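(* For every integer $m\ge 0$, the assignment $$\varphi_m(E^{[i]})=E^{[ip]}\,\Delta_T,\qquad \varphi_m(F^{[i]})=F^{[ip]}\,\Delta_T,\qquad \varphi_m\Big(\binom{H}{i}\Big)=\binom{H}{ip}\,\Delta_T\qquad(0\le i\le p^m)$$ on the generators of the $k$-algebra $U^{(m)}(\mathcal G)$ induces a well-defined map $\varphi_m:U^{(m)}(\mathcal G)\to U^{(m+1)}(\mathcal G)$, which is a (non-unital) morphism of $k$-algebras, i.e. it is $k$-linear and multiplicative, with $\varphi_m(1)=\Delta_T$. Moreover $\varphi_m$ splits the Frobenius morphism $Fr:U^{(m+1)}(\mathcal G)\to U^{(m)}(\mathcal G)$, i.e. $Fr\circ\varphi_m=\mathrm{id}_{U^{(m)}(\mathcal G)}$.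
   Context: Let $p>2$ be a prime, $k=\mathbb F_p$, $G=SL_2$ over $k$, $\mathcal G$ its Lie algebra with standard basis $(E,F,H)$. $\mathrm{Dist}(G)=U(\mathcal G)$ is the algebra of distributions of $G$, identified with the reduction mod $p$ of the Kostant $\mathbb Z$-form of the enveloping algebra of $sl_2$; it contains the divided powers $E^{[n]}=E^n/n!$, $F^{[n]}=F^n/n!$ and $\binom{H}{n}=H(H-1)\cdots(H-n+1)/n!$ ($n\ge 0$), and has $k$-basis $E^{[a]}\binom{H}{b}F^{[c]}$ $(a,b,c\ge 0)$. Let $\mathrm{Dist}(G)_n$ be the subspace of distributions of order $\le n$ (spanned by the basis elements with $a+b+c\le n$), and let $\epsilon_G\in\mathrm{Dist}(G)$ denote the unit of $\mathrm{Dist}(G)$ (the co-unit of the coordinate ring of $G$, viewed as a distribution). For $m\ge 0$, the enveloping algebra of level $m$ is the quotient $$U^{(m)}(\mathcal G)=\mathbb T_k(\mathrm{Dist}(G)_{2p^m-1})/I$$ of the tensor algebra over $k$ by the two-sided ideal $I$ generated by the elements $\lambda-\lambda\epsilon_G$ ($\lambda\in k$), $\mu\otimes\mu'-\mu'\otimes\mu-[\mu,\mu']$ and $\mu''\otimes\mu-\mu''\mu$ for $\mu,\mu'\in\mathrm{Dist}(G)_{p^m}$, $\mu''\in\mathrm{Dist}(G)_{p^m-1}$ (the bracket and the products $\mu''\mu$ being computed in $\mathrm{Dist}(G)$). The algebra $U^{(0)}(\mathcal G)$ is the universal enveloping algebra, and $\mathrm{Dist}(G)$ is the inductive limit of the $U^{(m)}(\mathcal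 G)$. As a $k$-vector space $U^{(m)}(\mathcal G)$ is spanned by the elements $E^{[a]}(E^{[p^m]})^{a'}\binom{H}{b}\binom{H}{p^m}^{b'}F^{[c]}(F^{[p^m]})^{c'}$ with $0\le a,b,c\le p^m-1$, $a',b',c'\in\mathbb N$; in particular it is generated as an algebra by the images of $E^{[i]},\binom{H}{i},F^{[i]}$, $0\le i\le p^m$. The element $\Delta_T:=\sum_{i=0}^{p-1}(-1)^i\binom{H}{i}$ is of order $\le p-1$ and is viewed as an element of $U^{(m+1)}(\mathcal G)$. The Frobenius morphism $Fr:\mathrm{Dist}(G)\to\mathrm{Dist}(G)$ is the algebra morphism transpose to the usual Frobenius of $G$: it sends $E^{[n]}\mapsto E^{[n/p]}$, $F^{[n]}\mapsto F^{[n/p]}$, $\binom{H}{n}\mapsto\binom{H}{n/p}$ if $p\mid n$, and these elements to $0$ if $p\nmid n$. It induces, by the same formulas on the generators ($0\le n\le p^{m+1}$), algebra morphisms $Fr:U^{(m+1)}(\mathcal G)\to U^{(m)}(\mathcal G)$. *)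

theory Defs
  imports
    "HOL-Algebra.QuotRing"
    "HOL-Algebra.Module"
    "HOL-Algebra.Generated_Rings"
    "HOL-Library.Poly_Mapping"
    "HOL-Analysis.Determinants"
    "Berlekamp_Zassenhaus.Finite_Field"
begin

text \<open>
  Not necessarily commutative algebras over a field are given by records of type
  \<open>('k, 'a) module\<close>, which carry a ring structure and a scalar multiplication; the scalars
  are all elements of the type \<open>'k\<close>.
\<close>

section \<open>Morphisms, spans and quotients of algebras\<close>

definition nonunital_alg_hom ::
    "('k, 'a) module \<Rightarrow> ('k, 'b) module \<Rightarrow> ('a \<Rightarrow> 'b) set" where
  "nonunital_alg_hom A B = {f \<in> carrier A \<rightarrow> carrier B.
     (\<forall>x\<in>carrier A. \<forall>y\<in>carrier A. f (x \<oplus>\<^bsub>A\<^esub> y) = f x \<oplus>\<^bsub>B\<^esub> f y) \<and>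
     (\<forall>c. \<forall>x\<in>carrier A. f (c \<odot>\<^bsub>A\<^esub> x) = c \<odot>\<^bsub>B\<^esub> f x) \<and>
     (\<forall>x\<in>carrier A. \<forall>y\<in>carrier A. f (x \<otimes>\<^bsub>A\<^esub> y) = f x \<otimes>\<^bsub>B\<^esub> f y)}"

definition alg_hom :: "('k, 'a) module \<Rightarrow> ('k, 'b) module \<Rightarrow> ('a \<Rightarrow> 'b) set" where
  "alg_hom A B = {f \<in> nonunital_alg_hom A B. f \<one>\<^bsub>A\<^esub> = \<one>\<^bsub>B\<^esub>}"

inductive_set lin_span :: "('k, 'a) module \<Rightarrow> 'a set \<Rightarrow> 'a set" for A S where
  zero: "\<zero>\<^bsub>A\<^esub> \<in> lin_span A S"
| base: "x \<in> S \<Longrightarrow> x \<in> lin_span A S"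
| add: "x \<in> lin_span A S \<Longrightarrow> y \<in> lin_span A S \<Longrightarrow> x \<oplus>\<^bsub>A\<^esub> y \<in> lin_span A S"
| smult: "x \<in> lin_span A S \<Longrightarrow> c \<odot>\<^bsub>A\<^esub> x \<in> lin_span A S"

definition quot_algebra :: "('k, 'a) module \<Rightarrow> 'a set \<Rightarrow> ('k, 'a set) module" where
  "quot_algebra A I =
     ring.extend (A Quot I) (module.fields (\<lambda>c X. \<Union>x\<in>X. I +>\<^bsub>A\<^esub> (c \<odot>\<^bsub>A\<^esub> x)))"

section \<open>Free, tensor and enveloping algebras\<close>

text \<open>
  Words form a monoid under concatenation, so that \<open>'x list \<Rightarrow>\<^sub>0 'k\<close> with the
  convolution product of \<^theory>\<open>HOL-Library.Poly_Mapping\<close> is the free associative algebra.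
\<close>

instantiation list :: (type) monoid_add
begin
definition zero_list :: "'a list" where "zero_list = []"
definition plus_list :: "'a list \<Rightarrow> 'a list \<Rightarrow> 'a list" where "plus_list = append"
instance by standard (simp_all add: zero_list_def plus_list_def)
end

definition free_algebra :: "'x set \<Rightarrow> ('k::field, 'x list \<Rightarrow>\<^sub>0 'k) module" where
  "free_algebra X = \<lparr>carrier = {f. Poly_Mapping.keys f \<subseteq> lists X},
     monoid.mult = (*), one = 1, zero = 0, add = (+),
     module.smult = (\<lambda>c. Poly_Mapping.map ((*) c))\<rparr>"

definition free_gen :: "'x \<Rightarrow> ('x list \<Rightarrow>\<^sub>0 'k::field)" where
  "free_gen x = Poly_Mapping.single [x] 1"

text \<open>
  The tensor algebra of the vector space \<open>V\<close>, of which only the additive structure and the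
  scalar multiplication are used. A word \<open>[v\<^sub>1, \<dots>, v\<^sub>n]\<close> stands for
  \<open>v\<^sub>1 \<otimes> \<dots> \<otimes> v\<^sub>n\<close>, and the ideal below is spanned by the relations of
  multilinearity.
\<close>

type_synonym ('k, 'v) tensor = "('v list \<Rightarrow>\<^sub>0 'k) set"

definition tensor_ideal :: "('k::field, 'v) module \<Rightarrow> ('v list \<Rightarrow>\<^sub>0 'k) set" where
  "tensor_ideal V = Idl\<^bsub>free_algebra (carrier V)\<^esub>
     ({free_gen (v \<oplus>\<^bsub>V\<^esub> w) - (free_gen v + free_gen w) | v w. v \<in> carrier V \<and> w \<in> carrier V} \<union>
      {free_gen (c \<odot>\<^bsub>V\<^esub> v) - c \<odot>\<^bsub>free_algebra (carrier V)\<^esub> free_gen v | c v. v \<in> carrier V})"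

definition tensor_algebra :: "('k::field, 'v) module \<Rightarrow> ('k, ('k, 'v) tensor) module" where
  "tensor_algebra V = quot_algebra (free_algebra (carrier V)) (tensor_ideal V)"

definition tensor_incl :: "('k::field, 'v) module \<Rightarrow> 'v \<Rightarrow> ('k, 'v) tensor" where
  "tensor_incl V v = tensor_ideal V +>\<^bsub>free_algebra (carrier V)\<^esub> free_gen v"

text \<open>
  In the two definitions below, \<open>x \<otimes>\<^bsub>L\<^esub> y\<close> is the bracket of the Lie algebra \<open>L\<close>, and
  \<open>\<one>\<^bsub>L\<^esub>\<close> is irrelevant.
\<close>

definition env_ideal :: "('k::field, 'v) module \<Rightarrow> ('k, 'v) tensor set" where
  "env_ideal L = (let T = tensor_algebra L; \<iota> = tensor_incl L in
     Idl\<^bsub>T\<^esub> {(\<iota> x \<otimes>\<^bsub>T\<^esub> \<iota> y \<ominus>\<^bsub>T\<^esub> \<iota> y \<otimes>\<^bsub>T\<^esub> \<iota> x) \<ominus>\<^bsub>T\<^esub> \<iota> (x \<otimes>\<^bsub>L\<^esub> y) | x y.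
            x \<in> carrier L \<and> y \<in> carrier L})"

definition enveloping_algebra ::
    "('k::field, 'v) module \<Rightarrow> ('k, ('k, 'v) tensor set) module" where
  "enveloping_algebra L = quot_algebra (tensor_algebra L) (env_ideal L)"

definition env_incl :: "('k::field, 'v) module \<Rightarrow> 'v \<Rightarrow> ('k, 'v) tensor set" where
  "env_incl L x = env_ideal L +>\<^bsub>tensor_algebra L\<^esub> tensor_incl L x"

section \<open>The Kostant form of the enveloping algebra of \<open>sl\<^sub>2\<close>\<close>

definition sl2 :: "(rat, rat^2^2) module" where
  "sl2 = \<lparr>carrier = {A. trace A = 0}, monoid.mult = (\<lambda>A B. A ** B - B ** A), one = undefined,
     zero = 0, add = (+), module.smult = (\<lambda>c A. \<chi> i j. c * A $ i $ j)\<rparr>"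

type_synonym usl2 = "(rat, rat^2^2) tensor set"

definition Usl2 :: "(rat, usl2) module" where
  "Usl2 = enveloping_algebra sl2"

definition E_Q :: usl2 where "E_Q = env_incl sl2 (vector [vector [0, 1], vector [0, 0]])"
definition F_Q :: usl2 where "F_Q = env_incl sl2 (vector [vector [0, 0], vector [1, 0]])"
definition H_Q :: usl2 where "H_Q = env_incl sl2 (vector [vector [1, 0], vector [0, - 1]])"

definition divided_power :: "(rat, 'a) module \<Rightarrow> 'a \<Rightarrow> nat \<Rightarrow> 'a" where
  "divided_power A x n = (1 / fact n) \<odot>\<^bsub>A\<^esub> (x [^]\<^bsub>A\<^esub> n)"

primrec falling_factorial :: "(rat, 'a) module \<Rightarrow> 'a \<Rightarrow> nat \<Rightarrow> 'a" where
  "falling_factorial A x 0 = \<one>\<^bsub>A\<^esub>"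
| "falling_factorial A x (Suc n) =
     falling_factorial A x n \<otimes>\<^bsub>A\<^esub> (x \<ominus>\<^bsub>A\<^esub> of_nat n \<odot>\<^bsub>A\<^esub> \<one>\<^bsub>A\<^esub>)"

definition binomial_elt :: "(rat, 'a) module \<Rightarrow> 'a \<Rightarrow> nat \<Rightarrow> 'a" where
  "binomial_elt A x n = (1 / fact n) \<odot>\<^bsub>A\<^esub> falling_factorial A x n"

definition kostant_form :: "usl2 set" where
  "kostant_form = generate_ring Usl2
     (range (divided_power Usl2 E_Q) \<union> range (divided_power Usl2 F_Q))"

section \<open>The algebra of distributions\<close>

text \<open>
  Here \<open>'p mod_ring\<close> is the prime field with \<open>p = CARD('p)\<close> elements. The reduction mod
  \<open>p\<close> of the Kostant form is its quotient by its multiples of \<open>p\<close>. The type of the classes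
  does not mention \<open>p\<close>, hence the explicit argument \<open>p\<close> of the distributions below.
\<close>

type_synonym dist = "usl2 set"

definition kostant_multiples :: "nat \<Rightarrow> usl2 set" where
  "kostant_multiples p = {of_nat p \<odot>\<^bsub>Usl2\<^esub> x | x. x \<in> kostant_form}"

definition Dist :: "('p::prime_card mod_ring, dist) module" where
  "Dist = (let I = kostant_multiples CARD('p) in
     ring.extend (Usl2\<lparr>carrier := kostant_form\<rparr> Quot I)
       (module.fields (\<lambda>c X. \<Union>x\<in>X. I +>\<^bsub>Usl2\<^esub> (of_int (to_int_mod_ring c) \<odot>\<^bsub>Usl2\<^esub> x))))"

definition dist_class :: "nat \<Rightarrow> usl2 \<Rightarrow> dist" where
  "dist_class p x = kostant_multiples p +>\<^bsub>Usl2\<^esub> x"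

definition dist_E :: "nat \<Rightarrow> nat \<Rightarrow> dist" where
  "dist_E p n = dist_class p (divided_power Usl2 E_Q n)"

definition dist_F :: "nat \<Rightarrow> nat \<Rightarrow> dist" where
  "dist_F p n = dist_class p (divided_power Usl2 F_Q n)"

definition dist_H :: "nat \<Rightarrow> nat \<Rightarrow> dist" where
  "dist_H p n = dist_class p (binomial_elt Usl2 H_Q n)"

text \<open>
  The subspace of distributions of order at most \<open>n\<close>; only its vector space structure is
  meaningful, since it is not closed under the product.
\<close>

definition Dist_le :: "nat \<Rightarrow> ('p::prime_card mod_ring, dist) module" where
  "Dist_le n = (let D = (Dist :: ('p mod_ring, dist) module); p = CARD('p) in
     D\<lparr>carrier := lin_span D
       {(dist_E p a \<otimes>\<^bsub>D\<^esub> dist_H p b) \<otimes>\<^bsub>D\<^esub> dist_F p c | a b c. a + b + c \<le> n}\<rparr>)"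

section \<open>Enveloping algebras of higher level\<close>

type_synonym 'p ulevel = "('p mod_ring, dist) tensor set"

definition level_space :: "nat \<Rightarrow> ('p::prime_card mod_ring, dist) module" where
  "level_space m = Dist_le (2 * CARD('p) ^ m - 1)"

definition level_ideal :: "nat \<Rightarrow> 'p::prime_card ulevel" where
  "level_ideal m =
    (let p = CARD('p);
         D = (Dist :: ('p mod_ring, dist) module);
         V = (level_space m :: ('p mod_ring, dist) module);
         small = carrier (Dist_le (p ^ m - 1) :: ('p mod_ring, dist) module);
         gens = carrier (Dist_le (p ^ m) :: ('p mod_ring, dist) module);
         T = tensor_algebra V;
         \<iota> = tensor_incl V
     in Idl\<^bsub>T\<^esub>
       ({c \<odot>\<^bsub>T\<^esub> \<one>\<^bsub>T\<^esub> \<ominus>\<^bsub>T\<^esub> \<iota> (c \<odot>\<^bsub>D\<^esub> \<one>\<^bsub>D\<^esub>) | c. True} \<union>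
        {(\<iota> x \<otimes>\<^bsub>T\<^esub> \<iota> y \<ominus>\<^bsub>T\<^esub> \<iota> y \<otimes>\<^bsub>T\<^esub> \<iota> x) \<ominus>\<^bsub>T\<^esub> \<iota> (x \<otimes>\<^bsub>D\<^esub> y \<ominus>\<^bsub>D\<^esub> y \<otimes>\<^bsub>D\<^esub> x) | x y.
            x \<in> gens \<and> y \<in> gens} \<union>
        {\<iota> z \<otimes>\<^bsub>T\<^esub> \<iota> x \<ominus>\<^bsub>T\<^esub> \<iota> (z \<otimes>\<^bsub>D\<^esub> x) | z x. z \<in> small \<and> x \<in> gens}))"

definition U_level :: "nat \<Rightarrow> ('p::prime_card mod_ring, 'p ulevel) module" where
  "U_level m = quot_algebra (tensor_algebra (level_space m)) (level_ideal m)"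

definition level_class :: "nat \<Rightarrow> dist \<Rightarrow> 'p::prime_card ulevel" where
  "level_class m x =
     level_ideal m +>\<^bsub>tensor_algebra (level_space m)\<^esub> tensor_incl (level_space m) x"

definition level_E :: "nat \<Rightarrow> nat \<Rightarrow> 'p::prime_card ulevel" where
  "level_E m n = level_class m (dist_E CARD('p) n)"

definition level_F :: "nat \<Rightarrow> nat \<Rightarrow> 'p::prime_card ulevel" where
  "level_F m n = level_class m (dist_F CARD('p) n)"

definition level_H :: "nat \<Rightarrow> nat \<Rightarrow> 'p::prime_card ulevel" where
  "level_H m n = level_class m (dist_H CARD('p) n)"

definition Delta_T :: "nat \<Rightarrow> 'p::prime_card ulevel" where
  "Delta_T m = (let D = (Dist :: ('p mod_ring, dist) module); p = CARD('p) in
     level_class m (\<Oplus>\<^bsub>D\<^esub>i\<in>{0..p - 1}. ((- 1) ^ i :: 'p mod_ring) \<odot>\<^bsub>D\<^esub> dist_H p i))"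

text \<open>
  The Frobenius morphism from level \<open>m + 1\<close> to level \<open>m\<close>: the unique unital algebra
  morphism with the prescribed values on the generators (made \<open>extensional\<close>, since the values
  outside of the carrier carry no information).
\<close>

definition Frobenius :: "nat \<Rightarrow> 'p::prime_card ulevel \<Rightarrow> 'p ulevel" where
  "Frobenius m =
    (let p = CARD('p);
         A = (U_level (Suc m) :: ('p mod_ring, 'p ulevel) module);
         B = (U_level m :: ('p mod_ring, 'p ulevel) module)
     in THE f. f \<in> alg_hom A B \<and> f \<in> extensional (carrier A) \<and>
       (\<forall>n\<le>p ^ Suc m.
          f (level_E (Suc m) n) = (if p dvd n then level_E m (n div p) else \<zero>\<^bsub>B\<^esub>) \<and>
          f (level_F (Suc m) n) = (if p dvd n then level_F m (n div p) else \<zero>\<^bsub>B\<^esub>) \<and>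
          f (level_H (Suc m) n) = (if p dvd n then level_H m (n div p) else \<zero>\<^bsub>B\<^esub>)))"

text \<open>The assignment on the generators of level \<open>m\<close> that defines the splitting.\<close>

definition splits_on_generators ::
    "nat \<Rightarrow> ('p::prime_card ulevel \<Rightarrow> 'p ulevel) \<Rightarrow> bool" where
  "splits_on_generators m f =
    (let p = CARD('p);
         B = (U_level (Suc m) :: ('p mod_ring, 'p ulevel) module);
         \<Delta> = Delta_T (Suc m)
     in \<forall>i\<le>p ^ m.
          f (level_E m i) = level_E (Suc m) (i * p) \<otimes>\<^bsub>B\<^esub> \<Delta> \<and>
          f (level_F m i) = level_F (Suc m) (i * p) \<otimes>\<^bsub>B\<^esub> \<Delta> \<and>
          f (level_H m i) = level_H (Suc m) (i * p) \<otimes>\<^bsub>B\<^esub> \<Delta>)"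

end

theory Submission imports Defs begin

text \<open>
  The enveloping algebra of \<open>sl\<^sub>2\<close> acts by left multiplication on the sums of elements
  \<open>E\<^bsup>[a]\<^esup> F\<^bsup>[c]\<^esup> 1\<^sub>l\<close> of its idempotented form, and an element is determined by its symbol, the family
  of coefficients of its image under this action on the unit. Modulo \<open>p\<close>, a distribution becomes a function of
  \<open>(a, c, l)\<close>, and its order is read off from the degrees in \<open>l\<close>. On symbols the Frobenius morphism
  is the restriction along \<open>(a, c, l) \<mapsto> (pa, pc, pl)\<close>; extension by zero is a multiplicative
  section of it which sends the unit to \<open>\<Delta>\<^sub>T\<close>, the indicator of the weights divisible by \<open>p\<close>.

  Since \<open>\<Delta>\<^sub>T\<close> has order less than \<open>p\<^bsup>m+1\<^esup>\<close>, the relations of level \<open>m + 1\<close> cover products with it, and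
  all relations required of the images follow from those of level \<open>m + 1\<close>, except for the
  commutators of the three elements of order exactly \<open>p\<^sup>m\<close>. Among these only \<open>[F\<^bsup>[q]\<^esup>, E\<^bsup>[q]\<^esup>] \<Delta>\<^sub>T\<close>,
  \<open>q = p\<^bsup>m+1\<^esup>\<close>, is not a product of an element of order at most \<open>q\<close> with \<open>\<Delta>\<^sub>T\<close>; it is computed termwise, where
  the terms that would exceed the order \<open>2q - 1\<close> vanish.
\<close>

section \<open>Algebras over a field and their quotients\<close>

text \<open>\<open>U_level m\<close> is presented by all of \<open>level_space m\<close>, so a
  morphism out of it needs a value on every distribution of order below 2p^m, not only on the
  generators. This is why the splitting is built on the whole of Dist(G), where it is multiplicative
  without any bound on orders; for the levels there only remains the question when a product of
  classes is the class of the product, which depends on orders alone. Orders survive reduction mod p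
  because the degree in l is measured by iterated differences and not by coefficients of
  polynomials: the p-th difference of f is f(l+p) - f(l), so restriction to multiples of p divides a
  degree bound by p, and extension by zero multiplies it by p. Elements of order between q = p^m and
  2q are handled by factoring them, up to lower order, into an element of order q and a smaller one.
  This needs a binomial coefficient that is nonzero mod p, and it is found through base p digits,
  since a choose p^k is congruent to the k-th digit of a.\<close>

locale kalg = ring A for A :: "('k::field, 'a) module" (structure) +
  assumes smult_closed [simp, intro]: "x \<in> carrier A \<Longrightarrow> c \<odot> x \<in> carrier A"
    and smult_l_distr: "x \<in> carrier A \<Longrightarrow> (c + d) \<odot> x = c \<odot> x \<oplus> d \<odot> x"
    and smult_r_distr: "x \<in> carrier A \<Longrightarrow> y \<in> carrier A \<Longrightarrow> c \<odot> (x \<oplus> y) = c \<odot> x \<oplus> c \<odot> y"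
    and smult_assoc1: "x \<in> carrier A \<Longrightarrow> (c * d) \<odot> x = c \<odot> (d \<odot> x)"
    and smult_one: "x \<in> carrier A \<Longrightarrow> 1 \<odot> x = x"
    and smult_mult1: "x \<in> carrier A \<Longrightarrow> y \<in> carrier A \<Longrightarrow> (c \<odot> x) \<otimes> y = c \<odot> (x \<otimes> y)"
    and smult_mult2: "x \<in> carrier A \<Longrightarrow> y \<in> carrier A \<Longrightarrow> x \<otimes> (c \<odot> y) = c \<odot> (x \<otimes> y)"
begin

lemma smult_zero_right [simp]: "c \<odot> \<zero> = \<zero>"
  using smult_r_distr[of \<zero> \<zero> c] add.l_cancel_one[of "c \<odot> \<zero>" "c \<odot> \<zero>"] by auto

lemma smult_zero_left [simp]: "x \<in> carrier A \<Longrightarrow> 0 \<odot> x = \<zero>"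
  using smult_l_distr[of x 0 0] add.l_cancel_one[of "0 \<odot> x" "0 \<odot> x"] by auto

lemma smult_minus1: "x \<in> carrier A \<Longrightarrow> (- 1) \<odot> x = \<ominus> x"
  using smult_l_distr[of x 1 "-1"] by (metis add.inv_closed add.inv_equality add.m_comm
      add.right_inverse smult_closed smult_one smult_zero_left)

text \<open>Scalars act as multiplication by \<open>c \<odot> \<one>\<close>, so the ring ideals
  used for the quotients are automatically subspaces.\<close>

lemma ideal_smult: "ideal I A \<Longrightarrow> x \<in> I \<Longrightarrow> c \<odot> x \<in> I"
  using ideal.I_l_closed[of I A x "c \<odot> \<one>"] additive_subgroup.a_Hcarr[of I A x] ideal.axioms(1)[of I A]
  by (auto simp: smult_mult1)

end

text \<open>\<open>quot_algebra A I\<close> and \<open>A Quot I\<close> have the same ring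
  operations but different record types, so the ring axioms have to be transported.\<close>

lemma ring_cong:
  assumes "ring R" "carrier S = carrier R" "monoid.mult S = monoid.mult R" "one S = one R"
    "ring.add S = ring.add R" "ring.zero S = ring.zero R"
  shows "ring S"
proof -
  interpret R: ring R by fact
  show ?thesis
  proof (intro ringI abelian_groupI monoidI)
    show "\<exists>y\<in>carrier S. y \<oplus>\<^bsub>S\<^esub> x = \<zero>\<^bsub>S\<^esub>" if "x \<in> carrier S" for x
      using that assms by (auto intro!: bexI[of _ "\<ominus>\<^bsub>R\<^esub> x"] simp: R.l_neg)
  qed (auto simp: assms R.a_ac R.m_assoc R.l_distr R.r_distr)
qed

section \<open>Quotients of algebras by ideals and their universal property\<close>

context
  fixes A :: "('k::field, 'a) module" (structure) and I
  assumes A: "kalg A" and I: "ideal I A"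
begin

interpretation kalg A by (fact A)
interpretation ideal I A by (fact I)

lemma quot_algebra_sel:
  "one (quot_algebra A I) = I +> \<one>"
  "zero (quot_algebra A I) = I"
  by (simp_all add: quot_algebra_def ring.defs module.defs FactRing_def)

lemma quot_carrierI: "x \<in> carrier A \<Longrightarrow> I +> x \<in> carrier (quot_algebra A I)"
  by (auto simp: quot_algebra_def ring.defs module.defs FactRing_def A_RCOSETS_defs a_r_coset_def)

lemma quot_carrierE: "X \<in> carrier (quot_algebra A I) \<Longrightarrow> \<exists>x\<in>carrier A. X = I +> x"
  by (auto simp: quot_algebra_def ring.defs module.defs FactRing_def A_RCOSETS_defs a_r_coset_def)

lemma quot_mult: "x \<in> carrier A \<Longrightarrow> y \<in> carrier A \<Longrightarrow>
    (I +> x) \<otimes>\<^bsub>quot_algebra A I\<^esub> (I +> y) = I +> (x \<otimes> y)"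
  by (simp add: quot_algebra_def ring.defs module.defs FactRing_def rcoset_mult_add)

lemma quot_add: "x \<in> carrier A \<Longrightarrow> y \<in> carrier A \<Longrightarrow>
    (I +> x) \<oplus>\<^bsub>quot_algebra A I\<^esub> (I +> y) = I +> (x \<oplus> y)"
  by (simp add: quot_algebra_def ring.defs module.defs FactRing_def a_rcos_sum)

lemma coset_eq_iff: "x \<in> carrier A \<Longrightarrow> y \<in> carrier A \<Longrightarrow> I +> x = I +> y \<longleftrightarrow> x \<ominus> y \<in> I"
  using quotient_eq_iff_same_a_r_cos[OF I] by auto

text \<open>The union that defines the scalar action runs over all representatives, and all of them
  give the same coset because the ideal is a subspace.\<close>

lemma quot_smult: assumes x: "x \<in> carrier A"
  shows "c \<odot>\<^bsub>quot_algebra A I\<^esub> (I +> x) = I +> (c \<odot> x)"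
proof -
  have "I +> (c \<odot> y) = I +> (c \<odot> x)" if "y \<in> I +> x" for y
  proof -
    from that obtain i where i: "i \<in> I" "y = i \<oplus> x" by (auto simp: a_r_coset_def')
    have y: "y \<in> carrier A" using i x by auto
    have i': "i \<in> carrier A" using i(1) by auto
    have "c \<odot> y \<ominus> c \<odot> x = c \<odot> i"
      unfolding i(2) smult_r_distr[OF i' x] using i' x r_neg[of "c \<odot> x"] a_assoc[of "c \<odot> i" "c \<odot> x" "\<ominus> (c \<odot> x)"]
      by (simp add: a_minus_def)
    with coset_eq_iff[of "c \<odot> y" "c \<odot> x"] x y ideal_smult[OF I i(1)] show ?thesis by simp
  qed
  moreover have "x \<in> I +> x" using x by (rule a_rcos_self)
  ultimately have "(\<Union>y\<in>I +> x. I +> (c \<odot> y)) = I +> (c \<odot> x)"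
    by (intro SUP_eq_const) blast+
  then show ?thesis
    by (simp add: quot_algebra_def ring.defs module.defs)
qed

lemma quot_kalg: "kalg (quot_algebra A I)"
proof -
  have r: "ring (quot_algebra A I)"
    by (rule ring_cong[OF quotient_is_ring]) (simp_all add: quot_algebra_def ring.defs module.defs)
  show ?thesis
    by (intro kalg.intro[OF r] kalg_axioms.intro)
      (auto dest!: quot_carrierE simp: quot_smult quot_add quot_mult smult_l_distr smult_r_distr
         smult_assoc1 smult_one smult_mult1 smult_mult2 quot_carrierI)
qed

lemma quot_proj_hom: "(\<lambda>x. I +> x) \<in> alg_hom A (quot_algebra A I)"
  by (auto simp: alg_hom_def nonunital_alg_hom_def quot_carrierI quot_mult quot_add quot_smult quot_algebra_sel)

lemma quot_eq_zero_iff: "x \<in> carrier A \<Longrightarrow> I +> x = \<zero>\<^bsub>quot_algebra A I\<^esub> \<longleftrightarrow> x \<in> I"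
  using a_rcos_const a_rcos_self by (auto simp: quot_algebra_sel)

end

lemma alg_homD:
  assumes "f \<in> nonunital_alg_hom A B"
  shows "x \<in> carrier A \<Longrightarrow> f x \<in> carrier B"
    and "x \<in> carrier A \<Longrightarrow> y \<in> carrier A \<Longrightarrow> f (x \<oplus>\<^bsub>A\<^esub> y) = f x \<oplus>\<^bsub>B\<^esub> f y"
    and "x \<in> carrier A \<Longrightarrow> y \<in> carrier A \<Longrightarrow> f (x \<otimes>\<^bsub>A\<^esub> y) = f x \<otimes>\<^bsub>B\<^esub> f y"
    and "x \<in> carrier A \<Longrightarrow> f (c \<odot>\<^bsub>A\<^esub> x) = c \<odot>\<^bsub>B\<^esub> f x"
  using assms by (auto simp: nonunital_alg_hom_def)

lemma alg_hom_nonunital: "f \<in> alg_hom A B \<Longrightarrow> f \<in> nonunital_alg_hom A B"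
  by (simp add: alg_hom_def)

lemma alg_hom_one: "f \<in> alg_hom A B \<Longrightarrow> f \<one>\<^bsub>A\<^esub> = \<one>\<^bsub>B\<^esub>"
  by (simp add: alg_hom_def)

lemma alg_hom_zero: assumes "kalg A" "kalg B" "f \<in> nonunital_alg_hom A B"
  shows "f \<zero>\<^bsub>A\<^esub> = \<zero>\<^bsub>B\<^esub>"
proof -
  interpret A: kalg A by fact
  interpret B: kalg B by fact
  show ?thesis using alg_homD(4)[OF assms(3), of "\<zero>\<^bsub>A\<^esub>" 0] alg_homD(1)[OF assms(3)] by simp
qed

lemma alg_hom_uminus: assumes "kalg A" "kalg B" "f \<in> nonunital_alg_hom A B" "x \<in> carrier A"
  shows "f (\<ominus>\<^bsub>A\<^esub> x) = \<ominus>\<^bsub>B\<^esub> f x"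
proof -
  interpret A: kalg A by fact
  interpret B: kalg B by fact
  show ?thesis using alg_homD(4)[OF assms(3), of x "-1"] alg_homD(1)[OF assms(3)] assms(4)
    by (simp add: A.smult_minus1 B.smult_minus1)
qed

lemma alg_hom_minus: assumes "kalg A" "kalg B" "f \<in> nonunital_alg_hom A B" "x \<in> carrier A" "y \<in> carrier A"
  shows "f (x \<ominus>\<^bsub>A\<^esub> y) = f x \<ominus>\<^bsub>B\<^esub> f y"
proof -
  interpret A: kalg A by fact
  show ?thesis using alg_hom_uminus[OF assms(1-3,5)] alg_homD(2)[OF assms(3,4), of "\<ominus>\<^bsub>A\<^esub> y"] assms(5)
    by (simp add: a_minus_def)
qed

lemma nonunital_alg_hom_comp:
  "f \<in> nonunital_alg_hom A B \<Longrightarrow> g \<in> nonunital_alg_hom B C \<Longrightarrow> (\<lambda>x. g (f x)) \<in> nonunital_alg_hom A C"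
  by (auto simp: nonunital_alg_hom_def Pi_iff)

lemma genideal_kernel:
  assumes A: "kalg A" and B: "kalg B" and f: "f \<in> nonunital_alg_hom A B"
    and S: "S \<subseteq> carrier A" "\<And>s. s \<in> S \<Longrightarrow> f s = \<zero>\<^bsub>B\<^esub>" and x: "x \<in> Idl\<^bsub>A\<^esub> S"
  shows "f x = \<zero>\<^bsub>B\<^esub>"
proof -
  interpret A: kalg A by fact
  interpret B: kalg B by fact
  note hom = alg_homD[OF f]
  let ?K = "{x \<in> carrier A. f x = \<zero>\<^bsub>B\<^esub>}"
  have z: "f \<zero>\<^bsub>A\<^esub> = \<zero>\<^bsub>B\<^esub>" using alg_hom_zero[OF A B f] .
  have "ideal ?K A"
    by (rule idealI[OF A.ring_axioms])
       (auto simp: hom z A.add.m_closed alg_hom_uminus[OF A B f] a_inv_def[symmetric] intro!: A.add.subgroupI)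
  then have "Idl\<^bsub>A\<^esub> S \<subseteq> ?K" using S by (intro A.genideal_minimal) auto
  with x show ?thesis by auto
qed

lemma quot_lift:
  assumes A: "kalg A" and B: "kalg B" and f: "f \<in> alg_hom A B"
    and S: "S \<subseteq> carrier A" "\<And>s. s \<in> S \<Longrightarrow> f s = \<zero>\<^bsub>B\<^esub>"
  shows "\<exists>g \<in> alg_hom (quot_algebra A (Idl\<^bsub>A\<^esub> S)) B.
           \<forall>x\<in>carrier A. g (Idl\<^bsub>A\<^esub> S +>\<^bsub>A\<^esub> x) = f x"
proof -
  interpret A: kalg A by fact
  interpret B: kalg B by fact
  let ?I = "Idl\<^bsub>A\<^esub> S"
  let ?Q = "quot_algebra A ?I"
  have I: "ideal ?I A" by (rule A.genideal_ideal[OF S(1)])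
  interpret I: ideal ?I A by fact
  note f' = alg_hom_nonunital[OF f]
  note hom = alg_homD[OF f']
  \<comment> \<open>A representative of the coset is chosen; the next step shows that
    \<open>f\<close> does not depend on it, since two representatives differ by an element of the
    kernel.\<close>
  define g where "g X = f (SOME x. x \<in> carrier A \<and> X = ?I +>\<^bsub>A\<^esub> x)" for X
  have g: "g (?I +>\<^bsub>A\<^esub> x) = f x" if x: "x \<in> carrier A" for x
  proof -
    define y where "y = (SOME y. y \<in> carrier A \<and> ?I +>\<^bsub>A\<^esub> x = ?I +>\<^bsub>A\<^esub> y)"
    have y: "y \<in> carrier A" "?I +>\<^bsub>A\<^esub> x = ?I +>\<^bsub>A\<^esub> y"
      using someI[of "\<lambda>y. y \<in> carrier A \<and> ?I +>\<^bsub>A\<^esub> x = ?I +>\<^bsub>A\<^esub> y" x] x unfolding y_def by auto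
    then have "x \<ominus>\<^bsub>A\<^esub> y \<in> ?I" using coset_eq_iff[OF A I x y(1)] by simp
    then have "f (x \<ominus>\<^bsub>A\<^esub> y) = \<zero>\<^bsub>B\<^esub>" using genideal_kernel[OF A B f' S] by simp
    then have "f x = f y" using alg_hom_minus[OF A B f' x y(1)] hom(1)[OF x] hom(1)[OF y(1)] by simp
    then show ?thesis unfolding g_def y_def by simp
  qed
  have "g \<in> alg_hom ?Q B"
    unfolding alg_hom_def nonunital_alg_hom_def
    by (auto dest!: quot_carrierE[OF A I] simp: g hom quot_add[OF A I] quot_mult[OF A I] quot_smult[OF A I]
        quot_algebra_sel[OF A I] alg_hom_one[OF f])
  with g show ?thesis by auto
qed

section \<open>Free algebras\<close>

lemma free_algebra_sel [simp]:
  "carrier (free_algebra X) = {f. Poly_Mapping.keys f \<subseteq> lists X}"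
  "monoid.mult (free_algebra X) = (*)" "one (free_algebra X) = 1"
  "zero (free_algebra X) = 0" "add (free_algebra X) = (+)"
  "module.smult (free_algebra X) = (\<lambda>c. Poly_Mapping.map ((*) c))"
  by (simp_all add: free_algebra_def)

lemma poly_mapping_sum_induct [case_names zero single add]:
  fixes f :: "'a \<Rightarrow>\<^sub>0 'b::comm_monoid_add"
  assumes "P 0" and "\<And>w c. P (Poly_Mapping.single w c)" and "\<And>x y. P x \<Longrightarrow> P y \<Longrightarrow> P (x + y)"
  shows "P f"
proof -
  have "f = (\<Sum>w\<in>Poly_Mapping.keys f. Poly_Mapping.single w (Poly_Mapping.lookup f w))"
    by (rule poly_mapping_eqI) (auto simp: lookup_sum lookup_single when_def in_keys_iff)
  moreover have "P (\<Sum>w\<in>S. Poly_Mapping.single w (Poly_Mapping.lookup f w))" if "finite S" for S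
    using that by (induction S) (auto intro: assms)
  ultimately show ?thesis by (metis finite_keys)
qed

text \<open>Summing over parts of the support keeps every intermediate element inside the free
  algebra on \<open>X\<close>, which \<open>poly_mapping_sum_induct\<close> does not
  guarantee.\<close>

lemma words_induct [consumes 1, case_names zero single add]:
  fixes g :: "'x list \<Rightarrow>\<^sub>0 'k::comm_monoid_add"
  assumes g: "Poly_Mapping.keys g \<subseteq> lists X" and "P 0"
    and "\<And>w c. w \<in> lists X \<Longrightarrow> P (Poly_Mapping.single w c)"
    and "\<And>x y. Poly_Mapping.keys x \<subseteq> lists X \<Longrightarrow> Poly_Mapping.keys y \<subseteq> lists X \<Longrightarrow> P x \<Longrightarrow> P y \<Longrightarrow> P (x + y)"
  shows "P g"
proof -
  let ?s = "\<lambda>S. (\<Sum>w\<in>S. Poly_Mapping.single w (Poly_Mapping.lookup g w))"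
  have "g = ?s (Poly_Mapping.keys g)"
    by (rule poly_mapping_eqI) (auto simp: lookup_sum lookup_single when_def in_keys_iff)
  moreover have "Poly_Mapping.keys (?s S) \<subseteq> lists X \<and> P (?s S)" if "finite S" "S \<subseteq> lists X" for S
    using that
  proof (induction S)
    case (insert w S)
    moreover have "Poly_Mapping.keys (Poly_Mapping.single w (Poly_Mapping.lookup g w)) \<subseteq> lists X"
      using insert by auto
    ultimately show ?case using keys_add[of "Poly_Mapping.single w (Poly_Mapping.lookup g w)" "?s S"]
      by (auto intro!: assms(3,4))
  qed (auto intro: assms)
  ultimately show ?thesis using g by (metis finite_keys)
qed

lemma mult_closed_words: "Poly_Mapping.keys (f * g) \<subseteq> lists X"
  if "Poly_Mapping.keys f \<subseteq> lists X" "Poly_Mapping.keys g \<subseteq> lists X" for f g :: "'x list \<Rightarrow>\<^sub>0 'k::semiring_0"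
  using keys_mult[of f g] that by (fastforce simp: plus_list_def)

lemma free_kalg: "kalg (free_algebra X :: ('k::field, 'x list \<Rightarrow>\<^sub>0 'k) module)"
proof -
  let ?F = "free_algebra X :: ('k::field, 'x list \<Rightarrow>\<^sub>0 'k) module"
  have mult: "Poly_Mapping.keys (f * g) \<subseteq> lists X"
    if "Poly_Mapping.keys f \<subseteq> lists X" "Poly_Mapping.keys g \<subseteq> lists X" for f g :: "'x list \<Rightarrow>\<^sub>0 'k"
    using that by (rule mult_closed_words)
  have add: "Poly_Mapping.keys (f + g) \<subseteq> lists X"
    if "Poly_Mapping.keys f \<subseteq> lists X" "Poly_Mapping.keys g \<subseteq> lists X" for f g :: "'x list \<Rightarrow>\<^sub>0 'k"
    using keys_add[of f g] that by blast
  have r: "ring ?F"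
  proof (intro ringI abelian_groupI monoidI)
    show "\<exists>y\<in>carrier ?F. y \<oplus>\<^bsub>?F\<^esub> x = \<zero>\<^bsub>?F\<^esub>" if "x \<in> carrier ?F" for x
      using that by (intro bexI[of _ "- x"]) (auto simp: in_keys_iff)
  qed (use mult add in \<open>auto simp: algebra_simps zero_list_def\<close>)
  have sm: "Poly_Mapping.map ((*) c) f = Poly_Mapping.single 0 c * f" for c and f :: "'x list \<Rightarrow>\<^sub>0 'k"
    by (rule mult_map_scale_conv_mult)
  \<comment> \<open>Multiples of the empty word are central; this is what makes scalars compatible
    with the right factor of a product.\<close>
  have cen: "f * Poly_Mapping.single 0 c = Poly_Mapping.single 0 c * f" for c and f :: "'x list \<Rightarrow>\<^sub>0 'k"
  proof (induct f rule: poly_mapping_sum_induct)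
  qed (simp_all add: mult_single distrib_left distrib_right mult.commute)
  have smc: "Poly_Mapping.keys (Poly_Mapping.single 0 c * f) \<subseteq> lists X"
    if "Poly_Mapping.keys f \<subseteq> lists X" for c and f :: "'x list \<Rightarrow>\<^sub>0 'k"
    using that by (intro mult) (auto simp: zero_list_def)
  show ?thesis
  proof (intro kalg.intro[OF r] kalg_axioms.intro)
    fix x y :: "'x list \<Rightarrow>\<^sub>0 'k" and c
    show "x \<otimes>\<^bsub>?F\<^esub> (c \<odot>\<^bsub>?F\<^esub> y) = c \<odot>\<^bsub>?F\<^esub> (x \<otimes>\<^bsub>?F\<^esub> y)"
      by (simp add: sm mult.assoc[symmetric] cen)
    show "(c * d) \<odot>\<^bsub>?F\<^esub> x = c \<odot>\<^bsub>?F\<^esub> (d \<odot>\<^bsub>?F\<^esub> x)" for d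
      by (simp add: sm mult_single flip: mult.assoc)
  qed (auto simp: sm single_add mult_single distrib_left distrib_right mult.assoc dest: smc[THEN subsetD, rotated])
qed

definition word_val :: "('k::field, 'b) module \<Rightarrow> ('x \<Rightarrow> 'b) \<Rightarrow> 'x list \<Rightarrow> 'b" where
  "word_val B f w = foldr (\<lambda>x y. f x \<otimes>\<^bsub>B\<^esub> y) w \<one>\<^bsub>B\<^esub>"

definition free_lift :: "('k::field, 'b) module \<Rightarrow> ('x \<Rightarrow> 'b) \<Rightarrow> ('x list \<Rightarrow>\<^sub>0 'k) \<Rightarrow> 'b" where
  "free_lift B f g = finsum B (\<lambda>w. Poly_Mapping.lookup g w \<odot>\<^bsub>B\<^esub> word_val B f w) (Poly_Mapping.keys g)"

context
  fixes B :: "('k::field, 'b) module" (structure) and f :: "'x \<Rightarrow> 'b" and X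
  assumes B: "kalg B" and f: "\<And>x. x \<in> X \<Longrightarrow> f x \<in> carrier B"
begin

interpretation kalg B by (fact B)

lemma word_val_closed: "w \<in> lists X \<Longrightarrow> word_val B f w \<in> carrier B"
  by (induction w) (auto simp: word_val_def f)

lemma word_val_append: "v \<in> lists X \<Longrightarrow> w \<in> lists X \<Longrightarrow>
    word_val B f (v @ w) = word_val B f v \<otimes> word_val B f w"
  using word_val_closed by (induction v) (auto simp: word_val_def f m_assoc)

text \<open>Sums over different supports can be added termwise only after passing to a common finite
  index set.\<close>

lemma free_lift_superset:
  assumes "finite S" "Poly_Mapping.keys g \<subseteq> S" "S \<subseteq> lists X"
  shows "free_lift B f g = (\<Oplus>w\<in>S. Poly_Mapping.lookup g w \<odot> word_val B f w)"
  unfolding free_lift_def using assms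
  by (intro add.finprod_mono_neutral_cong_left)
     (auto simp: in_keys_iff word_val_closed subset_iff)

lemma free_lift_closed: "Poly_Mapping.keys g \<subseteq> lists X \<Longrightarrow> free_lift B f g \<in> carrier B"
  unfolding free_lift_def by (intro finsum_closed) (auto simp: word_val_closed subset_iff)

lemma free_lift_add:
  assumes "Poly_Mapping.keys g \<subseteq> lists X" "Poly_Mapping.keys h \<subseteq> lists X"
  shows "free_lift B f (g + h) = free_lift B f g \<oplus> free_lift B f h"
proof -
  let ?S = "Poly_Mapping.keys g \<union> Poly_Mapping.keys h"
  have 1: "(\<lambda>w. c w \<odot> word_val B f w) \<in> ?S \<rightarrow> carrier B" for c
    using assms word_val_closed by (auto simp: subset_iff)
  have 2: "free_lift B f (g + h) = (\<Oplus>w\<in>?S. Poly_Mapping.lookup (g + h) w \<odot> word_val B f w)"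
    using assms keys_add[of g h] by (intro free_lift_superset) auto
  have 3: "free_lift B f g = (\<Oplus>w\<in>?S. Poly_Mapping.lookup g w \<odot> word_val B f w)"
    using assms by (intro free_lift_superset) auto
  have 4: "free_lift B f h = (\<Oplus>w\<in>?S. Poly_Mapping.lookup h w \<odot> word_val B f w)"
    using assms by (intro free_lift_superset) auto
  have "(\<Oplus>w\<in>?S. Poly_Mapping.lookup (g + h) w \<odot> word_val B f w) =
      (\<Oplus>w\<in>?S. Poly_Mapping.lookup g w \<odot> word_val B f w \<oplus> Poly_Mapping.lookup h w \<odot> word_val B f w)"
    using assms 1 word_val_closed by (intro finsum_cong') (auto simp: lookup_add smult_l_distr subset_iff)
  also have "\<dots> = (\<Oplus>w\<in>?S. Poly_Mapping.lookup g w \<odot> word_val B f w) \<oplus>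
      (\<Oplus>w\<in>?S. Poly_Mapping.lookup h w \<odot> word_val B f w)"
    by (rule finsum_addf[OF 1 1])
  finally show ?thesis using 2 3 4 by simp
qed

lemma free_lift_single: "w \<in> lists X \<Longrightarrow> free_lift B f (Poly_Mapping.single w c) = c \<odot> word_val B f w"
  using free_lift_superset[of "{w}" "Poly_Mapping.single w c"] by (simp add: word_val_closed)

lemma free_lift_zero: "free_lift B f 0 = \<zero>"
  by (simp add: free_lift_def)

lemma free_lift_mult:
  assumes g: "Poly_Mapping.keys g \<subseteq> lists X" and h: "Poly_Mapping.keys h \<subseteq> lists X"
  shows "free_lift B f (g * h) = free_lift B f g \<otimes> free_lift B f h"
proof -
  note cl = mult_closed_words
  have 1: "free_lift B f (Poly_Mapping.single v c * h) = free_lift B f (Poly_Mapping.single v c) \<otimes> free_lift B f h"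
    if v: "v \<in> lists X" for v c
    using h
  proof (induction h rule: words_induct)
    case zero show ?case using v by (simp add: free_lift_zero free_lift_single word_val_closed)
  next
    case (single w d)
    then show ?case using v
      by (simp add: mult_single free_lift_single word_val_closed word_val_append plus_list_def
          smult_mult1 smult_mult2 flip: smult_assoc1) (simp add: mult.commute)
  next
    case (add x y)
    have "Poly_Mapping.keys (Poly_Mapping.single v c * x) \<subseteq> lists X" "Poly_Mapping.keys (Poly_Mapping.single v c * y) \<subseteq> lists X"
      using add v by (intro cl; simp)+
    with add v show ?case
      by (simp add: distrib_left free_lift_add free_lift_closed r_distr)
  qed
  show ?thesis using g
  proof (induction g rule: words_induct)
    case zero show ?case using h by (simp add: free_lift_zero free_lift_closed)
  next
    case (single w d) then show ?case using 1 by simp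
  next
    case (add x y)
    have "Poly_Mapping.keys (x * h) \<subseteq> lists X" "Poly_Mapping.keys (y * h) \<subseteq> lists X"
      using add h by (intro cl; simp)+
    with add h show ?case
      by (simp add: distrib_right free_lift_add free_lift_closed l_distr)
  qed
qed

lemma free_lift_smult:
  assumes g: "Poly_Mapping.keys g \<subseteq> lists X"
  shows "free_lift B f (Poly_Mapping.map ((*) c) g) = c \<odot> free_lift B f g"
  using free_lift_mult[of "Poly_Mapping.single [] c" g] free_lift_single[of "[]" c] g free_lift_closed[OF g]
  by (auto simp: mult_map_scale_conv_mult zero_list_def word_val_def smult_mult1)

lemma free_lift_hom: "free_lift B f \<in> alg_hom (free_algebra X) B"
  using free_lift_single[of "[]" 1]
  by (auto simp: alg_hom_def nonunital_alg_hom_def free_lift_closed free_lift_add free_lift_mult free_lift_smult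
      word_val_def smult_one zero_list_def simp flip: single_one)

lemma free_lift_gen: "x \<in> X \<Longrightarrow> free_lift B f (free_gen x) = f x"
  by (simp add: free_gen_def free_lift_single word_val_def f smult_one)

end


lemma free_gen_closed: "x \<in> X \<Longrightarrow> free_gen x \<in> carrier (free_algebra X)"
  by (simp add: free_gen_def)

lemma free_induct [consumes 1, case_names one gen add smult mult]:
  fixes g :: "'x list \<Rightarrow>\<^sub>0 'k::field" and X
  defines "F \<equiv> free_algebra X :: ('k, 'x list \<Rightarrow>\<^sub>0 'k) module"
  assumes g: "g \<in> carrier F" and "P \<one>\<^bsub>F\<^esub>"
    and "\<And>x. x \<in> X \<Longrightarrow> P (free_gen x)"
    and "\<And>x y. x \<in> carrier F \<Longrightarrow> y \<in> carrier F \<Longrightarrow> P x \<Longrightarrow> P y \<Longrightarrow> P (x \<oplus>\<^bsub>F\<^esub> y)"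
    and sm: "\<And>x c. x \<in> carrier F \<Longrightarrow> P x \<Longrightarrow> P (c \<odot>\<^bsub>F\<^esub> x)"
    and "\<And>x y. x \<in> carrier F \<Longrightarrow> y \<in> carrier F \<Longrightarrow> P x \<Longrightarrow> P y \<Longrightarrow> P (x \<otimes>\<^bsub>F\<^esub> y)"
  shows "P g"
proof -
  note as = assms(3-)[unfolded F_def free_algebra_sel mem_Collect_eq]
  from g have "Poly_Mapping.keys g \<subseteq> lists X" by (simp add: F_def)
  then show ?thesis
  proof (induction g rule: words_induct)
    case zero
    show ?case using as(4)[OF _ as(1), of 0] by (simp add: mult_map_scale_conv_mult zero_list_def)
  next
    case (single w c)
    then have "P (Poly_Mapping.single w 1)"
    proof (induction w)
      case Nil
      then show ?case using as(1) by (simp flip: zero_list_def)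
    next
      case (Cons x w)
      then have "P (free_gen x * Poly_Mapping.single w 1)"
        by (intro as) (auto simp: free_gen_def)
      then show ?case by (simp add: free_gen_def mult_single plus_list_def)
    qed
    then show ?case using as(4)[of "Poly_Mapping.single w 1" c] single by simp
  next
    case (add x y)
    then show ?case using as(3) by simp
  qed
qed

text \<open>The hypothesis \<open>ind\<close> is an induction principle of \<open>A\<close>,
  quantified over its predicate \<open>R\<close>. It is applied with \<open>R x\<close> being
  \<open>P\<close> of the coset of \<open>x\<close>, so that the same proof serves tensor algebras,
  as quotients of free algebras, and quotients of tensor algebras.\<close>

lemma quot_induct [consumes 3, case_names one gen add smult mult]:
  fixes A :: "('k::field, 'a) module"
  defines "Q I \<equiv> quot_algebra A I"
  assumes A: "kalg A" and I: "ideal I A" and u: "u \<in> carrier (Q I)"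
    and ind: "\<And>R x. x \<in> carrier A \<Longrightarrow> R \<one>\<^bsub>A\<^esub> \<Longrightarrow> (\<And>s. s \<in> S \<Longrightarrow> R s) \<Longrightarrow>
      (\<And>x y. x \<in> carrier A \<Longrightarrow> y \<in> carrier A \<Longrightarrow> R x \<Longrightarrow> R y \<Longrightarrow> R (x \<oplus>\<^bsub>A\<^esub> y)) \<Longrightarrow>
      (\<And>x c. x \<in> carrier A \<Longrightarrow> R x \<Longrightarrow> R (c \<odot>\<^bsub>A\<^esub> x)) \<Longrightarrow>
      (\<And>x y. x \<in> carrier A \<Longrightarrow> y \<in> carrier A \<Longrightarrow> R x \<Longrightarrow> R y \<Longrightarrow> R (x \<otimes>\<^bsub>A\<^esub> y)) \<Longrightarrow> R x"
    and one: "P \<one>\<^bsub>Q I\<^esub>"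
    and gen: "\<And>x. x \<in> S \<Longrightarrow> P (I +>\<^bsub>A\<^esub> x)"
    and add: "\<And>x y. x \<in> carrier (Q I) \<Longrightarrow> y \<in> carrier (Q I) \<Longrightarrow> P x \<Longrightarrow> P y \<Longrightarrow> P (x \<oplus>\<^bsub>Q I\<^esub> y)"
    and smult: "\<And>x c. x \<in> carrier (Q I) \<Longrightarrow> P x \<Longrightarrow> P (c \<odot>\<^bsub>Q I\<^esub> x)"
    and mult: "\<And>x y. x \<in> carrier (Q I) \<Longrightarrow> y \<in> carrier (Q I) \<Longrightarrow> P x \<Longrightarrow> P y \<Longrightarrow> P (x \<otimes>\<^bsub>Q I\<^esub> y)"
  shows "P u"
proof -
  obtain x where x: "x \<in> carrier A" "u = I +>\<^bsub>A\<^esub> x"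
    using quot_carrierE[OF A I] u by (auto simp: Q_def)
  have "P (I +>\<^bsub>A\<^esub> x)" using x(1)
  proof (rule ind)
    show "P (I +>\<^bsub>A\<^esub> \<one>\<^bsub>A\<^esub>)" using one by (simp add: Q_def quot_algebra_sel[OF A I])
  qed (use gen add smult mult in \<open>auto simp: Q_def quot_carrierI[OF A I]
      simp flip: quot_add[OF A I] quot_smult[OF A I] quot_mult[OF A I]\<close>)
  then show ?thesis by (simp add: x)
qed

section \<open>Tensor and enveloping algebras\<close>

locale tensor_space =
  fixes V :: "('k::field, 'v) module" (structure)
  assumes space_add: "v \<in> carrier V \<Longrightarrow> w \<in> carrier V \<Longrightarrow> v \<oplus> w \<in> carrier V"
    and space_smult: "v \<in> carrier V \<Longrightarrow> c \<odot> v \<in> carrier V"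
begin

abbreviation "FV \<equiv> free_algebra (carrier V) :: ('k, 'v list \<Rightarrow>\<^sub>0 'k) module"

definition rels :: "('v list \<Rightarrow>\<^sub>0 'k) set" where "rels =
     {free_gen (v \<oplus>\<^bsub>V\<^esub> w) - (free_gen v + free_gen w) | v w. v \<in> carrier V \<and> w \<in> carrier V} \<union>
      {free_gen (c \<odot>\<^bsub>V\<^esub> v) - c \<odot>\<^bsub>FV\<^esub> free_gen v | c v. v \<in> carrier V}"

lemma minus_FV: "x \<in> carrier FV \<Longrightarrow> y \<in> carrier FV \<Longrightarrow> x \<ominus>\<^bsub>FV\<^esub> y = x - y"
proof -
  assume x: "x \<in> carrier FV" "y \<in> carrier FV"
  interpret F: kalg FV by (rule free_kalg)
  have "x \<ominus>\<^bsub>FV\<^esub> y \<oplus>\<^bsub>FV\<^esub> y = x" using x unfolding a_minus_def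
    by (metis F.a_assoc F.a_inv_closed F.l_neg F.r_zero)
  then show ?thesis by (simp add: eq_diff_eq)
qed

lemma add_rel_eq:
  assumes "v \<in> carrier V" "w \<in> carrier V"
  shows "free_gen (v \<oplus> w) - (free_gen v + free_gen w) =
    free_gen (v \<oplus> w) \<ominus>\<^bsub>FV\<^esub> (free_gen v \<oplus>\<^bsub>FV\<^esub> free_gen w)"
proof -
  interpret F: kalg FV by (rule free_kalg)
  have "free_gen v \<oplus>\<^bsub>FV\<^esub> free_gen w \<in> carrier FV"
    using assms by (intro F.a_closed free_gen_closed)
  then show ?thesis using assms by (subst minus_FV) (auto simp: free_gen_closed space_add simp del: free_algebra_sel(1))
qed

lemma smult_rel_eq: "v \<in> carrier V \<Longrightarrow> free_gen (c \<odot> v) - c \<odot>\<^bsub>FV\<^esub> free_gen v =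
    free_gen (c \<odot> v) \<ominus>\<^bsub>FV\<^esub> (c \<odot>\<^bsub>FV\<^esub> free_gen v)"
proof -
  interpret F: kalg FV by (rule free_kalg)
  show "v \<in> carrier V \<Longrightarrow> ?thesis"
    by (subst minus_FV) (auto simp: free_gen_closed space_smult simp del: free_algebra_sel)
qed

lemma rels_closed: "rels \<subseteq> carrier FV"
proof -
  interpret F: kalg FV by (rule free_kalg)
  show ?thesis unfolding rels_def
    by (auto simp: add_rel_eq smult_rel_eq free_gen_closed space_add space_smult simp del: free_algebra_sel)
qed

lemma tensor_ideal_eq: "tensor_ideal V = Idl\<^bsub>FV\<^esub> rels"
  unfolding tensor_ideal_def rels_def ..

lemma tensor_ideal: "ideal (tensor_ideal V) FV"
proof -
  interpret F: kalg FV by (rule free_kalg)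
  show ?thesis unfolding tensor_ideal_eq by (rule F.genideal_ideal[OF rels_closed])
qed

lemmas tensor_quot = free_kalg tensor_ideal

lemma tensor_kalg: "kalg (tensor_algebra V)"
  unfolding tensor_algebra_def by (rule quot_kalg[OF tensor_quot])

lemma tensor_incl_closed: "v \<in> carrier V \<Longrightarrow> tensor_incl V v \<in> carrier (tensor_algebra V)"
  unfolding tensor_algebra_def tensor_incl_def by (intro quot_carrierI[OF tensor_quot] free_gen_closed)

lemma tensor_incl_add:
  assumes "v \<in> carrier V" "w \<in> carrier V"
  shows "tensor_incl V (v \<oplus> w) = tensor_incl V v \<oplus>\<^bsub>tensor_algebra V\<^esub> tensor_incl V w"
proof -
  interpret F: kalg FV by (rule free_kalg)
  have "free_gen (v \<oplus> w) - (free_gen v + free_gen w) \<in> rels" using assms by (auto simp: rels_def)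
  then have "free_gen (v \<oplus> w) - (free_gen v + free_gen w) \<in> tensor_ideal V"
    using F.genideal_self[OF rels_closed] by (auto simp: tensor_ideal_eq)
  then show ?thesis
    using assms coset_eq_iff[OF tensor_quot, of "free_gen (v \<oplus> w)" "free_gen v \<oplus>\<^bsub>FV\<^esub> free_gen w"]
    by (simp add: add_rel_eq tensor_incl_def tensor_algebra_def quot_add[OF tensor_quot] free_gen_closed space_add
       F.a_closed[OF free_gen_closed free_gen_closed] del: free_algebra_sel)
qed

lemma tensor_incl_smult:
  assumes "v \<in> carrier V"
  shows "tensor_incl V (c \<odot> v) = c \<odot>\<^bsub>tensor_algebra V\<^esub> tensor_incl V v"
proof -
  interpret F: kalg FV by (rule free_kalg)
  have "free_gen (c \<odot> v) - c \<odot>\<^bsub>FV\<^esub> free_gen v \<in> rels" using assms unfolding rels_def by blast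
  then have "free_gen (c \<odot> v) - c \<odot>\<^bsub>FV\<^esub> free_gen v \<in> tensor_ideal V"
    using F.genideal_self[OF rels_closed] by (auto simp: tensor_ideal_eq)
  then show ?thesis
    using assms coset_eq_iff[OF tensor_quot, of "free_gen (c \<odot> v)" "c \<odot>\<^bsub>FV\<^esub> free_gen v"]
    by (simp add: smult_rel_eq tensor_incl_def tensor_algebra_def quot_smult[OF tensor_quot] free_gen_closed space_smult
        del: free_algebra_sel)
qed

lemma tensor_lift:
  assumes B: "kalg B" and f: "\<And>v. v \<in> carrier V \<Longrightarrow> f v \<in> carrier B"
    and f_add: "\<And>v w. v \<in> carrier V \<Longrightarrow> w \<in> carrier V \<Longrightarrow> f (v \<oplus> w) = f v \<oplus>\<^bsub>B\<^esub> f w"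
    and f_smult: "\<And>v c. v \<in> carrier V \<Longrightarrow> f (c \<odot> v) = c \<odot>\<^bsub>B\<^esub> f v"
  shows "\<exists>g \<in> alg_hom (tensor_algebra V) B. \<forall>v\<in>carrier V. g (tensor_incl V v) = f v"
proof -
  interpret F: kalg FV by (rule free_kalg)
  interpret B: kalg B by fact
  let ?h = "free_lift B f"
  have h: "?h \<in> alg_hom FV B" by (rule free_lift_hom[OF B f])
  note h' = alg_hom_nonunital[OF h]
  note gen = free_lift_gen[OF B f]
  note [simp del] = free_algebra_sel
  have "?h s = \<zero>\<^bsub>B\<^esub>" if s: "s \<in> rels" for s
  proof -
    from s consider v w where "v \<in> carrier V" "w \<in> carrier V" "s = free_gen (v \<oplus>\<^bsub>V\<^esub> w) - (free_gen v + free_gen w)"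
      | c v where "v \<in> carrier V" "s = free_gen (c \<odot>\<^bsub>V\<^esub> v) - c \<odot>\<^bsub>FV\<^esub> free_gen v"
      unfolding rels_def by blast
    then show ?thesis
    proof cases
      case 1
      with 1 show ?thesis
        by (simp add: add_rel_eq alg_hom_minus[OF free_kalg B h'] alg_homD(2)[OF h'] free_gen_closed space_add gen f_add f)
    next
      case 2
      with 2 show ?thesis
        by (simp add: smult_rel_eq alg_hom_minus[OF free_kalg B h'] alg_homD(4)[OF h'] free_gen_closed space_smult gen f_smult f)
    qed
  qed
  from quot_lift[OF free_kalg B h rels_closed this] obtain g where
    g: "g \<in> alg_hom (tensor_algebra V) B" "\<And>x. x \<in> carrier FV \<Longrightarrow> g (tensor_ideal V +>\<^bsub>FV\<^esub> x) = ?h x"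
    by (auto simp: tensor_algebra_def tensor_ideal_eq)
  then show ?thesis by (intro bexI[of _ g]) (auto simp: tensor_incl_def free_gen_closed gen)
qed

lemma tensor_induct [consumes 1, case_names one gen add smult mult]:
  assumes "u \<in> carrier (tensor_algebra V)"
    and "P \<one>\<^bsub>tensor_algebra V\<^esub>"
    and "\<And>x. x \<in> tensor_incl V ` carrier V \<Longrightarrow> P x"
    and "\<And>x y. x \<in> carrier (tensor_algebra V) \<Longrightarrow> y \<in> carrier (tensor_algebra V) \<Longrightarrow>
      P x \<Longrightarrow> P y \<Longrightarrow> P (x \<oplus>\<^bsub>tensor_algebra V\<^esub> y)"
    and "\<And>x c. x \<in> carrier (tensor_algebra V) \<Longrightarrow> P x \<Longrightarrow> P (c \<odot>\<^bsub>tensor_algebra V\<^esub> x)"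
    and "\<And>x y. x \<in> carrier (tensor_algebra V) \<Longrightarrow> y \<in> carrier (tensor_algebra V) \<Longrightarrow>
      P x \<Longrightarrow> P y \<Longrightarrow> P (x \<otimes>\<^bsub>tensor_algebra V\<^esub> y)"
  shows "P u"
proof (rule quot_induct[OF tensor_quot, of u "free_gen ` carrier V" P])
  show "u \<in> carrier (quot_algebra FV (tensor_ideal V))" using assms(1) by (simp add: tensor_algebra_def)
  show "R x" if "x \<in> carrier FV" "R \<one>\<^bsub>FV\<^esub>" "\<And>s. s \<in> free_gen ` carrier V \<Longrightarrow> R s"
      "\<And>x y. x \<in> carrier FV \<Longrightarrow> y \<in> carrier FV \<Longrightarrow> R x \<Longrightarrow> R y \<Longrightarrow> R (x \<oplus>\<^bsub>FV\<^esub> y)"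
      "\<And>x c. x \<in> carrier FV \<Longrightarrow> R x \<Longrightarrow> R (c \<odot>\<^bsub>FV\<^esub> x)"
      "\<And>x y. x \<in> carrier FV \<Longrightarrow> y \<in> carrier FV \<Longrightarrow> R x \<Longrightarrow> R y \<Longrightarrow> R (x \<otimes>\<^bsub>FV\<^esub> y)" for R x
    using that(1) by (rule free_induct[where P = R]) (use that in blast)+
qed (use assms in \<open>auto simp: tensor_incl_def tensor_algebra_def\<close>)

end

text \<open>Common form of the enveloping algebra of sl2 and of the algebras of level m: a tensor
  algebra modulo the ideal generated by a set of relators.\<close>

locale presented = tensor_space V for V :: "('k::field, 'v) module" (structure) +
  fixes S :: "('k, 'v) tensor set"
  assumes S_closed: "S \<subseteq> carrier (tensor_algebra V)"
begin

abbreviation "TV \<equiv> tensor_algebra V"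

definition "pres_ideal = Idl\<^bsub>TV\<^esub> S"
definition "pres_algebra = quot_algebra TV pres_ideal"
definition "pres_incl v = pres_ideal +>\<^bsub>TV\<^esub> tensor_incl V v"

lemma pres_ideal: "ideal pres_ideal TV"
proof -
  interpret T: kalg TV by (rule tensor_kalg)
  show ?thesis unfolding pres_ideal_def by (rule T.genideal_ideal[OF S_closed])
qed

lemmas pres_quot = tensor_kalg pres_ideal

lemma pres_kalg: "kalg pres_algebra"
  unfolding pres_algebra_def by (rule quot_kalg[OF pres_quot])

lemma pres_proj: "(\<lambda>x. pres_ideal +>\<^bsub>TV\<^esub> x) \<in> alg_hom TV pres_algebra"
  unfolding pres_algebra_def by (rule quot_proj_hom[OF pres_quot])

lemmas pres_proj_nonunital = alg_hom_nonunital[OF pres_proj]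
lemmas pres_projD = alg_homD[OF pres_proj_nonunital]

lemma pres_rel: "s \<in> S \<Longrightarrow> pres_ideal +>\<^bsub>TV\<^esub> s = \<zero>\<^bsub>pres_algebra\<^esub>"
proof -
  assume s: "s \<in> S"
  interpret T: kalg TV by (rule tensor_kalg)
  have "s \<in> pres_ideal" using T.genideal_self[OF S_closed] s by (auto simp: pres_ideal_def)
  then show ?thesis using quot_eq_zero_iff[OF pres_quot, of s] s S_closed by (auto simp: pres_algebra_def)
qed

lemma pres_incl_closed: "v \<in> carrier V \<Longrightarrow> pres_incl v \<in> carrier pres_algebra"
  unfolding pres_incl_def by (intro pres_projD(1) tensor_incl_closed)

lemma pres_incl_add: "v \<in> carrier V \<Longrightarrow> w \<in> carrier V \<Longrightarrow>
    pres_incl (v \<oplus> w) = pres_incl v \<oplus>\<^bsub>pres_algebra\<^esub> pres_incl w"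
  unfolding pres_incl_def by (simp add: tensor_incl_add pres_projD tensor_incl_closed)

lemma pres_incl_smult: "v \<in> carrier V \<Longrightarrow> pres_incl (c \<odot> v) = c \<odot>\<^bsub>pres_algebra\<^esub> pres_incl v"
  unfolding pres_incl_def by (simp add: tensor_incl_smult pres_projD tensor_incl_closed)

text \<open>The morphism on the tensor algebra is only known to exist, so \<open>rel\<close> asks
  that every \<open>g\<close> extending \<open>f\<close> kills the relators.\<close>

lemma pres_lift:
  assumes B: "kalg B" and f: "\<And>v. v \<in> carrier V \<Longrightarrow> f v \<in> carrier B"
    and f_add: "\<And>v w. v \<in> carrier V \<Longrightarrow> w \<in> carrier V \<Longrightarrow> f (v \<oplus> w) = f v \<oplus>\<^bsub>B\<^esub> f w"
    and f_smult: "\<And>v c. v \<in> carrier V \<Longrightarrow> f (c \<odot> v) = c \<odot>\<^bsub>B\<^esub> f v"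
    and rel: "\<And>g s. g \<in> alg_hom TV B \<Longrightarrow> (\<And>v. v \<in> carrier V \<Longrightarrow> g (tensor_incl V v) = f v) \<Longrightarrow>
      s \<in> S \<Longrightarrow> g s = \<zero>\<^bsub>B\<^esub>"
  shows "\<exists>g \<in> alg_hom pres_algebra B. \<forall>v\<in>carrier V. g (pres_incl v) = f v"
proof -
  from tensor_lift[OF B f f_add f_smult] obtain g where
    g: "g \<in> alg_hom TV B" "\<And>v. v \<in> carrier V \<Longrightarrow> g (tensor_incl V v) = f v" by auto
  from quot_lift[OF tensor_kalg B g(1) S_closed rel[OF g]] obtain h where
    "h \<in> alg_hom pres_algebra B" "\<And>x. x \<in> carrier TV \<Longrightarrow> h (pres_ideal +>\<^bsub>TV\<^esub> x) = g x"
    by (auto simp: pres_algebra_def pres_ideal_def)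
  then show ?thesis by (intro bexI[of _ h]) (auto simp: pres_incl_def tensor_incl_closed g)
qed

lemma pres_induct [consumes 1, case_names one gen add smult mult]:
  assumes "u \<in> carrier pres_algebra"
    and "P \<one>\<^bsub>pres_algebra\<^esub>"
    and "\<And>v. v \<in> carrier V \<Longrightarrow> P (pres_incl v)"
    and "\<And>x y. x \<in> carrier pres_algebra \<Longrightarrow> y \<in> carrier pres_algebra \<Longrightarrow>
      P x \<Longrightarrow> P y \<Longrightarrow> P (x \<oplus>\<^bsub>pres_algebra\<^esub> y)"
    and "\<And>x c. x \<in> carrier pres_algebra \<Longrightarrow> P x \<Longrightarrow> P (c \<odot>\<^bsub>pres_algebra\<^esub> x)"
    and "\<And>x y. x \<in> carrier pres_algebra \<Longrightarrow> y \<in> carrier pres_algebra \<Longrightarrow>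
      P x \<Longrightarrow> P y \<Longrightarrow> P (x \<otimes>\<^bsub>pres_algebra\<^esub> y)"
  shows "P u"
proof (rule quot_induct[OF pres_quot, of u "tensor_incl V ` carrier V" P])
  show "u \<in> carrier (quot_algebra TV pres_ideal)" using assms(1) by (simp add: pres_algebra_def)
  show "R x" if "x \<in> carrier TV" "R \<one>\<^bsub>TV\<^esub>" "\<And>s. s \<in> tensor_incl V ` carrier V \<Longrightarrow> R s"
      "\<And>x y. x \<in> carrier TV \<Longrightarrow> y \<in> carrier TV \<Longrightarrow> R x \<Longrightarrow> R y \<Longrightarrow> R (x \<oplus>\<^bsub>TV\<^esub> y)"
      "\<And>x c. x \<in> carrier TV \<Longrightarrow> R x \<Longrightarrow> R (c \<odot>\<^bsub>TV\<^esub> x)"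
      "\<And>x y. x \<in> carrier TV \<Longrightarrow> y \<in> carrier TV \<Longrightarrow> R x \<Longrightarrow> R y \<Longrightarrow> R (x \<otimes>\<^bsub>TV\<^esub> y)" for R x
    using that(1) by (rule tensor_induct[where P = R]) (fact that)+
qed (use assms in \<open>auto simp: pres_incl_def pres_algebra_def\<close>)

end


section \<open>The enveloping algebra of \<open>sl\<^sub>2\<close> and its action on symbols\<close>

definition env_rels :: "('k::field, 'v) module \<Rightarrow> ('k, 'v) tensor set" where
  "env_rels L = (let T = tensor_algebra L; \<iota> = tensor_incl L in
     {(\<iota> x \<otimes>\<^bsub>T\<^esub> \<iota> y \<ominus>\<^bsub>T\<^esub> \<iota> y \<otimes>\<^bsub>T\<^esub> \<iota> x) \<ominus>\<^bsub>T\<^esub> \<iota> (x \<otimes>\<^bsub>L\<^esub> y) | x y.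
            x \<in> carrier L \<and> y \<in> carrier L})"

lemma sl2_sel [simp]: "carrier sl2 = {A. trace A = 0}" "monoid.mult sl2 = (\<lambda>A B. A ** B - B ** A)"
  "add sl2 = (+)" "module.smult sl2 = (\<lambda>c A. \<chi> i j. c * A $ i $ j)"
  by (simp_all add: sl2_def)

lemma trace2: "trace (A :: rat^2^2) = A $ 1 $ 1 + A $ 2 $ 2"
  by (simp add: trace_def sum_2)

lemma sl2_bracket: "trace (A ** B - B ** A) = (0 :: rat)" for A :: "rat^2^2"
  by (simp add: trace2 matrix_matrix_mult_def sum_2)

interpretation sl2: tensor_space sl2
  by unfold_locales (simp_all add: trace2 flip: distrib_left)

interpretation sl2: presented sl2 "env_rels sl2"
proof unfold_locales
  interpret T: kalg "tensor_algebra sl2" by (rule sl2.tensor_kalg)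
  show "env_rels sl2 \<subseteq> carrier (tensor_algebra sl2)"
    using sl2_bracket by (auto simp: env_rels_def Let_def intro!: T.minus_closed T.m_closed sl2.tensor_incl_closed)
qed

lemma env_ideal_sl2: "env_ideal sl2 = sl2.pres_ideal"
  unfolding sl2.pres_ideal_def by (simp only: env_ideal_def env_rels_def Let_def)

lemma Usl2_eq: "Usl2 = sl2.pres_algebra"
  by (simp only: Usl2_def enveloping_algebra_def sl2.pres_algebra_def env_ideal_sl2)

lemma env_incl_eq: "env_incl sl2 = sl2.pres_incl"
  by (simp only: fun_eq_iff env_incl_def sl2.pres_incl_def env_ideal_sl2 simp_thms)

lemma Usl2_kalg: "kalg Usl2" unfolding Usl2_eq by (rule sl2.pres_kalg)

interpretation U: kalg Usl2 by (rule Usl2_kalg)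

text \<open>
  A function of type \<open>'r sym\<close> stands for the family, indexed by the weight \<open>l\<close>, of the
  elements \<open>\<Sum>a c. v a c l E\<^bsup>[a]\<^esup> F\<^bsup>[c]\<^esup> 1\<^sub>l\<close> of the idempotented enveloping algebra; the
  operators below are the left multiplications.
\<close>

type_synonym 'r sym = "nat \<Rightarrow> nat \<Rightarrow> int \<Rightarrow> 'r"

definition opE :: "rat sym \<Rightarrow> rat sym" where
  "opE v a c l = of_nat a * v (a - 1) c l"
text \<open>This is F E^[a+1] = E^[a+1] F - E^[a] (H + a) applied to F^[c] 1_l, where H acts by l -
  2c: the coefficient at (a, c) receives 2c - a - l times the one at (a+1, c). At c = 0 the factor c
  makes the truncated index c - 1 harmless.\<close>

definition opF :: "rat sym \<Rightarrow> rat sym" where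
  "opF v a c l = of_nat c * v a (c - 1) l + (2 * of_nat c - of_nat a - of_int l) * v (a + 1) c l"
definition opH :: "rat sym \<Rightarrow> rat sym" where
  "opH v a c l = (of_int l + 2 * of_nat a - 2 * of_nat c) * v a c l"

definition lin_op :: "(rat sym \<Rightarrow> rat sym) \<Rightarrow> bool" where
  "lin_op T \<longleftrightarrow> (\<forall>r s u v. T (\<lambda>a c l. r * u a c l + s * v a c l) = (\<lambda>a c l. r * T u a c l + s * T v a c l))"

definition End_sym :: "(rat, rat sym \<Rightarrow> rat sym) module" where
  "End_sym = \<lparr>carrier = {T. lin_op T}, monoid.mult = (\<lambda>S T v. S (T v)), one = (\<lambda>v. v),
     zero = (\<lambda>v a c l. 0), add = (\<lambda>S T v a c l. S v a c l + T v a c l),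
     module.smult = (\<lambda>k T v a c l. k * T v a c l)\<rparr>"

lemma End_sym_sel [simp]: "carrier End_sym = {T. lin_op T}" "monoid.mult End_sym = (\<lambda>S T v. S (T v))"
  "one End_sym = (\<lambda>v. v)" "zero End_sym = (\<lambda>v a c l. 0)" "add End_sym = (\<lambda>S T v a c l. S v a c l + T v a c l)"
  "module.smult End_sym = (\<lambda>k T v a c l. k * T v a c l)"
  by (simp_all add: End_sym_def)

lemma lin_op_add: "lin_op T \<Longrightarrow> T (\<lambda>a c l. u a c l + v a c l) = (\<lambda>a c l. T u a c l + T v a c l)"
  unfolding lin_op_def by (drule spec[of _ 1], drule spec[of _ 1]) simp

lemma lin_op_smult: "lin_op T \<Longrightarrow> T (\<lambda>a c l. k * u a c l) = (\<lambda>a c l. k * T u a c l)"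
  unfolding lin_op_def by (drule spec[of _ k], drule spec[of _ 0]) simp

lemma End_sym_kalg: "kalg End_sym"
proof -
  have r: "ring End_sym"
  proof (intro ringI abelian_groupI monoidI)
    show "\<exists>y\<in>carrier End_sym. y \<oplus>\<^bsub>End_sym\<^esub> x = \<zero>\<^bsub>End_sym\<^esub>" if "x \<in> carrier End_sym" for x
      using that by (intro bexI[of _ "\<lambda>v a c l. - x v a c l"]) (auto simp: lin_op_def)
    show "x \<otimes>\<^bsub>End_sym\<^esub> y \<in> carrier End_sym" if "x \<in> carrier End_sym" "y \<in> carrier End_sym" for x y
      using that by (simp add: lin_op_def)
    show "x \<oplus>\<^bsub>End_sym\<^esub> y \<in> carrier End_sym" if "x \<in> carrier End_sym" "y \<in> carrier End_sym" for x y
      using that by (simp add: lin_op_def algebra_simps)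
  qed (auto simp: lin_op_add algebra_simps, simp_all add: lin_op_def)
  show ?thesis
    by (intro kalg.intro[OF r] kalg_axioms.intro) (auto simp: lin_op_def lin_op_smult algebra_simps)
qed

lemma lin_op_comp: "lin_op S \<Longrightarrow> lin_op T \<Longrightarrow> lin_op (\<lambda>v. S (T v))"
  by (simp add: lin_op_def)

lemma End_uminus: "lin_op T \<Longrightarrow> \<ominus>\<^bsub>End_sym\<^esub> T = (\<lambda>v a c l. - T v a c l)"
proof -
  interpret E: kalg End_sym by (rule End_sym_kalg)
  show "lin_op T \<Longrightarrow> ?thesis" using E.smult_minus1[of T] by simp
qed

definition sl2_op :: "rat^2^2 \<Rightarrow> rat sym \<Rightarrow> rat sym" where
  "sl2_op M v a c l = M $ 1 $ 2 * opE v a c l + M $ 2 $ 1 * opF v a c l + M $ 1 $ 1 * opH v a c l"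

lemma sl2_op_lin: "lin_op (sl2_op M)"
  by (simp add: lin_op_def fun_eq_iff sl2_op_def opE_def opF_def opH_def algebra_simps)

lemma sl2_op_bracket:
  assumes "trace A = 0" "trace B = 0"
  shows "sl2_op A (sl2_op B v) a c l - sl2_op B (sl2_op A v) a c l = sl2_op (A ** B - B ** A) v a c l"
proof -
  have t: "A $ 2 $ 2 = - A $ 1 $ 1" "B $ 2 $ 2 = - B $ 1 $ 1" using assms by (auto simp: trace2 add_eq_0_iff)
  \<comment> \<open>The cases a = 0 and c = 0 are separate because the operators use truncated
    subtraction in their indices.\<close>
  show ?thesis
    by (cases a; cases c) (simp_all add: sl2_op_def opE_def opF_def opH_def matrix_matrix_mult_def sum_2 t algebra_simps)
qed

lemma Usl2_rep_ex: "\<exists>g \<in> alg_hom Usl2 End_sym. \<forall>M\<in>carrier sl2. g (env_incl sl2 M) = sl2_op M"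
  unfolding Usl2_eq env_incl_eq
proof (rule sl2.pres_lift[OF End_sym_kalg])
  fix g s
  assume g: "g \<in> alg_hom (tensor_algebra sl2) End_sym" and f: "\<And>v. v \<in> carrier sl2 \<Longrightarrow> g (tensor_incl sl2 v) = sl2_op v"
    and s: "s \<in> env_rels sl2"
  interpret E: kalg End_sym by (rule End_sym_kalg)
  interpret T: kalg "tensor_algebra sl2" by (rule sl2.tensor_kalg)
  note g' = alg_hom_nonunital[OF g]
  from s obtain A B where AB: "A \<in> carrier sl2" "B \<in> carrier sl2"
    and s: "s = (tensor_incl sl2 A \<otimes>\<^bsub>tensor_algebra sl2\<^esub> tensor_incl sl2 B \<ominus>\<^bsub>tensor_algebra sl2\<^esub>
       tensor_incl sl2 B \<otimes>\<^bsub>tensor_algebra sl2\<^esub> tensor_incl sl2 A) \<ominus>\<^bsub>tensor_algebra sl2\<^esub> tensor_incl sl2 (A \<otimes>\<^bsub>sl2\<^esub> B)"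
    by (auto simp: env_rels_def Let_def)
  have C: "A \<otimes>\<^bsub>sl2\<^esub> B \<in> carrier sl2" using sl2_bracket by auto
  note [simp del] = End_sym_sel sl2_sel
  have "g s = (sl2_op A \<otimes>\<^bsub>End_sym\<^esub> sl2_op B \<ominus>\<^bsub>End_sym\<^esub> sl2_op B \<otimes>\<^bsub>End_sym\<^esub> sl2_op A) \<ominus>\<^bsub>End_sym\<^esub> sl2_op (A \<otimes>\<^bsub>sl2\<^esub> B)"
    unfolding s using AB C by (simp add: alg_hom_minus[OF sl2.tensor_kalg End_sym_kalg g'] alg_homD(3)[OF g'] f sl2.tensor_incl_closed)
  moreover have "sl2_op A \<otimes>\<^bsub>End_sym\<^esub> sl2_op B = sl2_op (A \<otimes>\<^bsub>sl2\<^esub> B) \<oplus>\<^bsub>End_sym\<^esub> sl2_op B \<otimes>\<^bsub>End_sym\<^esub> sl2_op A"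
    using sl2_op_bracket[of A B] AB by (simp add: fun_eq_iff End_sym_sel sl2_sel diff_eq_eq)
  ultimately show "g s = \<zero>\<^bsub>End_sym\<^esub>"
    by (auto simp: a_minus_def fun_eq_iff End_sym_sel End_uminus sl2_op_lin lin_op_comp)
qed (use sl2_op_lin in \<open>auto simp: sl2_op_def fun_eq_iff algebra_simps\<close>)

definition Usl2_rep :: "usl2 \<Rightarrow> rat sym \<Rightarrow> rat sym" where
  "Usl2_rep = (SOME g. g \<in> alg_hom Usl2 End_sym \<and> (\<forall>M\<in>carrier sl2. g (env_incl sl2 M) = sl2_op M))"

lemma Usl2_rep: "Usl2_rep \<in> alg_hom Usl2 End_sym" "trace M = 0 \<Longrightarrow> Usl2_rep (env_incl sl2 M) = sl2_op M"
  using someI_ex[of "\<lambda>g. g \<in> alg_hom Usl2 End_sym \<and> (\<forall>M\<in>carrier sl2. g (env_incl sl2 M) = sl2_op M)"]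
    Usl2_rep_ex unfolding Usl2_rep_def by auto

lemmas Usl2_repD = alg_homD[OF alg_hom_nonunital[OF Usl2_rep(1)], unfolded End_sym_sel]

text \<open>Turning the carrier into a type of class \<open>ring_1\<close> makes sums, powers and
  ring normalisation available without carrier conditions.\<close>

typedef uq = "carrier Usl2" morphisms rep_uq abs_uq
  using U.zero_closed by blast

lemma rep_uq_closed [simp, intro]: "rep_uq x \<in> carrier Usl2" by (rule rep_uq)

lemma rep_abs_uq [simp]: "x \<in> carrier Usl2 \<Longrightarrow> rep_uq (abs_uq x) = x" by (rule abs_uq_inverse)

instantiation uq :: ring_1
begin
definition zero_uq where "0 = abs_uq \<zero>\<^bsub>Usl2\<^esub>"
definition one_uq where "1 = abs_uq \<one>\<^bsub>Usl2\<^esub>"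
definition plus_uq where "x + y = abs_uq (rep_uq x \<oplus>\<^bsub>Usl2\<^esub> rep_uq y)"
definition times_uq where "x * y = abs_uq (rep_uq x \<otimes>\<^bsub>Usl2\<^esub> rep_uq y)"
definition uminus_uq where "- x = abs_uq (\<ominus>\<^bsub>Usl2\<^esub> rep_uq x)"
definition minus_uq where "x - y = abs_uq (rep_uq x \<ominus>\<^bsub>Usl2\<^esub> rep_uq y)"
instance
proof
  \<comment> \<open>That the quotient is not the zero ring is not visible from the presentation; it
    follows from the action, under which 1 is not the zero operator.\<close>
  have "Usl2_rep \<zero>\<^bsub>Usl2\<^esub> \<noteq> Usl2_rep \<one>\<^bsub>Usl2\<^esub>"
  proof
    assume "Usl2_rep \<zero>\<^bsub>Usl2\<^esub> = Usl2_rep \<one>\<^bsub>Usl2\<^esub>"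
    then have "(\<lambda>v a c l. 0) = (\<lambda>v :: rat sym. v)"
      using alg_hom_zero[OF Usl2_kalg End_sym_kalg alg_hom_nonunital[OF Usl2_rep(1)]]
        alg_hom_one[OF Usl2_rep(1)] by simp
    from fun_cong[OF fun_cong[OF fun_cong[OF fun_cong[OF this, of "\<lambda>a c l. 1"]]]] show False by simp
  qed
  then show "(0::uq) \<noteq> 1" by (auto simp: zero_uq_def one_uq_def abs_uq_inject)
qed (simp_all add: zero_uq_def one_uq_def plus_uq_def times_uq_def uminus_uq_def minus_uq_def rep_uq_inverse
   U.a_assoc U.m_assoc U.l_distr U.r_distr U.l_neg a_minus_def, (simp add: U.a_comm)?)
end

lemma rep_uq_simps: "rep_uq 0 = \<zero>\<^bsub>Usl2\<^esub>" "rep_uq 1 = \<one>\<^bsub>Usl2\<^esub>" "rep_uq (x + y) = rep_uq x \<oplus>\<^bsub>Usl2\<^esub> rep_uq y"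
  "rep_uq (x * y) = rep_uq x \<otimes>\<^bsub>Usl2\<^esub> rep_uq y" "rep_uq (- x) = \<ominus>\<^bsub>Usl2\<^esub> rep_uq x" "rep_uq (x - y) = rep_uq x \<ominus>\<^bsub>Usl2\<^esub> rep_uq y"
  by (simp_all add: zero_uq_def one_uq_def plus_uq_def times_uq_def uminus_uq_def minus_uq_def)

text \<open>The class \<open>ring_1\<close> has no rational scalars, so they are represented by
  central elements.\<close>

definition sc :: "rat \<Rightarrow> uq" where "sc c = abs_uq (c \<odot>\<^bsub>Usl2\<^esub> \<one>\<^bsub>Usl2\<^esub>)"

lemma rep_sc_mult: "rep_uq (sc c * x) = c \<odot>\<^bsub>Usl2\<^esub> rep_uq x"
  by (simp add: sc_def rep_uq_simps U.smult_mult1)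

lemma sc_simps [simp]: "sc 0 = 0" "sc 1 = 1" "sc (c + d) = sc c + sc d" "sc (c * d) = sc c * sc d"
  by (simp_all add: sc_def rep_uq_inject[symmetric] rep_uq_simps U.smult_l_distr U.smult_assoc1 U.smult_mult1 U.smult_one)

lemma sc_comm: "x * sc c = sc c * x"
  by (simp add: sc_def rep_uq_inject[symmetric] rep_uq_simps U.smult_mult1 U.smult_mult2)

definition act :: "uq \<Rightarrow> rat sym \<Rightarrow> rat sym" where "act x = Usl2_rep (rep_uq x)"

lemma act_simps [simp]: "act (x * y) v = act x (act y v)" "act (x + y) v = (\<lambda>a c l. act x v a c l + act y v a c l)"
  "act 1 v = v" "act (sc k) v = (\<lambda>a c l. k * v a c l)" "act 0 v = (\<lambda>a c l. 0)"
  using alg_hom_zero[OF Usl2_kalg End_sym_kalg alg_hom_nonunital[OF Usl2_rep(1)]]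
     alg_hom_one[OF Usl2_rep(1)]
  by (simp_all add: act_def rep_uq_simps Usl2_repD sc_def)

lemma act_uminus [simp]: "act (- x) v = (\<lambda>a c l. - act x v a c l)"
proof -
  have "act (x + (- x)) v = (\<lambda>a c l. 0)" by (simp only: right_minus act_simps)
  then have "act x v a c l + act (- x) v a c l = 0" for a c l
    unfolding act_simps fun_eq_iff by blast
  then show ?thesis by (intro ext) (simp add: eq_neg_iff_add_eq_0 add.commute)
qed

lemma act_minus [simp]: "act (x - y) v = (\<lambda>a c l. act x v a c l - act y v a c l)"
  using act_simps(2)[of x "- y" v] by simp

section \<open>The standard generators and their commutation relations\<close>

abbreviation matE :: "rat^2^2" where "matE \<equiv> vector [vector [0, 1], vector [0, 0]]"
abbreviation matF :: "rat^2^2" where "matF \<equiv> vector [vector [0, 0], vector [1, 0]]"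
abbreviation matH :: "rat^2^2" where "matH \<equiv> vector [vector [1, 0], vector [0, - 1]]"

definition uE where "uE = abs_uq E_Q"
definition uF where "uF = abs_uq F_Q"
definition uH where "uH = abs_uq H_Q"

lemma mat_trace [simp]: "trace matE = 0" "trace matF = 0" "trace matH = 0"
  by (simp_all add: trace2 vector_2)

lemma EFH_closed: "E_Q \<in> carrier Usl2" "F_Q \<in> carrier Usl2" "H_Q \<in> carrier Usl2"
  by (auto simp: E_Q_def F_Q_def H_Q_def env_incl_eq Usl2_eq intro!: sl2.pres_incl_closed)

lemma rep_uEFH [simp]: "rep_uq uE = E_Q" "rep_uq uF = F_Q" "rep_uq uH = H_Q"
  by (simp_all add: uE_def uF_def uH_def EFH_closed)

lemma act_gens [simp]: "act uE = opE" "act uF = opF" "act uH = opH"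
  by (simp_all add: act_def E_Q_def F_Q_def H_Q_def Usl2_rep(2) fun_eq_iff sl2_op_def vector_2)

lemma env_bracket:
  assumes "trace A = 0" "trace B = 0"
  shows "abs_uq (env_incl sl2 A) * abs_uq (env_incl sl2 B) - abs_uq (env_incl sl2 B) * abs_uq (env_incl sl2 A) =
    abs_uq (env_incl sl2 (A ** B - B ** A))"
proof -
  interpret T: kalg "tensor_algebra sl2" by (rule sl2.tensor_kalg)
  let ?T = "tensor_algebra sl2" and ?\<iota> = "tensor_incl sl2"
  have A: "A \<in> carrier sl2" "B \<in> carrier sl2" "A ** B - B ** A \<in> carrier sl2" using assms sl2_bracket by auto
  have "(?\<iota> A \<otimes>\<^bsub>?T\<^esub> ?\<iota> B \<ominus>\<^bsub>?T\<^esub> ?\<iota> B \<otimes>\<^bsub>?T\<^esub> ?\<iota> A) \<ominus>\<^bsub>?T\<^esub> ?\<iota> (A ** B - B ** A) \<in> env_rels sl2"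
    using A unfolding env_rels_def Let_def by auto
  from sl2.pres_rel[OF this] have
    "(sl2.pres_incl A \<otimes>\<^bsub>Usl2\<^esub> sl2.pres_incl B \<ominus>\<^bsub>Usl2\<^esub> sl2.pres_incl B \<otimes>\<^bsub>Usl2\<^esub> sl2.pres_incl A) \<ominus>\<^bsub>Usl2\<^esub>
      sl2.pres_incl (A ** B - B ** A) = \<zero>\<^bsub>Usl2\<^esub>"
    using A sl2.tensor_incl_closed
    by (simp add: alg_hom_minus[OF sl2.tensor_kalg sl2.pres_kalg sl2.pres_proj_nonunital] sl2.pres_projD(3)
       sl2.pres_incl_def Usl2_eq del: sl2_sel)
  then show ?thesis
    using A sl2.pres_incl_closed
    by (simp add: rep_uq_inject[symmetric] rep_uq_simps env_incl_eq del: sl2_sel flip: Usl2_eq)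
qed

lemma env_smult: "trace A = 0 \<Longrightarrow> abs_uq (env_incl sl2 (\<chi> i j. k * A $ i $ j)) = sc k * abs_uq (env_incl sl2 A)"
  using sl2.pres_incl_smult[of A k] sl2.pres_incl_closed[of A]
  by (simp add: rep_uq_inject[symmetric] rep_sc_mult env_incl_eq flip: Usl2_eq)

lemma env_add: "trace A = 0 \<Longrightarrow> trace B = 0 \<Longrightarrow>
   abs_uq (env_incl sl2 (A + B)) = abs_uq (env_incl sl2 A) + abs_uq (env_incl sl2 B)"
  using sl2.pres_incl_add[of A B] sl2.pres_incl_closed[of A] sl2.pres_incl_closed[of B]
  by (simp add: rep_uq_inject[symmetric] rep_uq_simps env_incl_eq flip: Usl2_eq)

lemma env_mat: "trace A = 0 \<Longrightarrow>
   abs_uq (env_incl sl2 A) = sc (A $ 1 $ 2) * uE + sc (A $ 2 $ 1) * uF + sc (A $ 1 $ 1) * uH"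
proof -
  assume A: "trace A = 0"
  have "A = (\<chi> i j. A $ 1 $ 2 * matE $ i $ j) + (\<chi> i j. A $ 2 $ 1 * matF $ i $ j) + (\<chi> i j. A $ 1 $ 1 * matH $ i $ j)"
    (is "A = ?B") using A by (simp add: vec_eq_iff forall_2 vector_2 trace2 add_eq_0_iff)
  also have "abs_uq (env_incl sl2 ?B) = sc (A $ 1 $ 2) * uE + sc (A $ 2 $ 1) * uF + sc (A $ 1 $ 1) * uH"
    by (subst env_add env_smult; simp add: trace2 vector_2 uE_def uF_def uH_def E_Q_def F_Q_def H_Q_def
       env_add[OF _ mat_trace(3)] env_smult)+
  finally show ?thesis .
qed

lemma uq_rels: "uE * uF = uF * uE + uH" "uH * uE = uE * uH + sc 2 * uE" "uH * uF = uF * uH - sc 2 * uF"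
proof -
  have "trace (A ** B - B ** A) = 0" for A B :: "rat^2^2" by (rule sl2_bracket)
  note * = env_bracket env_mat[OF this]
  show "uE * uF = uF * uE + uH"
    using *(1)[of matE matF] *(2)[of matE matF]
    by (simp add: uE_def uF_def uH_def E_Q_def F_Q_def H_Q_def matrix_matrix_mult_def sum_2 vector_2 algebra_simps)
  have [simp]: "sc (-2) = - sc 2" using sc_simps(3)[of 2 "-2"] by (simp add: add_eq_0_iff2)
  show "uH * uE = uE * uH + sc 2 * uE"
    using *(1)[of matH matE] *(2)[of matH matE]
    by (simp add: uE_def uF_def uH_def E_Q_def F_Q_def H_Q_def matrix_matrix_mult_def sum_2 vector_2 algebra_simps)
  show "uH * uF = uF * uH - sc 2 * uF"
    using *(1)[of matH matF] *(2)[of matH matF]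
    by (simp add: uE_def uF_def uH_def E_Q_def F_Q_def H_Q_def matrix_matrix_mult_def sum_2 vector_2 algebra_simps)
qed

lemma uq_induct [case_names sc E F H add mult]:
  assumes "\<And>k. P (sc k)" "P uE" "P uF" "P uH" "\<And>x y. P x \<Longrightarrow> P y \<Longrightarrow> P (x + y)" "\<And>x y. P x \<Longrightarrow> P y \<Longrightarrow> P (x * y)"
  shows "P x"
proof -
  have "P (abs_uq u)" if "u \<in> carrier Usl2" for u
    using that unfolding Usl2_eq
  proof (induction u rule: sl2.pres_induct)
    case one then show ?case using assms(1)[of 1] by (simp add: one_uq_def flip: Usl2_eq)
  next
    case (gen A)
    then show ?case by (simp add: env_mat assms flip: env_incl_eq)
  next
    case (add x y)
    then show ?case using assms(5)[of "abs_uq x" "abs_uq y"] by (simp add: plus_uq_def flip: Usl2_eq)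
  next
    case (smult x c)
    then have "abs_uq (c \<odot>\<^bsub>Usl2\<^esub> x) = sc c * abs_uq x"
      by (simp add: rep_uq_inject[symmetric] rep_sc_mult flip: Usl2_eq)
    then show ?case using smult assms by (simp flip: Usl2_eq)
  next
    case (mult x y)
    then show ?case using assms(6)[of "abs_uq x" "abs_uq y"] by (simp add: times_uq_def flip: Usl2_eq)
  qed
  from this[of "rep_uq x"] show ?thesis by (simp add: rep_uq_inverse)
qed


section \<open>Divided powers and the PBW theorem\<close>

lemma sc_uminus [simp]: "sc (- k) = - sc k"
  using sc_simps(3)[of k "- k"] by (simp add: eq_neg_iff_add_eq_0 add.commute)

lemma sc_of_nat: "sc (of_nat n) = of_nat n" by (induction n) auto

lemma sc_of_int: "sc (of_int n) = of_int n" by (cases n rule: int_diff_cases) (simp add: sc_of_nat diff_conv_add_uminus del: add_uminus_conv_diff)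

lemma sc_comm': "x * (sc c * y) = sc c * (x * y)"
  by (metis mult.assoc sc_comm)

lemma sc_commute: "sc a * sc b = sc b * sc a"
  by (rule sc_comm)

definition dE :: "nat \<Rightarrow> uq" where "dE r = sc (1 / fact r) * uE ^ r"
definition dF :: "nat \<Rightarrow> uq" where "dF r = sc (1 / fact r) * uF ^ r"

lemma sc_left_commute: "sc a * (sc b * y) = sc b * (sc a * y)"
  by (rule sc_comm')

lemmas sc_comms = sc_comm'[of uE] sc_comm'[of uF] sc_comm'[of uH] sc_comm'[of "dE r" for r]
  sc_comm'[of "dF r" for r] sc_comm'[of "uE ^ r" for r] sc_comm'[of "uF ^ r" for r]
  sc_commute sc_left_commute

lemma d_0 [simp]: "dE 0 = 1" "dF 0 = 1" by (simp_all add: dE_def dF_def)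

lemma d_Suc: "uE * dE r = sc (of_nat (Suc r)) * dE (Suc r)" "uF * dF r = sc (of_nat (Suc r)) * dF (Suc r)"
proof -
  have *: "sc (of_nat (Suc r)) * sc (1 / fact (Suc r)) = sc (1 / fact r)"
    unfolding sc_simps(4)[symmetric] by (rule arg_cong[of _ _ sc]) (simp del: of_nat_Suc)
  then have "sc (of_nat (Suc r)) * (sc (1 / fact (Suc r)) * z) = sc (1 / fact r) * z" for z
    by (simp only: mult.assoc[symmetric])
  then show "uE * dE r = sc (of_nat (Suc r)) * dE (Suc r)" "uF * dF r = sc (of_nat (Suc r)) * dF (Suc r)"
    by (simp_all only: dE_def dF_def sc_comms power_Suc)
qed

lemma dE_Suc': "dE (Suc r) = sc (1 / of_nat (Suc r)) * (uE * dE r)"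
  "dF (Suc r) = sc (1 / of_nat (Suc r)) * (uF * dF r)"
proof -
  have "sc (1 / of_nat (Suc r)) * (sc (of_nat (Suc r)) * z) = z" for z
    unfolding mult.assoc[symmetric] sc_simps(4)[symmetric] by (simp del: of_nat_Suc sc_simps(4))
  then show "dE (Suc r) = sc (1 / of_nat (Suc r)) * (uE * dE r)"
    "dF (Suc r) = sc (1 / of_nat (Suc r)) * (uF * dF r)" unfolding d_Suc by simp_all
qed

section \<open>Polynomials in H and moving E and F across them\<close>

definition ev :: "rat poly \<Rightarrow> uq" where "ev p = fold_coeffs (\<lambda>a b. sc a + uH * b) p 0"

lemma ev_0 [simp]: "ev 0 = 0" by (simp add: ev_def)

lemma ev_pCons [simp]: "ev (pCons a p) = sc a + uH * ev p"
  by (cases "p = 0 \<and> a = 0") (auto simp: ev_def)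

lemma ev_1 [simp]: "ev 1 = 1" unfolding one_pCons by simp

lemma ev_add [simp]: "ev (p + q) = ev p + ev q"
  by (induction p q rule: poly_induct2) (simp_all add: algebra_simps)

lemma ev_smult [simp]: "ev (smult k p) = sc k * ev p"
  by (induction p) (simp_all add: algebra_simps sc_comms sc_commute)

lemmas sc_comms' = sc_comms sc_comm'[of "ev p" for p] sc_comm[of "ev p" for p] sc_comm[of uE] sc_comm[of uF] sc_comm[of uH]

lemma ev_mult [simp]: "ev (p * q) = ev p * ev q"
  by (induction p) (simp_all add: algebra_simps)

lemma ev_minus [simp]: "ev (- p) = - ev p" "ev (p - q) = ev p - ev q"
proof -
  show *: "ev (- p) = - ev p" for p using ev_smult[of "-1" p] by simp
  show "ev (p - q) = ev p - ev q" using ev_add[of p "- q"] * by simp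
qed

lemma ev_sum: "ev (\<Sum>i\<in>A. f i) = (\<Sum>i\<in>A. ev (f i))"
  by (induction A rule: infinite_finite_induct) auto

text \<open>F lowers weights by 2, hence the substitution of H + 2.\<close>

lemma uF_ev: "uF * ev p = ev (pcompose p [:2, 1:]) * uF"
proof (induction p)
  case (pCons a p)
  have "uF * uH = (uH + sc 2) * uF" using uq_rels(3) by (simp add: algebra_simps)
  then have "uF * (uH * ev p) = (uH + sc 2) * (uF * ev p)" by (metis mult.assoc)
  then show ?case using pCons
    by (simp add: pcompose_pCons algebra_simps sc_comms')
qed simp

lemma ev_uE: "ev p * uE = uE * ev (pcompose p [:2, 1:])"
proof (induction p)
  case (pCons a p)
  have "uH * ev p * uE = uH * uE * ev (pcompose p [:2, 1:])" by (simp add: pCons mult.assoc)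
  also have "\<dots> = uE * (uH + sc 2) * ev (pcompose p [:2, 1:])"
    using uq_rels(2) by (simp add: algebra_simps sc_comms')
  finally show ?case
    by (simp add: pcompose_pCons algebra_simps sc_comms')
qed simp

lemma ev_dE: "\<exists>q. ev p * dE r = dE r * ev q"
proof (induction r arbitrary: p)
  case (Suc r)
  from Suc[of "pcompose p [:2, 1:]"] obtain q where q: "ev (pcompose p [:2, 1:]) * dE r = dE r * ev q" by auto
  have "ev p * dE (Suc r) = sc (1 / of_nat (Suc r)) * (ev p * uE * dE r)"
    unfolding dE_Suc' by (metis mult.assoc sc_comm')
  also have "\<dots> = sc (1 / of_nat (Suc r)) * (uE * (dE r * ev q))" by (simp only: ev_uE mult.assoc q)
  also have "\<dots> = dE (Suc r) * ev q" unfolding dE_Suc' by (metis mult.assoc)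
  finally show ?case by auto
qed auto

text \<open>Only the shape of the correction term is recorded. This is enough for spanning; exact
  coefficients are obtained later by comparing symbols.\<close>

lemma uF_dE: "\<exists>q. uF * dE r = dE r * uF + (if r = 0 then 0 else dE (r - 1) * ev q)"
proof (induction r)
  case (Suc r)
  then obtain q where q: "uF * dE r = dE r * uF + (if r = 0 then 0 else dE (r - 1) * ev q)" by blast
  obtain q' where q': "uH * dE r = dE r * ev q'" using ev_dE[of "[:0, 1:]" r] by auto
  let ?s = "sc (1 / of_nat (Suc r))"
  have "uF * dE (Suc r) = ?s * (uF * uE * dE r)"
    unfolding dE_Suc' by (metis mult.assoc sc_comm')
  also have "uF * uE = uE * uF - uH" using uq_rels(1) by simp
  also have "(uE * uF - uH) * dE r = uE * (uF * dE r) - uH * dE r" by (simp add: algebra_simps)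
  also have "\<dots> = uE * (dE r * uF) + (uE * (if r = 0 then 0 else dE (r - 1) * ev q) - dE r * ev q')"
    unfolding q q' by (simp add: algebra_simps)
  also have "uE * (if r = 0 then 0 else dE (r - 1) * ev q) = dE r * ev (smult (of_nat r) q)"
  proof (cases r)
    case (Suc n)
    have "uE * (dE n * ev q) = sc (of_nat (Suc n)) * (dE (Suc n) * ev q)" by (metis mult.assoc d_Suc(1))
    then show ?thesis by (simp add: Suc sc_comms' del: of_nat_Suc)
  qed simp
  also have "?s * (uE * (dE r * uF) + (dE r * ev (smult (of_nat r) q) - dE r * ev q')) =
      dE (Suc r) * uF + dE r * ev (smult (1 / of_nat (Suc r)) (smult (of_nat r) q - q'))"
    unfolding dE_Suc' by (simp add: algebra_simps sc_comms' del: of_nat_Suc)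
  finally show ?case
    by (intro exI[of _ "smult (1 / of_nat (Suc r)) (smult (of_nat r) q - q')"]) (simp only: nat.simps if_False diff_Suc_1)
qed simp

section \<open>Spanning by PBW monomials\<close>

definition pbw :: "uq \<Rightarrow> bool" where
  "pbw x \<longleftrightarrow> (\<exists>n g. x = (\<Sum>a<n. \<Sum>c<n. dE a * ev (g a c) * dF c))"

lemma pbw_extend: "n \<le> m \<Longrightarrow> (\<Sum>a<n. \<Sum>c<n. dE a * ev (g a c) * dF c) =
   (\<Sum>a<m. \<Sum>c<m. dE a * ev (if a < n \<and> c < n then g a c else 0) * dF c)"
proof -
  assume n: "n \<le> m"
  have "(\<Sum>a<m. \<Sum>c<m. dE a * ev (if a < n \<and> c < n then g a c else 0) * dF c) =
      (\<Sum>a<n. \<Sum>c<m. dE a * ev (if a < n \<and> c < n then g a c else 0) * dF c)"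
    by (rule sum.mono_neutral_right) (use n in auto)
  also have "\<dots> = (\<Sum>a<n. \<Sum>c<n. dE a * ev (if a < n \<and> c < n then g a c else 0) * dF c)"
    by (rule sum.cong[OF refl], rule sum.mono_neutral_right) (use n in auto)
  finally show ?thesis by simp
qed

lemma pbw_add: assumes "pbw x" "pbw y" shows "pbw (x + y)"
proof -
  from assms obtain n g m h where x: "x = (\<Sum>a<n. \<Sum>c<n. dE a * ev (g a c) * dF c)"
    and y: "y = (\<Sum>a<m. \<Sum>c<m. dE a * ev (h a c) * dF c)" by (auto simp: pbw_def)
  define k where "k = max n m"
  have "x + y = (\<Sum>a<k. \<Sum>c<k. dE a * ev ((if a < n \<and> c < n then g a c else 0) + (if a < m \<and> c < m then h a c else 0)) * dF c)"
    unfolding x y pbw_extend[of n k g, unfolded k_def, simplified] pbw_extend[of m k h, unfolded k_def, simplified]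
    by (simp add: k_def sum.distrib[symmetric] distrib_left distrib_right)
  then show ?thesis unfolding pbw_def
    by (intro exI[of _ k] exI[of _ "\<lambda>a c. (if a < n \<and> c < n then g a c else 0) + (if a < m \<and> c < m then h a c else 0)"])
qed

lemma pbw_0: "pbw 0" unfolding pbw_def by (intro exI[of _ 0]) simp

lemma pbw_single: "pbw (dE a * ev g * dF c)"
proof -
  have "(\<Sum>a'<Suc (a + c). \<Sum>c'<Suc (a + c). dE a' * ev (if a' = a \<and> c' = c then g else 0) * dF c') =
     (\<Sum>a'<Suc (a + c). \<Sum>c'<Suc (a + c). if c' = c then if a' = a then dE a' * ev g * dF c' else 0 else 0)"
    by (intro sum.cong refl) auto
  also have "\<dots> = dE a * ev g * dF c" by (simp add: sum.delta del: sum.lessThan_Suc)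
  finally show ?thesis unfolding pbw_def
    by (intro exI[of _ "Suc (a + c)"] exI[of _ "\<lambda>a' c'. if a' = a \<and> c' = c then g else 0"]) (rule sym)
qed

lemma pbw_sum: "(\<And>i. i \<in> A \<Longrightarrow> pbw (f i)) \<Longrightarrow> pbw (\<Sum>i\<in>A. f i)"
  by (induction A rule: infinite_finite_induct) (auto intro: pbw_0 pbw_add)

lemma pbw_lmult:
  assumes "\<And>a g c. pbw (x * (dE a * ev g * dF c))" "pbw y"
  shows "pbw (x * y)"
proof -
  from assms(2) obtain n g where y: "y = (\<Sum>a<n. \<Sum>c<n. dE a * ev (g a c) * dF c)" by (auto simp: pbw_def)
  show ?thesis unfolding y sum_distrib_left by (intro pbw_sum assms(1))
qed

text \<open>The sums of PBW monomials contain 1 and are stable under left multiplication by scalars,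
  E, F and H, hence by everything. Quantifying over \<open>y\<close> makes the property pass to
  products.\<close>

lemma pbw_all: "pbw x"
proof -
  have "\<forall>y. pbw y \<longrightarrow> pbw (x * y)"
  proof (induction x rule: uq_induct)
    case (sc k)
    have "pbw (sc k * (dE a * ev g * dF c))" for a g c
      using pbw_single[of a "smult k g" c] by (simp add: sc_comms' mult.assoc)
    then show ?case using pbw_lmult by blast
  next
    case E
    have "pbw (uE * (dE a * ev g * dF c))" for a g c
    proof -
      have "uE * (dE a * ev g * dF c) = uE * dE a * ev g * dF c" by (simp only: mult.assoc)
      also have "\<dots> = dE (Suc a) * ev (smult (of_nat (Suc a)) g) * dF c"
        unfolding d_Suc ev_smult by (simp only: sc_comms' mult.assoc)
      finally show ?thesis by (metis pbw_single)
    qed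
    then show ?case using pbw_lmult by blast
  next
    case F
    have "pbw (uF * (dE a * ev g * dF c))" for a g c
    proof -
      obtain q where q: "uF * dE a = dE a * uF + (if a = 0 then 0 else dE (a - 1) * ev q)" using uF_dE by blast
      have "uF * (dE a * ev g * dF c) = uF * dE a * ev g * dF c" by (simp only: mult.assoc)
      also have "\<dots> = dE a * (uF * ev g) * dF c + (if a = 0 then 0 else dE (a - 1) * (ev q * ev g) * dF c)"
        unfolding q by (simp add: algebra_simps)
      also have "dE a * (uF * ev g) * dF c = dE a * ev (pcompose g [:2, 1:]) * (uF * dF c)"
        unfolding uF_ev by (simp only: mult.assoc)
      also have "\<dots> = dE a * ev (smult (of_nat (Suc c)) (pcompose g [:2, 1:])) * dF (Suc c)"
        unfolding d_Suc ev_smult by (simp only: sc_comms' mult.assoc)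
      finally have eq: "uF * (dE a * ev g * dF c) = dE a * ev (smult (of_nat (Suc c)) (pcompose g [:2, 1:])) * dF (Suc c) +
          (if a = 0 then 0 else dE (a - 1) * (ev q * ev g) * dF c)" .
      have "pbw (if a = 0 then 0 else dE (a - 1) * (ev q * ev g) * dF c)"
        using pbw_single[of "a - 1" "q * g" c] pbw_0 by simp
      then show ?thesis unfolding eq by (rule pbw_add[OF pbw_single])
    qed
    then show ?case using pbw_lmult by blast
  next
    case H
    have "pbw (uH * (dE a * ev g * dF c))" for a g c
    proof -
      obtain q where "uH * dE a = dE a * ev q" using ev_dE[of "[:0, 1:]" a] by auto
      then have "uH * (dE a * ev g * dF c) = dE a * ev (q * g) * dF c" by (simp flip: mult.assoc)
      then show ?thesis by (metis pbw_single)
    qed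
    then show ?case using pbw_lmult by blast
  next
    case (add x y) then show ?case by (simp add: distrib_right pbw_add)
  next
    case (mult x y) then show ?case by (simp add: mult.assoc)
  qed
  moreover have "pbw 1" using pbw_single[of 0 1 0] by simp
  ultimately show ?thesis by force
qed

section \<open>Symbols of PBW monomials and linear independence\<close>

definition v0 :: "'r::zero_neq_one sym" where "v0 a c l = (if a = 0 \<and> c = 0 then 1 else 0)"

lemma act_sum: "act (\<Sum>i\<in>A. f i) v a c l = (\<Sum>i\<in>A. act (f i) v a c l)"
  by (induction A rule: infinite_finite_induct) auto

lemma act_ev: "act (ev p) v a c l = poly p (of_int l + 2 * of_nat a - 2 * of_nat c) * v a c l"
  by (induction p arbitrary: v) (simp_all add: opH_def algebra_simps)

lemma act_dE: "act (dE r) v a c l = of_nat (a choose r) * (if r \<le> a then v (a - r) c l else 0)"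
proof (induction r arbitrary: a)
  case (Suc r)
  have "of_nat (Suc r) * act (dE (Suc r)) v a c l = act (uE * dE r) v a c l"
    unfolding d_Suc by (simp del: of_nat_Suc)
  also have "\<dots> = of_nat a * act (dE r) v (a - 1) c l" by (simp add: opE_def)
  also have "\<dots> = of_nat (Suc r) * (of_nat (a choose Suc r) * (if Suc r \<le> a then v (a - Suc r) c l else 0))"
  proof (cases a)
    case (Suc b)
    have "of_nat (Suc b) * of_nat (b choose r) = of_nat (Suc r) * (of_nat (Suc b choose Suc r) :: rat)"
      by (metis Suc_times_binomial_eq mult.commute of_nat_mult)
    then show ?thesis by (simp add: Suc Suc.IH flip: mult.assoc del: of_nat_Suc)
  qed simp
  finally show ?case by (simp del: of_nat_Suc)
qed simp

lemma gbinomial_step: "of_nat k * (y - 1 gchoose k) = (y - of_nat k) * (y - 1 gchoose (k - 1))" if "k > 0" for y :: rat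
proof -
  from that obtain j where k: "k = Suc j" by (cases k) auto
  show ?thesis using gbinomial_absorb_comp[of "y - 1" j] gbinomial_absorption[of j "y - 1"] unfolding k
    by (simp add: algebra_simps)
qed

text \<open>Coefficient form of F^[r] E^[A] = sum over k of E^[A-k] ((-H - r - A + 2k) choose k)
  F^[r-k], applied to F^[C] 1_l. The term that lands on (a, c) has A = a + k and C = c + k - r, and
  there H acts by l - 2c; the condition excludes negative C.\<close>

lemma act_dF: "act (dF r) v a c l =
   (\<Sum>k\<le>r. if r \<le> c + k then (2 * of_nat (c + k - r) + of_nat r - of_nat (a + k) - of_int l gchoose k) *
      of_nat (c choose (c + k - r)) * v (a + k) (c + k - r) l else 0)"
proof (induction r arbitrary: a c)
  case (Suc r)
  let ?t = "\<lambda>r a c k. if r \<le> c + k then (2 * of_nat (c + k - r) + of_nat r - of_nat (a + k) - of_int l gchoose k) *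
      of_nat (c choose (c + k - r)) * v (a + k) (c + k - r) l else 0"
  have "of_nat (Suc r) * act (dF (Suc r)) v a c l = act (uF * dF r) v a c l"
    unfolding d_Suc by (simp del: of_nat_Suc)
  also have "\<dots> = of_nat c * (\<Sum>k\<le>r. ?t r a (c - 1) k) + (2 * of_nat c - of_nat a - of_int l) * (\<Sum>k\<le>r. ?t r (a + 1) c k)"
    unfolding act_simps act_gens opF_def Suc.IH ..
  \<comment> \<open>The first summand of \<open>opF\<close> keeps the index k and the second raises
    it by one; both sums are put on the range up to \<open>Suc r\<close> so that they can be
    compared term by term.\<close>
  also have "of_nat c * (\<Sum>k\<le>r. ?t r a (c - 1) k) = (\<Sum>k\<le>Suc r. of_nat c * (if k \<le> r then ?t r a (c - 1) k else 0))"
    by (simp add: sum_distrib_left)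
  also have "(\<Sum>k\<le>r. ?t r (a + 1) c k) = (\<Sum>k\<le>Suc r. if k = 0 then 0 else ?t r (a + 1) c (k - 1))"
    by (simp only: sum.atMost_Suc_shift diff_Suc_1 nat.simps simp_thms if_True if_False add_0 cong: if_cong)
  also have "(\<Sum>k\<le>Suc r. of_nat c * (if k \<le> r then ?t r a (c - 1) k else 0)) +
      (2 * of_nat c - of_nat a - of_int l) * (\<Sum>k\<le>Suc r. if k = 0 then 0 else ?t r (a + 1) c (k - 1)) =
      (\<Sum>k\<le>Suc r. of_nat c * (if k \<le> r then ?t r a (c - 1) k else 0) +
        (2 * of_nat c - of_nat a - of_int l) * (if k = 0 then 0 else ?t r (a + 1) c (k - 1)))"
    by (simp only: sum_distrib_left sum.distrib)
  also have "\<dots> = (\<Sum>k\<le>Suc r. of_nat (Suc r) * ?t (Suc r) a c k)"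
  proof (rule sum.cong[OF refl])
    fix k assume "k \<in> {..Suc r}"
    then have k: "k \<le> Suc r" by simp
    show "of_nat c * (if k \<le> r then ?t r a (c - 1) k else 0) +
        (2 * of_nat c - of_nat a - of_int l) * (if k = 0 then 0 else ?t r (a + 1) c (k - 1)) =
        of_nat (Suc r) * ?t (Suc r) a c k"
    proof (cases "Suc r \<le> c + k")
      case False
      then show ?thesis by (cases k) (auto simp: not_le)
    next
      case True
      define C where "C = c + k - Suc r"
      define y where "y = 2 * of_nat C + of_nat (Suc r) - of_nat (a + k) - (of_int l :: rat)"
      define w where "w = v (a + k) C l"
      have c: "of_nat c = (of_nat C + of_nat (Suc r) - of_nat k :: rat)"
        using True k by (simp add: C_def of_nat_diff)
      have 1: "of_nat c * (if k \<le> r then ?t r a (c - 1) k else 0) =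
          (of_nat (Suc r) - of_nat k) * (y - 1 gchoose k) * of_nat (c choose C) * w"
      proof (cases "k \<le> r")
        case True': True
        then obtain c' where c': "c = Suc c'" using True by (cases c) auto
        have e: "c - 1 + k - r = C" "r \<le> c - 1 + k" using True by (auto simp: C_def c')
        have "of_nat c * of_nat (c' choose C) = (of_nat (Suc r) - of_nat k) * (of_nat (c choose C) :: rat)"
        proof -
          have "(Suc c' - C) * (Suc c' choose C) = Suc c' * (c' choose C)"
            using binomial_absorb_comp[of "Suc c'" C] by simp
          moreover have "Suc c' - C = Suc r - k" using True True' by (simp add: C_def c')
          ultimately show ?thesis using True' c' by (metis Suc_leD Suc_le_mono of_nat_diff of_nat_mult le_SucI)
        qed
        moreover have "y - 1 = 2 * of_nat C + of_nat r - of_nat (a + k) - of_int l" by (simp add: y_def)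
        then have "of_nat c * (if k \<le> r then ?t r a (c - 1) k else 0) =
            (of_nat c * of_nat (c' choose C)) * ((y - 1 gchoose k) * w)"
          using True' e c' by (simp only: w_def if_True diff_Suc_1 mult.assoc mult.left_commute)
        ultimately show ?thesis by (simp only: mult.assoc mult.left_commute)
      next
        case False
        with k have "k = Suc r" by simp
        then show ?thesis by simp
      qed
      have 2: "(2 * of_nat c - of_nat a - of_int l) * (if k = 0 then 0 else ?t r (a + 1) c (k - 1)) =
         (y + of_nat (Suc r) - of_nat k) * (if k = 0 then 0 else (y - 1 gchoose (k - 1))) * of_nat (c choose C) * w"
      proof (cases k)
        case (Suc j)
        have e: "c + j - r = C" "r \<le> c + j" using True by (auto simp: C_def Suc)
        have y: "y - 1 = 2 * of_nat C + of_nat r - of_nat (a + 1 + j) - of_int l" by (simp add: y_def Suc)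
        have "2 * of_nat c - of_nat a - of_int l = y + of_nat (Suc r) - of_nat k"
          by (simp add: y_def c)
        then show ?thesis using e unfolding y
          by (simp only: Suc w_def nat.simps if_False if_True diff_Suc_1 mult.assoc) simp
      qed simp
      have 3: "of_nat (Suc r) * ?t (Suc r) a c k = of_nat (Suc r) * ((y gchoose k) * of_nat (c choose C) * w)"
        using True by (simp add: w_def y_def C_def)
      \<comment> \<open>Pascal's rule for y choose k; the two terms left over cancel by
        \<open>gbinomial_step\<close>.\<close>
      have 4: "(of_nat (Suc r) - of_nat k) * (y - 1 gchoose k) + (y + of_nat (Suc r) - of_nat k) *
          (if k = 0 then 0 else (y - 1 gchoose (k - 1))) = of_nat (Suc r) * (y gchoose k)"
      proof (cases "k = 0")
        case False
        then have "y gchoose k = (y - 1 gchoose (k - 1)) + (y - 1 gchoose k)"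
          by (intro gbinomial_reduce_nat) auto
        then show ?thesis using False gbinomial_step[of k y] by (simp add: algebra_simps)
      qed simp
      show ?thesis by (simp only: 1 2 3 mult.assoc[symmetric] 4[symmetric] distrib_right)
    qed
  qed
  also have "\<dots> = of_nat (Suc r) * (\<Sum>k\<le>Suc r. ?t (Suc r) a c k)" by (simp only: sum_distrib_left)
  finally show ?case by (simp del: of_nat_Suc sum.atMost_Suc)
qed simp

lemma act_dF_v0: "act (dF r) v0 a c l = (if a = 0 \<and> c = r then 1 else 0)"
proof -
  have "act (dF r) v0 a c l = (\<Sum>k\<le>r. if k = 0 then if a = 0 \<and> c = r then 1 else 0 else 0)"
    unfolding act_dF by (intro sum.cong refl) (auto simp: v0_def)
  then show ?thesis by (simp add: sum.delta)
qed

lemma act_pbw: "act (dE a' * ev g * dF c') v0 a c l =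
   (if a = a' \<and> c = c' then poly g (of_int l - 2 * of_nat c) else 0)"
  by (auto simp: act_dE act_ev act_dF_v0)

lemma act_pbw_sum: "act (\<Sum>a<n. \<Sum>c<n. dE a * ev (g a c) * dF c) v0 a c l =
   (if a < n \<and> c < n then poly (g a c) (of_int l - 2 * of_nat c) else 0)"
proof -
  have "act (\<Sum>a<n. \<Sum>c<n. dE a * ev (g a c) * dF c) v0 a c l =
    (\<Sum>a'<n. \<Sum>c'<n. if c' = c then if a' = a then poly (g a c) (of_int l - 2 * of_nat c) else 0 else 0)"
    unfolding act_sum act_pbw by (intro sum.cong refl) auto
  then show ?thesis by (cases "c < n") (simp_all add: sum.delta)
qed

lemma poly_int_zero: assumes "\<And>z::int. poly p (of_int z) = (0::rat)" shows "p = 0"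
proof (rule ccontr)
  assume "p \<noteq> 0"
  then have "finite {x. poly p x = 0}" by (rule poly_roots_finite)
  moreover have "range (of_int :: int \<Rightarrow> rat) \<subseteq> {x. poly p x = 0}" using assms by auto
  ultimately have "finite (range (of_int :: int \<Rightarrow> rat))" by (rule finite_subset[rotated])
  then show False using finite_imageD[of "of_int :: int \<Rightarrow> rat" UNIV] by (simp add: inj_on_def)
qed

text \<open>Independence half of the PBW theorem: the symbol of a PBW sum lists the values of its
  polynomial coefficients at all integers, and a polynomial that vanishes on the integers is
  zero.\<close>

lemma symbol_inject: "act x v0 = act y v0 \<longleftrightarrow> x = y"
proof
  assume *: "act x v0 = act y v0"
  obtain n g where d: "x - y = (\<Sum>a<n. \<Sum>c<n. dE a * ev (g a c) * dF c)" using pbw_all[of "x - y"] by (auto simp: pbw_def)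
  have "g a c = 0" if "a < n" "c < n" for a c
  proof (rule poly_int_zero)
    fix z :: int
    \<comment> \<open>The shift by 2c compensates the weight of F^[c], so that the coefficient is
      evaluated at z itself.\<close>
    have "act (x - y) v0 a c (z + 2 * int c) = 0" by (simp add: *)
    then show "poly (g a c) (of_int z) = 0" unfolding d act_pbw_sum using that by simp
  qed
  then have "x - y = 0" unfolding d by simp
  then show "x = y" by simp
qed simp


section \<open>The Kostant form\<close>

text \<open>Binomial coefficient with an upper argument that may be negative. The floor is exact by
  \<open>of_int_ibin\<close>; an integer value is needed for reduction mod p.\<close>

definition ibin :: "int \<Rightarrow> nat \<Rightarrow> int" where "ibin z k = \<lfloor>(of_int z :: rat) gchoose k\<rfloor>"

lemma of_int_ibin: "of_int (ibin z k) = (of_int z :: rat) gchoose k"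
  unfolding ibin_def of_int_gbinomial[symmetric] floor_of_int ..

lemma ibin_0 [simp]: "ibin z 0 = 1" "ibin 0 (Suc k) = 0" by (simp_all add: ibin_def)

lemma ibin_Suc_Suc: "ibin (z + 1) (Suc k) = ibin z k + ibin z (Suc k)"
proof -
  have "of_int (ibin (z + 1) (Suc k)) = (of_int (ibin z k + ibin z (Suc k)) :: rat)"
    using gbinomial_Suc_Suc[of "of_int z :: rat" k] by (simp add: of_int_ibin)
  then show ?thesis by (simp only: of_int_eq_iff)
qed

lemma ibin_of_nat: "ibin (int n) k = int (n choose k)"
  by (simp add: ibin_def flip: binomial_gbinomial)

lemma act_dF_int: "act (dF r) v a c l =
   (\<Sum>k\<le>r. if r \<le> c + k then of_int (ibin (2 * int (c + k - r) + int r - int (a + k) - l) k) *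
      of_nat (c choose (c + k - r)) * v (a + k) (c + k - r) l else 0)"
  unfolding act_dF of_int_ibin by (simp cong: if_cong)

lemma rep_uq_power: "rep_uq (x ^ n) = rep_uq x [^]\<^bsub>Usl2\<^esub> n"
  by (induction n) (simp_all add: rep_uq_simps power_Suc2 del: power_Suc)

lemma rep_dE: "divided_power Usl2 E_Q n = rep_uq (dE n)"
  and rep_dF: "divided_power Usl2 F_Q n = rep_uq (dF n)"
  by (simp_all add: divided_power_def dE_def dF_def rep_sc_mult rep_uq_power)

definition binpoly :: "nat \<Rightarrow> rat poly" where
  "binpoly n = smult (1 / fact n) (\<Prod>i<n. [:- of_nat i, 1:])"

lemma poly_binpoly: "poly (binpoly n) x = x gchoose n"
  unfolding binpoly_def gbinomial_prod_rev by (simp add: poly_prod atLeast0LessThan)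

lemma degree_binpoly: "degree (binpoly n) \<le> n"
proof -
  have "degree (\<Prod>i<n. [:- of_nat i, 1:] :: rat poly) \<le> n"
  proof (induction n)
    case (Suc n)
    then show ?case using degree_mult_le[of "\<Prod>i<n. [:- of_nat i, 1:] :: rat poly" "[:- of_nat n, 1:]"]
      by (simp del: mult_pCons_right)
  qed simp
  then show ?thesis by (simp add: binpoly_def)
qed

lemma rep_binomial: "binomial_elt Usl2 H_Q n = rep_uq (ev (binpoly n))"
proof -
  have "falling_factorial Usl2 H_Q n = rep_uq (ev (\<Prod>i<n. [:- of_nat i, 1:]))" for n
  proof (induction n)
    case (Suc n)
    have "rep_uq (ev [:- of_nat n, 1:]) = H_Q \<ominus>\<^bsub>Usl2\<^esub> (of_nat n \<odot>\<^bsub>Usl2\<^esub> \<one>\<^bsub>Usl2\<^esub>)"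
      using rep_sc_mult[of "of_nat n" 1] by (simp add: rep_uq_simps a_minus_def U.a_comm)
    then show ?case unfolding falling_factorial.simps Suc prod.lessThan_Suc ev_mult rep_uq_simps by simp
  qed (simp add: rep_uq_simps)
  then show ?thesis unfolding binomial_elt_def binpoly_def by (simp only: ev_smult rep_sc_mult)
qed

section \<open>The integral form inside the type \<open>uq\<close>\<close>

definition kost :: "uq set" where "kost = {x. rep_uq x \<in> kostant_form}"

lemma kost_gens: "range (divided_power Usl2 E_Q) \<union> range (divided_power Usl2 F_Q) \<subseteq> carrier Usl2"
  by (auto simp: rep_dE rep_dF)

lemma kostant_closed: "x \<in> kostant_form \<Longrightarrow> x \<in> carrier Usl2"
  unfolding kostant_form_def by (rule U.generate_ring_in_carrier[OF kost_gens])

lemma kostant_form_eq: "kostant_form = rep_uq ` kost"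
  using kostant_closed by (auto simp: kost_def image_iff) (metis rep_abs_uq)

lemma kost_dE: "dE n \<in> kost" and kost_dF: "dF n \<in> kost" and kost_1: "1 \<in> kost"
  by (auto simp: kost_def kostant_form_def rep_uq_simps rep_dE[symmetric] rep_dF[symmetric]
     intro: generate_ring.intros)

lemma kost_uminus: "x \<in> kost \<Longrightarrow> - x \<in> kost"
  and kost_add: "x \<in> kost \<Longrightarrow> y \<in> kost \<Longrightarrow> x + y \<in> kost"
  and kost_mult: "x \<in> kost \<Longrightarrow> y \<in> kost \<Longrightarrow> x * y \<in> kost"
  by (auto simp: kost_def kostant_form_def rep_uq_simps intro: generate_ring.intros)

lemma kost_diff: "x \<in> kost \<Longrightarrow> y \<in> kost \<Longrightarrow> x - y \<in> kost"
  using kost_add[of x "- y"] kost_uminus by simp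

lemma kost_0: "0 \<in> kost" using kost_diff[OF kost_1 kost_1] by simp

lemma kost_sum: "(\<And>i. i \<in> A \<Longrightarrow> f i \<in> kost) \<Longrightarrow> (\<Sum>i\<in>A. f i) \<in> kost"
  by (induction A rule: infinite_finite_induct) (auto intro: kost_0 kost_add)

lemma kost_of_nat: "of_nat n \<in> kost"
  by (induction n) (auto intro: kost_0 kost_1 kost_add)

lemma kost_of_int: "of_int n \<in> kost"
  by (cases n rule: int_diff_cases) (auto intro: kost_diff kost_of_nat)

lemma kost_induct [consumes 1, case_names one E F uminus add mult]:
  assumes "x \<in> kost" "P 1" "\<And>n. P (dE n)" "\<And>n. P (dF n)" "\<And>x. x \<in> kost \<Longrightarrow> P x \<Longrightarrow> P (- x)"
    "\<And>x y. x \<in> kost \<Longrightarrow> y \<in> kost \<Longrightarrow> P x \<Longrightarrow> P y \<Longrightarrow> P (x + y)"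
    "\<And>x y. x \<in> kost \<Longrightarrow> y \<in> kost \<Longrightarrow> P x \<Longrightarrow> P y \<Longrightarrow> P (x * y)"
  shows "P x"
proof -
  have "P (abs_uq u) \<and> u \<in> carrier Usl2" if "u \<in> kostant_form" for u
    using that unfolding kostant_form_def
  proof (induction u rule: generate_ring.induct)
    case one then show ?case using assms(2) by (simp add: one_uq_def)
  next
    case (incl h) then show ?case using assms(3,4) by (auto simp: rep_dE rep_dF rep_uq_inverse)
  next
    case (a_inv h)
    then have "abs_uq (\<ominus>\<^bsub>Usl2\<^esub> h) = - abs_uq h" by (simp add: rep_uq_inject[symmetric] rep_uq_simps)
    then show ?case using a_inv assms(5)[of "abs_uq h"] by (simp add: kost_def kostant_form_def)
  next
    case (eng_add h1 h2)
    then have "abs_uq (h1 \<oplus>\<^bsub>Usl2\<^esub> h2) = abs_uq h1 + abs_uq h2" by (simp add: rep_uq_inject[symmetric] rep_uq_simps)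
    then show ?case using eng_add assms(6)[of "abs_uq h1" "abs_uq h2"] by (simp add: kost_def kostant_form_def)
  next
    case (eng_mult h1 h2)
    then have "abs_uq (h1 \<otimes>\<^bsub>Usl2\<^esub> h2) = abs_uq h1 * abs_uq h2" by (simp add: rep_uq_inject[symmetric] rep_uq_simps)
    then show ?case using eng_mult assms(7)[of "abs_uq h1" "abs_uq h2"] by (simp add: kost_def kostant_form_def)
  qed
  from this[of "rep_uq x"] show ?thesis using assms(1) by (simp add: kost_def rep_uq_inverse)
qed

lemma kost_integral: "x \<in> kost \<Longrightarrow> (\<And>a c l. v a c l \<in> \<int>) \<Longrightarrow> act x v a c l \<in> \<int>"
proof (induction x arbitrary: v a c l rule: kost_induct)
  case (F n)
  then show ?case unfolding act_dF_int by (intro Ints_sum) auto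
qed (auto simp: act_dE)

text \<open>The matrix of the numbers i choose b is unitriangular, so interpolation at 0, ..., d has
  integral coefficients; the new coefficient corrects the value at d + 1 without changing the
  earlier ones.\<close>

lemma newton_nat: "\<exists>n :: nat \<Rightarrow> int. \<forall>i\<le>d. f i = (\<Sum>b\<le>d. n b * int (i choose b))"
proof (induction d)
  case 0 show ?case by (intro exI[of _ "\<lambda>_. f 0"]) simp
next
  case (Suc d)
  then obtain n where n: "\<And>i. i \<le> d \<Longrightarrow> f i = (\<Sum>b\<le>d. n b * int (i choose b))" by blast
  define n' where "n' = n(Suc d := f (Suc d) - (\<Sum>b\<le>d. n b * int (Suc d choose b)))"
  have "(\<Sum>b\<le>Suc d. n' b * int (i choose b)) = (\<Sum>b\<le>d. n b * int (i choose b)) + n' (Suc d) * int (i choose Suc d)" for i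
    by (simp add: n'_def)
  then have "f i = (\<Sum>b\<le>Suc d. n' b * int (i choose b))" if "i \<le> Suc d" for i
    using n[of i] that by (cases "i = Suc d") (auto simp: n'_def le_Suc_eq)
  then show ?case by blast
qed

text \<open>Integer-valued polynomials are integral combinations of binomials: the interpolation at
  0, ..., d agrees with g at d + 1 points and both have degree at most d.\<close>

lemma newton_poly:
  assumes "\<And>z::int. poly g (of_int z) \<in> (\<int> :: rat set)" "degree g \<le> d"
  shows "\<exists>n :: nat \<Rightarrow> int. g = (\<Sum>b\<le>d. smult (of_int (n b)) (binpoly b))"
proof -
  have "\<exists>m. poly g (of_nat i) = of_int m" for i
    using assms(1)[of "int i"] by (auto elim: Ints_cases)
  then obtain f where f: "\<And>i. poly g (of_nat i) = of_int (f i)" by metis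
  obtain n where n: "\<And>i. i \<le> d \<Longrightarrow> f i = (\<Sum>b\<le>d. n b * int (i choose b))" using newton_nat[of d f] by blast
  let ?h = "\<Sum>b\<le>d. smult (of_int (n b)) (binpoly b)"
  have "poly g (of_nat i) = poly ?h (of_nat i)" if "i \<le> d" for i
    using n[OF that] by (simp add: f poly_sum poly_binpoly flip: binomial_gbinomial)
  moreover have "degree ?h \<le> d"
    using degree_binpoly by (intro degree_sum_le) (auto intro: order_trans[OF degree_smult_le] order_trans)
  moreover have "card ((of_nat :: nat \<Rightarrow> rat) ` {..d}) = Suc d" by (simp add: card_image inj_on_def)
  ultimately have "g = ?h"
    using assms(2) by (intro poly_eqI_degree[of "of_nat ` {..d}"]) auto
  then show ?thesis by blast
qed

lemma kost_newton:
  assumes "\<And>z::int. poly g (of_int z) \<in> (\<int> :: rat set)" "degree g \<le> d"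
    and "\<And>b. b \<le> d \<Longrightarrow> ev (binpoly b) \<in> kost"
  shows "ev g \<in> kost"
proof -
  obtain n :: "nat \<Rightarrow> int" where "g = (\<Sum>b\<le>d. smult (of_int (n b)) (binpoly b))" using newton_poly[OF assms(1,2)] by blast
  then have "ev g = (\<Sum>b\<le>d. of_int (n b) * ev (binpoly b))" by (simp add: ev_sum sc_of_int)
  then show ?thesis using assms(3) by (auto intro!: kost_sum kost_mult kost_of_int)
qed

lemma symbol_FE: "act (dF r * dE r) v0 a c l = (if a = c \<and> a \<le> r then of_int (ibin (- l) (r - a)) else 0)"
proof -
  have "act (dF r * dE r) v0 a c l = (\<Sum>k\<le>r. if k = r - a then if a = c \<and> a \<le> r then of_int (ibin (- l) (r - a)) else 0 else 0)"
    unfolding act_simps act_dF_int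
  proof (intro sum.cong refl)
    fix k assume "k \<in> {..r}"
    then show "(if r \<le> c + k then of_int (ibin (2 * int (c + k - r) + int r - int (a + k) - l) k) *
       of_nat (c choose (c + k - r)) * act (dE r) v0 (a + k) (c + k - r) l else 0) =
       (if k = r - a then if a = c \<and> a \<le> r then of_int (ibin (- l) (r - a)) else 0 else 0)"
      unfolding act_dE by (auto simp: v0_def)
  qed
  then show ?thesis by (simp add: sum.delta)
qed

text \<open>Elements with equal symbols are equal, so the expansion is read off from
  \<open>symbol_FE\<close> without commuting anything. The polynomial between E^[a] and F^[a] is (-H
  - 2a) choose (r - a).\<close>

lemma FE_expand:
  "dF r * dE r = (\<Sum>a<Suc r. dE a * ev (pcompose (binpoly (r - a)) [:- 2 * of_nat a, - 1:]) * dF a)"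
proof -
  let ?g = "\<lambda>a c. if a = c then pcompose (binpoly (r - a)) [:- 2 * of_nat a, - 1:] else 0"
  have "act (dF r * dE r) v0 = act (\<Sum>a<Suc r. \<Sum>c<Suc r. dE a * ev (?g a c) * dF c) v0"
    unfolding symbol_FE act_pbw_sum fun_eq_iff
    by (auto simp: poly_pcompose poly_binpoly of_int_ibin)
  then have "dF r * dE r = (\<Sum>a<Suc r. \<Sum>c<Suc r. dE a * ev (?g a c) * dF c)" by (simp only: symbol_inject)
  also have "\<dots> = (\<Sum>a<Suc r. \<Sum>c<Suc r. if a = c then dE a * ev (?g a a) * dF a else 0)"
    by (intro sum.cong refl) auto
  also have "\<dots> = (\<Sum>a<Suc r. dE a * ev (?g a a) * dF a)"
    by (simp add: sum.delta' del: sum.lessThan_Suc)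
  finally show ?thesis by simp
qed

text \<open>Expand F^[r] E^[r]. The terms with a > 0 contain integer-valued polynomials of degree
  less than r, which lie in the form by induction and \<open>newton_poly\<close>; so the remaining
  term (-H) choose r does too. Finally H choose r is an integral combination of the elements (-H)
  choose b with b at most r.\<close>

lemma kost_binpoly: "ev (binpoly r) \<in> kost"
proof (induction r rule: less_induct)
  case (less r)
  let ?g = "\<lambda>a. pcompose (binpoly (r - a)) [:- 2 * of_nat a, - 1 :: rat:]"
  have int: "poly (?g a) (of_int z) \<in> \<int>" for a and z :: int
  proof -
    have "poly (?g a) (of_int z) = of_int (ibin (- 2 * int a - z) (r - a))"
      unfolding of_int_ibin by (simp add: poly_pcompose poly_binpoly)
    then show ?thesis by simp
  qed
  have deg: "degree (?g a) \<le> r - a" for a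
    using degree_binpoly[of "r - a"] by (simp add: degree_pcompose)
  have small: "ev g \<in> kost" if "\<And>z::int. poly g (of_int z) \<in> (\<int> :: rat set)" "degree g < r" for g
    by (rule kost_newton[OF that(1), of "r - 1"]) (use that(2) less in auto)
  have "ev (?g a) \<in> kost" if "0 < a" "a \<le> r" for a
    using that deg[of a] by (intro small int) auto
  then have "(\<Sum>a\<in>{1..r}. dE a * ev (?g a) * dF a) \<in> kost"
    by (intro kost_sum kost_mult kost_dE kost_dF) auto
  moreover have "dF r * dE r = ev (?g 0) + (\<Sum>a\<in>{1..r}. dE a * ev (?g a) * dF a)"
    unfolding FE_expand lessThan_Suc_atMost sum.atMost_shift
    by (simp add: sum.shift_bounds_nat_ivl sum.atLeast1_atMost_eq lessThan_Suc_atMost[symmetric] del: sum.lessThan_Suc)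
  then have "ev (?g 0) = dF r * dE r - (\<Sum>a\<in>{1..r}. dE a * ev (?g a) * dF a)" by simp
  ultimately have 0: "ev (?g 0) \<in> kost"
    using kost_diff[OF kost_mult[OF kost_dF[of r] kost_dE[of r]]] by simp
  let ?h = "pcompose (binpoly r) [:0, - 1 :: rat:]"
  have g0: "?g 0 = ?h" by simp
  have hint: "poly ?h (of_int z) \<in> \<int>" for z :: int using int[of 0 z] by simp
  have hdeg: "degree ?h \<le> r" using deg[of 0] by simp
  obtain n :: "nat \<Rightarrow> int" where n: "?h = (\<Sum>b\<le>r. smult (of_int (n b)) (binpoly b))" using newton_poly[OF hint hdeg] by blast
  \<comment> \<open>Substituting -H for H in the expansion of (-H) choose r gives an expansion of H
    choose r.\<close>
  have "pcompose ?h [:0, - 1:] = binpoly r"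
    unfolding pcompose_assoc[symmetric] by (simp add: pcompose_pCons)
  then have "binpoly r = (\<Sum>b\<le>r. smult (of_int (n b)) (pcompose (binpoly b) [:0, - 1:]))"
    unfolding n by (simp add: pcompose_sum pcompose_smult)
  then have "ev (binpoly r) = (\<Sum>b\<le>r. of_int (n b) * ev (pcompose (binpoly b) [:0, - 1:]))"
    by (metis (mono_tags, lifting) ev_sum ev_smult sc_of_int sum.cong)
  moreover have "ev (pcompose (binpoly b) [:0, - 1:]) \<in> kost" if "b \<le> r" for b
  proof (cases "b = r")
    case True then show ?thesis using 0 g0 by simp
  next
    case False
    have "poly (pcompose (binpoly b) [:0, - 1:]) (of_int z) = of_int (ibin (- z) b)" for z :: int
      unfolding of_int_ibin by (simp add: poly_pcompose poly_binpoly)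
    then show ?thesis using False that degree_binpoly[of b] by (intro small) (simp_all add: degree_pcompose)
  qed
  ultimately show ?case by (auto intro!: kost_sum kost_mult kost_of_int)
qed

text \<open>If the symbol is integral, each polynomial coefficient of the PBW expansion takes
  integral values on the integers, hence is an integral combination of binomials in H. This
  criterion makes division by p in the form a matter of symbols.\<close>

lemma kost_iff: "x \<in> kost \<longleftrightarrow> (\<forall>a c l. act x v0 a c l \<in> \<int>)"
proof
  assume "x \<in> kost" then show "\<forall>a c l. act x v0 a c l \<in> \<int>"
    by (auto intro!: kost_integral simp: v0_def)
next
  assume *: "\<forall>a c l. act x v0 a c l \<in> \<int>"
  obtain n g where x: "x = (\<Sum>a<n. \<Sum>c<n. dE a * ev (g a c) * dF c)" using pbw_all[of x] by (auto simp: pbw_def)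
  have "ev (g a c) \<in> kost" if "a < n" "c < n" for a c
  proof (rule kost_newton[OF _ order_refl kost_binpoly])
    fix z :: int
    have "act x v0 a c (z + 2 * int c) \<in> \<int>" using * by blast
    then show "poly (g a c) (of_int z) \<in> \<int>" unfolding x act_pbw_sum using that by simp
  qed
  then show "x \<in> kost" unfolding x by (auto intro!: kost_sum kost_mult kost_dE kost_dF)
qed

lemma kost_symbol: "x \<in> kost \<Longrightarrow> \<exists>n. \<forall>a c l. act x v0 a c l = of_int (n a c l)"
  unfolding kost_iff by (intro exI[of _ "\<lambda>a c l. \<lfloor>act x v0 a c l\<rfloor>"]) (auto simp: Ints_def)

section \<open>The algebra of distributions\<close>

abbreviation (input) "Kform \<equiv> Usl2\<lparr>carrier := kostant_form\<rparr>"

lemma Kform_ring: "ring Kform"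
  unfolding kostant_form_def by (rule U.generate_ring_is_ring[OF kost_gens])

lemma kostant_multiples_eq: "kostant_multiples p = rep_uq ` {of_nat p * x | x. x \<in> kost}"
proof -
  have "of_nat p \<odot>\<^bsub>Usl2\<^esub> rep_uq y = rep_uq (of_nat p * y)" for y
    unfolding rep_sc_mult[symmetric] sc_of_nat ..
  then show ?thesis unfolding kostant_multiples_def kostant_form_eq by force
qed

lemma kform_elem: "rep_uq x \<in> kostant_form \<longleftrightarrow> x \<in> kost"
  by (simp add: kost_def)

lemma kostant_multiples_ideal: "ideal (kostant_multiples p) Kform"
proof (rule idealI[OF Kform_ring])
  interpret K: ring Kform by (rule Kform_ring)
  have um: "\<ominus>\<^bsub>Kform\<^esub> rep_uq x = rep_uq (- x)" if "x \<in> kost" for x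
  proof -
    have "rep_uq (- x) \<oplus>\<^bsub>Kform\<^esub> rep_uq x = \<zero>\<^bsub>Kform\<^esub>" by (simp flip: rep_uq_simps)
    then show ?thesis using that kost_uminus[OF that] by (intro K.minus_equality) (auto simp: kform_elem)
  qed
  have cl: "of_nat p * x \<in> kost" if "x \<in> kost" for x using that by (intro kost_mult kost_of_nat)
  show "subgroup (kostant_multiples p) (add_monoid Kform)"
  proof (rule K.add.subgroupI)
    show "kostant_multiples p \<subseteq> carrier Kform"
      by (auto simp: kostant_multiples_eq kform_elem cl)
    show "kostant_multiples p \<noteq> {}" using kost_0 by (auto simp: kostant_multiples_eq)
    fix a b assume "a \<in> kostant_multiples p" "b \<in> kostant_multiples p"
    then obtain x y where "x \<in> kost" "y \<in> kost" and a: "a = rep_uq (of_nat p * x)" and b: "b = rep_uq (of_nat p * y)"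
      by (auto simp: kostant_multiples_eq)
    then have "a \<oplus>\<^bsub>Kform\<^esub> b = rep_uq (of_nat p * (x + y))" "x + y \<in> kost" by (auto simp: kost_add distrib_left simp flip: rep_uq_simps)
    then show "a \<oplus>\<^bsub>Kform\<^esub> b \<in> kostant_multiples p" unfolding kostant_multiples_eq by blast
    have "\<ominus>\<^bsub>Kform\<^esub> a = rep_uq (of_nat p * (- x))" using um[OF cl[OF \<open>x \<in> kost\<close>]] a by simp
    then show "\<ominus>\<^bsub>Kform\<^esub> a \<in> kostant_multiples p" unfolding kostant_multiples_eq using kost_uminus[OF \<open>x \<in> kost\<close>] by blast
  qed
  fix a x assume "a \<in> kostant_multiples p" "x \<in> carrier Kform"
  then obtain y z where y: "y \<in> kost" "a = rep_uq (of_nat p * y)" and z: "z \<in> kost" "x = rep_uq z"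
    by (auto simp: kostant_multiples_eq kostant_form_eq)
  have "x \<otimes>\<^bsub>Kform\<^esub> a = rep_uq (of_nat p * (z * y))" "a \<otimes>\<^bsub>Kform\<^esub> x = rep_uq (of_nat p * (y * z))"
    unfolding y z by (simp_all flip: rep_uq_simps) (simp_all add: mult.assoc mult_of_nat_commute)
  then show "x \<otimes>\<^bsub>Kform\<^esub> a \<in> kostant_multiples p" "a \<otimes>\<^bsub>Kform\<^esub> x \<in> kostant_multiples p"
    unfolding kostant_multiples_eq using kost_mult y z by blast+
qed

definition dcl :: "nat \<Rightarrow> uq \<Rightarrow> dist" where "dcl p x = dist_class p (rep_uq x)"

lemma dcl_coset: "dcl p x = kostant_multiples p +>\<^bsub>Kform\<^esub> rep_uq x"
  by (simp add: dcl_def dist_class_def a_r_coset_def')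

lemma dcl_mem: "u \<in> dcl p x \<longleftrightarrow> (\<exists>z\<in>kost. u = rep_uq (of_nat p * z + x))"
  by (auto simp: dcl_coset a_r_coset_def' kostant_multiples_eq rep_uq_simps)

lemma dcl_eq_iff: "dcl p x = dcl p y \<longleftrightarrow> (\<exists>z\<in>kost. x - y = of_nat p * z)"
proof
  assume "dcl p x = dcl p y"
  moreover have "rep_uq x \<in> dcl p x" unfolding dcl_mem using kost_0 by (intro bexI[of _ 0]) auto
  ultimately have "rep_uq x \<in> dcl p y" by simp
  then show "\<exists>z\<in>kost. x - y = of_nat p * z" unfolding dcl_mem rep_uq_inject by force
next
  assume "\<exists>z\<in>kost. x - y = of_nat p * z"
  then obtain z where z: "z \<in> kost" "x = of_nat p * z + y" by (auto simp: diff_eq_eq)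
  have "u \<in> dcl p x \<longleftrightarrow> u \<in> dcl p y" for u
    unfolding dcl_mem
  proof
    assume "\<exists>w\<in>kost. u = rep_uq (of_nat p * w + x)"
    then obtain w where "w \<in> kost" "u = rep_uq (of_nat p * (w + z) + y)" by (auto simp: z algebra_simps)
    then show "\<exists>w\<in>kost. u = rep_uq (of_nat p * w + y)" using z kost_add by blast
  next
    assume "\<exists>w\<in>kost. u = rep_uq (of_nat p * w + y)"
    then obtain w where "w \<in> kost" "u = rep_uq (of_nat p * (w - z) + x)" by (auto simp: z algebra_simps)
    then show "\<exists>w\<in>kost. u = rep_uq (of_nat p * w + x)" using z kost_diff by blast
  qed
  then show "dcl p x = dcl p y" by blast
qed

abbreviation dist_alg :: "'p::prime_card itself \<Rightarrow> ('p mod_ring, dist) module" where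
  "dist_alg _ \<equiv> Dist"

context
  fixes D :: "('p::prime_card mod_ring, dist) module"
  defines "D \<equiv> Dist"
begin

lemma Dist_sel: "carrier D = dcl CARD('p) ` kost" "one D = dcl CARD('p) 1" "zero D = dcl CARD('p) 0"
proof -
  interpret ideal "kostant_multiples CARD('p)" Kform by (rule kostant_multiples_ideal)
  have "carrier (Kform Quot kostant_multiples CARD('p)) = dcl CARD('p) ` kost"
    by (auto simp: FactRing_def A_RCOSETS_def' dcl_coset kostant_form_eq)
  then show "carrier D = dcl CARD('p) ` kost"
    by (simp add: D_def Dist_def Let_def ring.defs module.defs)
  show "one D = dcl CARD('p) 1"
    by (simp add: D_def Dist_def Let_def ring.defs module.defs FactRing_def dcl_coset rep_uq_simps)
  have "zero D = kostant_multiples CARD('p)"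
    by (simp add: D_def Dist_def Let_def ring.defs module.defs FactRing_def)
  also have "\<dots> = dcl CARD('p) 0"
  proof -
    have "u \<in> dcl CARD('p) 0 \<longleftrightarrow> (\<exists>z\<in>kost. u = rep_uq (of_nat CARD('p) * z))" for u by (simp add: dcl_mem)
    then show ?thesis unfolding kostant_multiples_eq by blast
  qed
  finally show "zero D = dcl CARD('p) 0" .
qed

lemma Dist_mult: "x \<in> kost \<Longrightarrow> y \<in> kost \<Longrightarrow> dcl CARD('p) x \<otimes>\<^bsub>D\<^esub> dcl CARD('p) y = dcl CARD('p) (x * y)"
proof -
  interpret ideal "kostant_multiples CARD('p)" Kform by (rule kostant_multiples_ideal)
  assume "x \<in> kost" "y \<in> kost"
  then show ?thesis using rcoset_mult_add[of "rep_uq x" "rep_uq y"]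
    by (simp add: D_def Dist_def Let_def ring.defs module.defs FactRing_def dcl_coset kform_elem rep_uq_simps)
qed

lemma Dist_add: "x \<in> kost \<Longrightarrow> y \<in> kost \<Longrightarrow> dcl CARD('p) x \<oplus>\<^bsub>D\<^esub> dcl CARD('p) y = dcl CARD('p) (x + y)"
proof -
  interpret ideal "kostant_multiples CARD('p)" Kform by (rule kostant_multiples_ideal)
  assume "x \<in> kost" "y \<in> kost"
  then show ?thesis using a_rcos_sum[of "rep_uq x" "rep_uq y"]
    by (simp add: D_def Dist_def Let_def ring.defs module.defs FactRing_def dcl_coset kform_elem rep_uq_simps)
qed

lemma Dist_smult: "x \<in> kost \<Longrightarrow> c \<odot>\<^bsub>D\<^esub> dcl CARD('p) x = dcl CARD('p) (of_int (to_int_mod_ring c) * x)"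
proof -
  let ?k = "to_int_mod_ring c"
  assume x: "x \<in> kost"
  have "kostant_multiples CARD('p) +>\<^bsub>Usl2\<^esub> (of_int ?k \<odot>\<^bsub>Usl2\<^esub> u) = dcl CARD('p) (of_int ?k * x)"
    if u: "u \<in> dcl CARD('p) x" for u
  proof -
    from u obtain z where z: "z \<in> kost" "u = rep_uq (of_nat CARD('p) * z + x)" unfolding dcl_mem by blast
    have "of_int ?k \<odot>\<^bsub>Usl2\<^esub> u = rep_uq (of_int ?k * (of_nat CARD('p) * z + x))"
      unfolding z(2) rep_sc_mult[symmetric] sc_of_int ..
    then have "kostant_multiples CARD('p) +>\<^bsub>Usl2\<^esub> (of_int ?k \<odot>\<^bsub>Usl2\<^esub> u) = dcl CARD('p) (of_int ?k * (of_nat CARD('p) * z + x))"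
      by (simp add: dcl_def dist_class_def)
    also have "\<dots> = dcl CARD('p) (of_int ?k * x)"
      unfolding dcl_eq_iff using kost_mult[OF kost_of_int z(1), of ?k]
      by (intro bexI[of _ "of_int ?k * z"]) (simp_all add: algebra_simps mult_of_nat_commute)
    finally show ?thesis .
  qed
  moreover have "dcl CARD('p) x \<noteq> {}" using dcl_mem[of _ "CARD('p)" x] kost_0 by blast
  ultimately have "(\<Union>u\<in>dcl CARD('p) x. kostant_multiples CARD('p) +>\<^bsub>Usl2\<^esub> (of_int ?k \<odot>\<^bsub>Usl2\<^esub> u)) = dcl CARD('p) (of_int ?k * x)"
    by (intro SUP_eq_const) auto
  then show ?thesis by (simp add: D_def Dist_def Let_def ring.defs module.defs)
qed

end

definition Dist_carrier :: "'p::prime_card itself \<Rightarrow> dist set" where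
  "Dist_carrier _ = carrier (Dist :: ('p mod_ring, dist) module)"

text \<open>The type \<open>dist\<close> does not determine p; the new type carries
  \<open>'p\<close>, so that it can be an instance of \<open>ring_1\<close>.\<close>

typedef (overloaded) ('p::prime_card) dst = "Dist_carrier TYPE('p)" morphisms rep_d abs_d
  unfolding Dist_carrier_def Dist_sel using kost_0 by blast

definition dc :: "uq \<Rightarrow> 'p::prime_card dst" where "dc x = abs_d (dcl CARD('p) x)"

lemma dc_carrier: "x \<in> kost \<Longrightarrow> dcl CARD('p) x \<in> Dist_carrier TYPE('p::prime_card)"
  by (simp add: Dist_carrier_def Dist_sel)

lemma rep_dc: "x \<in> kost \<Longrightarrow> rep_d (dc x :: 'p::prime_card dst) = dcl CARD('p) x"
  using dc_carrier[of x, where 'p = 'p] by (simp add: dc_def abs_d_inverse)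

lemma dc_cases: "(\<And>u. x = (dc u :: 'p::prime_card dst) \<Longrightarrow> u \<in> kost \<Longrightarrow> P) \<Longrightarrow> P"
proof -
  assume *: "\<And>u. x = (dc u :: 'p dst) \<Longrightarrow> u \<in> kost \<Longrightarrow> P"
  obtain u where "u \<in> kost" "rep_d x = dcl CARD('p) u"
    using rep_d[of x] unfolding Dist_carrier_def Dist_sel by blast
  then show P using *[of u] by (metis dc_def rep_d_inverse)
qed

lemma dc_eq_iff: "x \<in> kost \<Longrightarrow> y \<in> kost \<Longrightarrow> (dc x :: 'p::prime_card dst) = dc y \<longleftrightarrow> (\<exists>z\<in>kost. x - y = of_nat CARD('p) * z)"
  by (simp add: rep_d_inject[symmetric] rep_dc dcl_eq_iff)

text \<open>A representative in the Kostant form has an integral symbol, so the floor is exact; by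
  \<open>symb_dc\<close> the residue mod p does not depend on the representative.\<close>

definition symb :: "'p::prime_card dst \<Rightarrow> 'p mod_ring sym" where
  "symb x a c l = of_int \<lfloor>act (SOME u. u \<in> kost \<and> x = dc u) v0 a c l\<rfloor>"

lemma of_int_mod_ring_cong: "(of_int m :: 'p::prime_card mod_ring) = of_int n \<longleftrightarrow> int CARD('p) dvd m - n"
  using of_int_eq_0_iff_char_dvd[of "m - n", where 'a = "'p mod_ring"] by (simp add: semiring_char_mod_ring)

lemma of_int_to_int_mod_ring: "of_int (to_int_mod_ring c) = (c :: 'p::prime_card mod_ring)"
  by (simp add: of_int_of_int_mod_ring)

lemma symb_dc: assumes x: "x \<in> kost" and n: "act x v0 a c l = of_int n"
  shows "symb (dc x :: 'p::prime_card dst) a c l = of_int n"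
proof -
  define u where "u = (SOME u. u \<in> kost \<and> (dc x :: 'p dst) = dc u)"
  have u: "u \<in> kost" "(dc x :: 'p dst) = dc u" using someI[of "\<lambda>u. u \<in> kost \<and> (dc x :: 'p dst) = dc u" x] x unfolding u_def by auto
  then obtain z where z: "z \<in> kost" "u - x = of_nat CARD('p) * z" using dc_eq_iff[OF u(1) x, where 'p = 'p] by auto
  have "act (u - x) v0 a c l = of_nat CARD('p) * act z v0 a c l"
    unfolding z(2) sc_of_nat[symmetric] by simp
  moreover obtain m k where m: "act u v0 a c l = of_int m" "act z v0 a c l = of_int k"
    using u z kost_iff by (metis Ints_cases)
  ultimately have "m - n = int CARD('p) * k" using n by (simp flip: of_int_eq_iff[where 'a = rat])
  then have "(of_int m :: 'p mod_ring) = of_int n" unfolding of_int_mod_ring_cong by simp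
  then show ?thesis unfolding symb_def u_def[symmetric] m by simp
qed

lemma symb_dc': "x \<in> kost \<Longrightarrow> symb (dc x :: 'p::prime_card dst) a c l = of_int \<lfloor>act x v0 a c l\<rfloor>"
  using symb_dc[of x a c l] kost_iff[of x] by (metis Ints_cases floor_of_int)

text \<open>If the symbols of u and w agree mod p, then (u - w)/p, formed in the rational algebra,
  has an integral symbol and lies in the Kostant form by \<open>kost_iff\<close>. So u and w differ
  by p times an element of the form.\<close>

lemma symb_inject: "symb x = symb y \<longleftrightarrow> x = (y :: 'p::prime_card dst)"
proof
  assume *: "symb x = symb y"
  obtain u w where u: "u \<in> kost" "x = dc u" and w: "w \<in> kost" "y = dc w" by (metis dc_cases)
  let ?z = "sc (1 / of_nat CARD('p)) * (u - w)"
  have p: "sc (of_nat CARD('p)) * sc (1 / of_nat CARD('p)) = 1"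
    unfolding sc_simps(4)[symmetric] by simp
  have "act ?z v0 a c l \<in> \<int>" for a c l
  proof -
    obtain m n where m: "act u v0 a c l = of_int m" "act w v0 a c l = of_int n" using u w kost_iff by (metis Ints_cases)
    have "(of_int m :: 'p mod_ring) = of_int n"
      using fun_cong[OF fun_cong[OF fun_cong[OF *, of a], of c], of l] symb_dc[OF u(1) m(1), where 'p = 'p] symb_dc[OF w(1) m(2), where 'p = 'p] u w by simp
    then obtain k where "m - n = int CARD('p) * k" unfolding of_int_mod_ring_cong by blast
    then have "m = n + int CARD('p) * k" by simp
    then have "act ?z v0 a c l = of_int k" by (simp add: m)
    then show ?thesis by simp
  qed
  then have "?z \<in> kost" by (simp add: kost_iff)
  moreover have "u - w = of_nat CARD('p) * ?z"
    by (simp flip: sc_of_nat mult.assoc add: p)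
  ultimately show "x = y" using dc_eq_iff[OF u(1) w(1), where 'p = 'p] u w by blast
qed simp

instantiation dst :: (prime_card) ring_1
begin
definition zero_dst where "0 = abs_d \<zero>\<^bsub>dist_alg TYPE('a)\<^esub>"
definition one_dst where "1 = abs_d \<one>\<^bsub>dist_alg TYPE('a)\<^esub>"
definition plus_dst where "x + y = abs_d (rep_d x \<oplus>\<^bsub>dist_alg TYPE('a)\<^esub> rep_d y)"
definition times_dst where "x * y = abs_d (rep_d x \<otimes>\<^bsub>dist_alg TYPE('a)\<^esub> rep_d y)"
definition uminus_dst where "- x = abs_d ((- 1) \<odot>\<^bsub>dist_alg TYPE('a)\<^esub> rep_d x)"
definition minus_dst where "x - y = x + (- y :: 'a dst)"

lemma dc_add: "x \<in> kost \<Longrightarrow> y \<in> kost \<Longrightarrow> (dc x + dc y :: 'a dst) = dc (x + y)"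
  unfolding plus_dst_def by (simp add: rep_dc Dist_add) (simp add: dc_def)

lemma dc_mult: "x \<in> kost \<Longrightarrow> y \<in> kost \<Longrightarrow> (dc x * dc y :: 'a dst) = dc (x * y)"
  unfolding times_dst_def by (simp add: rep_dc Dist_mult) (simp add: dc_def)

lemma dc_0: "(0 :: 'a dst) = dc 0" and dc_1: "(1 :: 'a dst) = dc 1"
  unfolding zero_dst_def one_dst_def dc_def by (simp_all add: Dist_sel)

lemma dc_uminus: "x \<in> kost \<Longrightarrow> (- dc x :: 'a dst) = dc (- x)"
proof -
  assume x: "x \<in> kost"
  let ?k = "to_int_mod_ring (- 1 :: 'a mod_ring)"
  \<comment> \<open>\<open>to_int_mod_ring\<close> returns an integer that is only congruent to -1;
    the multiple of p in between disappears in the class.\<close>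
  have "int CARD('a) dvd ?k - (- 1)"
    by (subst of_int_mod_ring_cong[symmetric]) (simp add: of_int_to_int_mod_ring)
  then obtain k where "?k - (- 1) = int CARD('a) * k" by (rule dvdE)
  then have k: "?k = int CARD('a) * k - 1" by simp
  have "- dc x = abs_d (dcl CARD('a) (of_int ?k * x))"
    unfolding uminus_dst_def by (simp add: rep_dc x Dist_smult)
  also have "\<dots> = dc (of_int ?k * x)" by (simp add: dc_def)
  also have "\<dots> = dc (- x)"
  proof -
    have "of_int k * (of_nat CARD('a) * x) = of_nat CARD('a) * (of_int k * x)" by (metis mult.assoc mult_of_nat_commute)
    then show ?thesis
      unfolding dc_eq_iff[OF kost_mult[OF kost_of_int x] kost_uminus[OF x]]
      using kost_mult[OF kost_of_int x, of k]
      by (intro bexI[of _ "of_int k * x"]) (simp_all add: k algebra_simps)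
  qed
  finally show ?thesis .
qed

instance
proof
  fix x y z :: "'a dst"
  obtain u v w where [simp]: "x = dc u" "y = dc v" "z = dc w" and [simp]: "u \<in> kost" "v \<in> kost" "w \<in> kost" by (metis dc_cases)
  note [simp] = dc_add dc_mult dc_0 dc_1 dc_uminus kost_0 kost_1 kost_add kost_mult kost_uminus minus_dst_def
  show "x + y + z = x + (y + z)" "x + y = y + x" "0 + x = x" "- x + x = 0" "x - y = x + - y"
    "x * y * z = x * (y * z)" "1 * x = x" "x * 1 = x" "(x + y) * z = x * z + y * z" "x * (y + z) = x * y + x * z"
    by (simp_all add: algebra_simps)
  have "symb (1 :: 'a dst) 0 0 0 = 1" "symb (0 :: 'a dst) 0 0 0 = 0"
    using symb_dc[OF kost_1, of 0 0 0 1, where 'p = 'a] symb_dc[OF kost_0, of 0 0 0 0, where 'p = 'a] by (simp_all add: v0_def)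
  then show "(0 :: 'a dst) \<noteq> 1" by (metis zero_neq_one)
qed

end

lemma symb_add: "symb (x + y :: 'p::prime_card dst) a c l = symb x a c l + symb y a c l"
proof -
  obtain u w where u: "u \<in> kost" "x = dc u" and w: "w \<in> kost" "y = dc w" by (metis dc_cases)
  obtain m n where m: "act u v0 a c l = of_int m" "act w v0 a c l = of_int n" using u w kost_iff by (metis Ints_cases)
  have "act (u + w) v0 a c l = of_int (m + n)" using m by simp
  from symb_dc[OF kost_add[OF u(1) w(1)] this, where 'p = 'p] symb_dc[OF u(1) m(1), where 'p = 'p] symb_dc[OF w(1) m(2), where 'p = 'p]
  show ?thesis by (simp add: u w dc_add)
qed

lemma symb_0: "symb (0 :: 'p::prime_card dst) a c l = 0"
  using symb_add[of "0 :: 'p dst" 0 a c l] by (metis add_0 add_cancel_right_right)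

lemma symb_uminus: "symb (- x :: 'p::prime_card dst) a c l = - symb x a c l"
  using symb_add[of x "- x" a c l] by (simp add: symb_0 eq_neg_iff_add_eq_0 add.commute)

lemma symb_diff: "symb (x - y :: 'p::prime_card dst) a c l = symb x a c l - symb y a c l"
  using symb_add[of x "- y" a c l] symb_uminus[of y] by simp

lemma symb_sum: "symb (\<Sum>i\<in>A. f i :: 'p::prime_card dst) a c l = (\<Sum>i\<in>A. symb (f i) a c l)"
  by (induction A rule: infinite_finite_induct) (auto simp: symb_0 symb_add)

lemma symb_1: "symb (1 :: 'p::prime_card dst) = v0"
  using symb_dc'[OF kost_1, where 'p = 'p] by (auto simp: fun_eq_iff dc_1 v0_def)

definition gE :: "nat \<Rightarrow> 'p::prime_card dst" where "gE n = dc (dE n)"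
definition gF :: "nat \<Rightarrow> 'p::prime_card dst" where "gF n = dc (dF n)"
definition gH :: "nat \<Rightarrow> 'p::prime_card dst" where "gH n = dc (ev (binpoly n))"

lemma symb_gE: "symb (gE r * x :: 'p::prime_card dst) a c l = of_nat (a choose r) * (if r \<le> a then symb x (a - r) c l else 0)"
proof -
  obtain u where u: "u \<in> kost" "x = dc u" by (metis dc_cases)
  obtain n where n: "\<And>a c l. act u v0 a c l = of_int (n a c l)" using kost_symbol[OF u(1)] by blast
  have "act (dE r * u) v0 a c l = of_int (int (a choose r) * (if r \<le> a then n (a - r) c l else 0))"
    by (simp add: act_dE n)
  from symb_dc[OF kost_mult[OF kost_dE u(1)] this, where 'p = 'p] symb_dc[OF u(1) n, where 'p = 'p]
  show ?thesis by (simp add: gE_def u dc_mult kost_dE)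
qed

lemma symb_gH: "symb (gH r * x :: 'p::prime_card dst) a c l = of_int (ibin (l + 2 * int a - 2 * int c) r) * symb x a c l"
proof -
  obtain u where u: "u \<in> kost" "x = dc u" by (metis dc_cases)
  obtain n where n: "\<And>a c l. act u v0 a c l = of_int (n a c l)" using kost_symbol[OF u(1)] by blast
  have "act (ev (binpoly r) * u) v0 a c l = of_int (ibin (l + 2 * int a - 2 * int c) r * n a c l)"
    by (simp add: act_ev n poly_binpoly of_int_ibin)
  from symb_dc[OF kost_mult[OF kost_binpoly u(1)] this, where 'p = 'p] symb_dc[OF u(1) n, where 'p = 'p]
  show ?thesis by (simp add: gH_def u dc_mult kost_binpoly)
qed

lemma symb_gF: "symb (gF r * x :: 'p::prime_card dst) a c l =
   (\<Sum>k\<le>r. if r \<le> c + k then of_int (ibin (2 * int (c + k - r) + int r - int (a + k) - l) k) *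
      of_nat (c choose (c + k - r)) * symb x (a + k) (c + k - r) l else 0)"
proof -
  obtain u where u: "u \<in> kost" "x = dc u" by (metis dc_cases)
  obtain n where n: "\<And>a c l. act u v0 a c l = of_int (n a c l)" using kost_symbol[OF u(1)] by blast
  have "act (dF r * u) v0 a c l = of_int (\<Sum>k\<le>r. if r \<le> c + k then ibin (2 * int (c + k - r) + int r - int (a + k) - l) k *
      int (c choose (c + k - r)) * n (a + k) (c + k - r) l else 0)"
    unfolding act_simps act_dF_int n by (simp add: of_int_sum if_distrib cong: if_cong)
  from symb_dc[OF kost_mult[OF kost_dF u(1)] this, where 'p = 'p] symb_dc[OF u(1) n, where 'p = 'p]
  show ?thesis by (simp add: gF_def u dc_mult kost_dF of_int_sum if_distrib cong: if_cong)
qed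

lemma dst_induct [case_names one E F uminus add mult]:
  assumes "P 1" "\<And>n. P (gE n)" "\<And>n. P (gF n)" "\<And>x. P x \<Longrightarrow> P (- x)"
    "\<And>x y. P x \<Longrightarrow> P y \<Longrightarrow> P (x + y)" "\<And>x y. P x \<Longrightarrow> P y \<Longrightarrow> P (x * y)"
  shows "P (x :: 'p::prime_card dst)"
proof -
  have "P (dc u)" if "u \<in> kost" for u
    using that
  proof (induction u rule: kost_induct)
    case one then show ?case using assms(1) by (simp add: dc_1)
  next
    case (uminus x) then show ?case using assms(4) by (simp flip: dc_uminus)
  next
    case (add x y) then show ?case using assms(5) by (simp flip: dc_add)
  next
    case (mult x y) then show ?case using assms(6) by (simp flip: dc_mult)
  qed (use assms(2,3) in \<open>auto simp: gE_def gF_def\<close>)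
  then show ?thesis by (metis dc_cases)
qed

lemma dist_gens: "dist_E CARD('p) n = rep_d (gE n :: 'p::prime_card dst)" "dist_F CARD('p) n = rep_d (gF n :: 'p dst)"
  "dist_H CARD('p) n = rep_d (gH n :: 'p dst)"
  by (simp_all add: dist_E_def dist_F_def dist_H_def rep_dE rep_dF rep_binomial gE_def gF_def gH_def rep_dc
      kost_dE kost_dF kost_binpoly dcl_def)

lemma rep_d_simps:
  fixes x y :: "'p::prime_card dst"
  shows "rep_d (x + y) = rep_d x \<oplus>\<^bsub>dist_alg TYPE('p)\<^esub> rep_d y" "rep_d (x * y) = rep_d x \<otimes>\<^bsub>dist_alg TYPE('p)\<^esub> rep_d y"
    "rep_d (0 :: 'p dst) = \<zero>\<^bsub>dist_alg TYPE('p)\<^esub>" "rep_d (1 :: 'p dst) = \<one>\<^bsub>dist_alg TYPE('p)\<^esub>"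
    "c \<odot>\<^bsub>dist_alg TYPE('p)\<^esub> rep_d x = rep_d (of_int (to_int_mod_ring c) * x)"
proof -
  obtain u w where u: "u \<in> kost" "x = dc u" and w: "w \<in> kost" "y = dc w" by (metis dc_cases)
  show "rep_d (x + y) = rep_d x \<oplus>\<^bsub>dist_alg TYPE('p)\<^esub> rep_d y" "rep_d (x * y) = rep_d x \<otimes>\<^bsub>dist_alg TYPE('p)\<^esub> rep_d y"
    using u w by (simp_all add: dc_add dc_mult rep_dc kost_add kost_mult Dist_add Dist_mult)
  show "rep_d (0 :: 'p dst) = \<zero>\<^bsub>dist_alg TYPE('p)\<^esub>" "rep_d (1 :: 'p dst) = \<one>\<^bsub>dist_alg TYPE('p)\<^esub>"
    by (simp_all add: dc_0 dc_1 rep_dc kost_0 kost_1 Dist_sel)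
  have nat: "of_nat n = (dc (of_nat n) :: 'p dst)" for n
    by (induction n) (simp_all add: dc_0 dc_1 dc_add kost_of_nat kost_1)
  have "of_int k = (dc (of_int k) :: 'p dst)" for k
    by (cases k rule: int_diff_cases) (simp add: nat diff_conv_add_uminus dc_uminus dc_add kost_of_nat kost_uminus del: add_uminus_conv_diff)
  then show "c \<odot>\<^bsub>dist_alg TYPE('p)\<^esub> rep_d x = rep_d (of_int (to_int_mod_ring c) * x)"
    using u by (simp add: rep_dc Dist_smult dc_mult kost_of_int kost_mult)
qed


section \<open>Finite differences\<close>

definition fd :: "(int \<Rightarrow> 'a::ab_group_add) \<Rightarrow> int \<Rightarrow> 'a" where "fd f l = f (l + 1) - f l"

text \<open>Degree less than n, expressed by differences so that it makes sense for values in the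
  prime field, where binomial functions of degree p or more are not polynomial functions.
  \<open>lowdeg 0\<close> means zero.\<close>

definition lowdeg :: "nat \<Rightarrow> (int \<Rightarrow> 'a::ab_group_add) \<Rightarrow> bool" where
  "lowdeg n f \<longleftrightarrow> (\<forall>l. (fd ^^ n) f l = 0)"

lemma lowdeg_0: "lowdeg 0 f \<longleftrightarrow> (\<forall>l. f l = 0)" by (simp add: lowdeg_def)

lemma lowdeg_Suc: "lowdeg (Suc n) f \<longleftrightarrow> lowdeg n (fd f)"
  by (simp add: lowdeg_def funpow_swap1)

lemma fd_const [simp]: "fd (\<lambda>l. c) = (\<lambda>l. 0)" by (simp add: fun_eq_iff fd_def)

lemma lowdeg_zero [simp]: "lowdeg n (\<lambda>l. 0)"
  by (induction n) (simp_all add: lowdeg_0 lowdeg_Suc fd_def[abs_def])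

lemma lowdeg_Suc_mono: "lowdeg n f \<Longrightarrow> lowdeg (Suc n) f"
proof (induction n arbitrary: f)
  case 0
  then have "fd f = (\<lambda>l. 0)" by (simp add: fun_eq_iff lowdeg_0 fd_def)
  then show ?case by (simp add: lowdeg_Suc)
next
  case (Suc n) then show ?case by (simp add: lowdeg_Suc)
qed

lemma lowdeg_mono: "lowdeg n f \<Longrightarrow> n \<le> m \<Longrightarrow> lowdeg m f"
  by (induction m) (auto simp: le_Suc_eq intro: lowdeg_Suc_mono)

lemma lowdeg_add: "lowdeg n f \<Longrightarrow> lowdeg n g \<Longrightarrow> lowdeg n (\<lambda>l. f l + g l)"
proof (induction n arbitrary: f g)
  case (Suc n)
  have "fd (\<lambda>l. f l + g l) = (\<lambda>l. fd f l + fd g l)" by (simp add: fun_eq_iff fd_def)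
  then show ?case using Suc by (simp add: lowdeg_Suc)
qed (simp add: lowdeg_0)

lemma lowdeg_uminus: "lowdeg n f \<Longrightarrow> lowdeg n (\<lambda>l. - f l)"
proof (induction n arbitrary: f)
  case (Suc n)
  have "fd (\<lambda>l. - f l) = (\<lambda>l. - fd f l)" by (simp add: fun_eq_iff fd_def)
  then show ?case using Suc by (simp add: lowdeg_Suc)
qed (simp add: lowdeg_0)

lemma lowdeg_diff: "lowdeg n f \<Longrightarrow> lowdeg n g \<Longrightarrow> lowdeg n (\<lambda>l. f l - g l)"
  using lowdeg_add[OF _ lowdeg_uminus, of n f g] by simp

lemma lowdeg_sum: "(\<And>i. i \<in> A \<Longrightarrow> lowdeg n (f i)) \<Longrightarrow> lowdeg n (\<lambda>l. \<Sum>i\<in>A. f i l)"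
  by (induction A rule: infinite_finite_induct) (auto intro: lowdeg_add)

lemma lowdeg_cmult: "lowdeg n f \<Longrightarrow> lowdeg n (\<lambda>l. c * f l)" for c :: "'a::ring"
proof (induction n arbitrary: f)
  case (Suc n)
  have "fd (\<lambda>l. c * f l) = (\<lambda>l. c * fd f l)" by (simp add: fun_eq_iff fd_def right_diff_distrib)
  then show ?case using Suc by (simp add: lowdeg_Suc)
qed (simp add: lowdeg_0)

lemma lowdeg_shift: "lowdeg n f \<Longrightarrow> lowdeg n (\<lambda>l. f (l + k))"
proof (induction n arbitrary: f)
  case (Suc n)
  have "fd (\<lambda>l. f (l + k)) = (\<lambda>l. fd f (l + k))" by (simp add: fun_eq_iff fd_def algebra_simps)
  then show ?case using Suc by (simp add: lowdeg_Suc)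
qed (simp add: lowdeg_0)

lemma lowdeg_reflect: "lowdeg n f \<Longrightarrow> lowdeg n (\<lambda>l. f (k - l))"
proof (induction n arbitrary: f k)
  case (Suc n)
  have "fd (\<lambda>l. f (k - l)) = (\<lambda>l. - fd f ((k - 1) - l))" by (simp add: fun_eq_iff fd_def algebra_simps)
  then show ?case using Suc by (simp add: lowdeg_Suc lowdeg_uminus)
qed (simp add: lowdeg_0)

text \<open>Leibniz rule: the difference of f g is \<open>fd f l * g (l + 1) + fd g l * f l\<close>.
  Each summand has one difference less to go, and the induction hypothesis is used for the second
  one with the roles of the factors exchanged.\<close>

lemma lowdeg_mult:
  fixes f g :: "int \<Rightarrow> 'a::comm_ring"
  shows "lowdeg i f \<Longrightarrow> lowdeg (Suc j) g \<Longrightarrow> lowdeg (i + j) (\<lambda>l. f l * g l)"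
proof (induction "i + j" arbitrary: i j f g rule: less_induct)
  case less
  show ?case
  proof (cases i)
    case 0 then show ?thesis using less.prems by (simp add: lowdeg_0)
  next
    case (Suc i')
    have e: "fd (\<lambda>l. f l * g l) = (\<lambda>l. fd f l * g (l + 1) + fd g l * f l)"
      by (simp add: fun_eq_iff fd_def algebra_simps)
    have 1: "lowdeg (i' + j) (\<lambda>l. fd f l * g (l + 1))"
      using less.prems Suc by (intro less.hyps lowdeg_shift) (simp_all add: lowdeg_Suc)
    have 2: "lowdeg (i' + j) (\<lambda>l. fd g l * f l)"
    proof (cases j)
      case 0
      then show ?thesis using less.prems by (simp add: lowdeg_Suc lowdeg_0)
    next
      case (Suc j')
      then have "lowdeg (j + i') (\<lambda>l. fd g l * f l)"
        using less.prems \<open>i = Suc i'\<close> by (intro less.hyps) (simp_all add: lowdeg_Suc)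
      then show ?thesis by (simp add: add.commute)
    qed
    show ?thesis unfolding Suc using lowdeg_add[OF 1 2] by (simp add: lowdeg_Suc e)
  qed
qed

lemma lowdeg_shift_diff: "lowdeg (Suc n) f \<Longrightarrow> lowdeg n (\<lambda>l. f (l + k) - f l)"
proof (induction k rule: int_induct[where k = 0])
  case base show ?case by simp
next
  case (step1 i)
  have "(\<lambda>l. f (l + (i + 1)) - f l) = (\<lambda>l. fd f (l + i) + (f (l + i) - f l))"
    by (simp add: fun_eq_iff fd_def algebra_simps)
  then show ?case using step1 by (simp add: lowdeg_Suc lowdeg_add lowdeg_shift)
next
  case (step2 i)
  have "(\<lambda>l. f (l + (i - 1)) - f l) = (\<lambda>l. (f (l + i) - f l) - fd f (l + (i - 1)))"
    by (simp add: fun_eq_iff fd_def algebra_simps)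
  then show ?case using step2 by (simp add: lowdeg_Suc lowdeg_diff lowdeg_shift)
qed

lemma fd_zero_const: "(\<And>l. fd f l = 0) \<Longrightarrow> f l = f 0"
  by (induction l rule: int_induct[where k = 0]) (auto simp: fd_def, metis diff_add_cancel right_minus_eq)

section \<open>Binomial functions of the weight\<close>

definition bin :: "nat \<Rightarrow> int \<Rightarrow> 'a::comm_ring_1" where "bin k l = of_int (ibin l k)"

lemma bin_0 [simp]: "bin 0 l = 1" "bin (Suc k) 0 = 0" by (simp_all add: bin_def)

lemma bin_at_0: "bin k 0 = (if k = 0 then 1 else 0)" by (cases k) auto

lemma fd_bin: "fd (bin (Suc k)) = bin k" "fd (bin 0) = (\<lambda>l. 0)"
  by (simp_all add: fun_eq_iff fd_def bin_def ibin_Suc_Suc)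

lemma bin_Suc_Suc: "bin (Suc k) (l + 1) = bin k l + bin (Suc k) l"
  by (simp add: bin_def ibin_Suc_Suc)

lemma bin_of_nat: "bin k (int n) = of_nat (n choose k)"
  by (simp add: bin_def ibin_of_nat)

lemma bin_1: "bin 1 l = of_int l"
  by (simp add: bin_def ibin_def)

lemma lowdeg_bin: "lowdeg (Suc k) (bin k)"
  by (induction k) (simp_all add: lowdeg_Suc fd_bin lowdeg_0)

text \<open>Expand the difference of f first and raise every index by one; what is left has
  difference zero and is therefore constant.\<close>

lemma newton_expand:
  fixes f :: "int \<Rightarrow> 'a::comm_ring_1"
  shows "lowdeg n f \<Longrightarrow> \<exists>c. \<forall>l. f l = (\<Sum>b<n. c b * bin b l)"
proof (induction n arbitrary: f)
  case (Suc n)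
  then obtain c where c: "\<And>l. fd f l = (\<Sum>b<n. c b * bin b l)" by (auto simp: lowdeg_Suc)
  define g where "g l = f l - (\<Sum>b<n. c b * bin (Suc b) l)" for l
  have "fd g l = 0" for l
  proof -
    have "fd g l = fd f l - (\<Sum>b<n. c b * fd (bin (Suc b)) l)"
      by (simp add: fd_def g_def right_diff_distrib sum_subtractf)
    then show ?thesis by (simp add: fd_bin c)
  qed
  then have "g l = g 0" for l by (rule fd_zero_const)
  then have "f l = g 0 * bin 0 l + (\<Sum>b<n. c b * bin (Suc b) l)" for l
    by (metis bin_0(1) diff_add_cancel g_def mult.right_neutral)
  then have "f l = (\<Sum>b<Suc n. (case b of 0 \<Rightarrow> g 0 | Suc b' \<Rightarrow> c b') * bin b l)" for l
    by (simp add: sum.lessThan_Suc_shift del: sum.lessThan_Suc)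
  then show ?case by blast
qed (simp add: lowdeg_0)

text \<open>The difference of the product consists of two products with one index lowered and one
  with both lowered. Pascal's rule adds up the two leading coefficients, and the third product has
  lower degree.\<close>

lemma bin_mult:
  "lowdeg (i + j) (\<lambda>l. bin i l * bin j l - of_nat ((i + j) choose i) * bin (i + j) l :: 'a::comm_ring_1)"
proof (induction "i + j" arbitrary: i j rule: less_induct)
  case less
  show ?case
  proof (cases "i = 0 \<or> j = 0")
    case True then show ?thesis by auto
  next
    case False
    then obtain i' j' where i: "i = Suc i'" and j: "j = Suc j'" by (metis not0_implies_Suc)
    have e: "fd (\<lambda>l. bin i l * bin j l - of_nat ((i + j) choose i) * bin (i + j) l :: 'a) =
      (\<lambda>l. (bin i' l * bin j l - of_nat ((i' + j) choose i') * bin (i' + j) l) +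
           (bin i l * bin j' l - of_nat ((i + j') choose i) * bin (i + j') l) + bin i' l * bin j' l)"
      by (simp add: fun_eq_iff fd_def i j bin_Suc_Suc algebra_simps)
    have "lowdeg (Suc i' + j') (\<lambda>l. bin i' l * bin j' l :: 'a)"
      by (intro lowdeg_mult lowdeg_bin)
    then have "lowdeg (i' + j) (\<lambda>l. bin i' l * bin j' l :: 'a)" by (simp add: j)
    moreover have "lowdeg (i' + j) (\<lambda>l. bin i' l * bin j l - of_nat ((i' + j) choose i') * bin (i' + j) l :: 'a)"
      by (rule less) (simp add: i)
    moreover have "lowdeg (i + j') (\<lambda>l. bin i l * bin j' l - of_nat ((i + j') choose i) * bin (i + j') l :: 'a)"
      by (rule less) (simp add: j)
    then have "lowdeg (i' + j) (\<lambda>l. bin i l * bin j' l - of_nat ((i + j') choose i) * bin (i + j') l :: 'a)"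
      by (rule lowdeg_mono) (simp add: i j)
    ultimately have "lowdeg (i' + j) (fd (\<lambda>l. bin i l * bin j l - of_nat ((i + j) choose i) * bin (i + j) l :: 'a))"
      unfolding e by (intro lowdeg_add) assumption+
    then have "lowdeg (Suc (i' + j)) (\<lambda>l. bin i l * bin j l - of_nat ((i + j) choose i) * bin (i + j) l :: 'a)"
      unfolding lowdeg_Suc .
    then show ?thesis by (simp add: i)
  qed
qed

lemma forward_newton:
  fixes f :: "int \<Rightarrow> 'a::comm_ring_1"
  shows "f (l + int n) = (\<Sum>k\<le>n. of_nat (n choose k) * (fd ^^ k) f l)"
proof (induction n arbitrary: l)
  case (Suc n)
  have s: "(fd ^^ k) f (l + 1) = (fd ^^ k) f l + (fd ^^ Suc k) f l" for k by (simp add: fd_def)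
  have "f (l + int (Suc n)) = f ((l + 1) + int n)" by (simp add: algebra_simps)
  also have "\<dots> = (\<Sum>k\<le>n. of_nat (n choose k) * (fd ^^ k) f l) + (\<Sum>k\<le>n. of_nat (n choose k) * (fd ^^ Suc k) f l)"
    unfolding Suc.IH s by (simp only: distrib_left sum.distrib)
  also have "(\<Sum>k\<le>n. of_nat (n choose k) * (fd ^^ k) f l) = (\<Sum>k\<le>Suc n. of_nat (n choose k) * (fd ^^ k) f l)"
    by (simp add: binomial_eq_0)
  also have "\<dots> = f l + (\<Sum>k\<le>n. of_nat (n choose Suc k) * (fd ^^ Suc k) f l)"
    by (simp only: sum.atMost_Suc_shift) simp
  finally show ?case
    by (simp only: sum.atMost_Suc_shift binomial_Suc_Suc of_nat_add distrib_right sum.distrib) (simp add: add_ac)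
qed simp

section \<open>Differences and binomial functions in characteristic p\<close>

lemma CARD_prime: "prime CARD('p::prime_card)" by (rule prime_card)

lemma of_nat_mod_ring_0: "(of_nat n :: 'p::prime_card mod_ring) = 0 \<longleftrightarrow> CARD('p) dvd n"
  using of_nat_eq_0_iff_char_dvd[of n, where 'a = "'p mod_ring"] by simp

text \<open>For the shift T this is (T - 1)^p = T^p - 1, the inner binomial coefficients being
  divisible by p.\<close>

lemma fd_frobenius:
  fixes f :: "int \<Rightarrow> 'p::prime_card mod_ring"
  shows "(fd ^^ CARD('p)) f l = f (l + int CARD('p)) - f l"
proof -
  let ?p = "CARD('p)"
  have p: "?p > 0" using CARD_prime[where 'p = 'p] by (simp add: prime_gt_0_nat)
  have "(\<Sum>k\<le>?p. of_nat (?p choose k) * (fd ^^ k) f l) = (\<Sum>k\<in>{0, ?p}. of_nat (?p choose k) * (fd ^^ k) f l)"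
  proof (rule sum.mono_neutral_right)
    show "\<forall>k\<in>{..?p} - {0, ?p}. of_nat (?p choose k) * (fd ^^ k) f l = 0"
      by (auto simp: of_nat_mod_ring_0 intro!: dvd_choose_prime[OF _ _ _ CARD_prime])
  qed auto
  then show ?thesis using p forward_newton[of f l ?p] by simp
qed

lemma funpow_mult_Suc: "(g ^^ (q * Suc m)) f = (g ^^ (q * m)) ((g ^^ q) f)"
proof -
  have "q * Suc m = q * m + q" by simp
  then show ?thesis by (simp only: funpow_add comp_apply)
qed

text \<open>By \<open>fd_frobenius\<close>, one difference of f(pl) in l amounts to p differences of
  f.\<close>

lemma fd_scale:
  fixes f :: "int \<Rightarrow> 'p::prime_card mod_ring"
  shows "(fd ^^ m) (\<lambda>l. f (int CARD('p) * l)) l = (fd ^^ (CARD('p) * m)) f (int CARD('p) * l)"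
proof (induction m arbitrary: f l)
  case (Suc m)
  have "fd (\<lambda>l. f (int CARD('p) * l)) = (\<lambda>l. (fd ^^ CARD('p)) f (int CARD('p) * l))"
    by (simp add: fun_eq_iff fd_frobenius fd_def algebra_simps)
  then have "(fd ^^ Suc m) (\<lambda>l. f (int CARD('p) * l)) l = (fd ^^ m) (\<lambda>l. (fd ^^ CARD('p)) f (int CARD('p) * l)) l"
    by (simp add: funpow_swap1)
  also have "\<dots> = (fd ^^ (CARD('p) * m)) ((fd ^^ CARD('p)) f) (int CARD('p) * l)" by (rule Suc.IH)
  also have "\<dots> = (fd ^^ (CARD('p) * Suc m)) f (int CARD('p) * l)"
    by (simp only: funpow_mult_Suc)
  finally show ?case .
qed simp

lemma lowdeg_scale:
  fixes f :: "int \<Rightarrow> 'p::prime_card mod_ring"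
  assumes "lowdeg n f" "n \<le> CARD('p) * m"
  shows "lowdeg m (\<lambda>l. f (int CARD('p) * l))"
  using lowdeg_mono[OF assms] by (simp add: lowdeg_def fd_scale)

definition spread :: "(int \<Rightarrow> 'p::prime_card mod_ring) \<Rightarrow> int \<Rightarrow> 'p mod_ring" where
  "spread f l = (if int CARD('p) dvd l then f (l div int CARD('p)) else 0)"

lemma fd_spread: "(fd ^^ CARD('p)) (spread f) = spread (fd f)" for f :: "int \<Rightarrow> 'p::prime_card mod_ring"
proof (intro ext)
  fix l
  have p: "int CARD('p) \<noteq> 0" by simp
  show "(fd ^^ CARD('p)) (spread f) l = spread (fd f) l"
    unfolding fd_frobenius spread_def fd_def using p by (auto simp: div_add_self2)
qed

lemma fd_spread_pow: "(fd ^^ (CARD('p) * m)) (spread f) = spread ((fd ^^ m) f)" for f :: "int \<Rightarrow> 'p::prime_card mod_ring"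
proof (induction m arbitrary: f)
  case (Suc m)
  have "(fd ^^ (CARD('p) * Suc m)) (spread f) = (fd ^^ (CARD('p) * m)) ((fd ^^ CARD('p)) (spread f))"
    by (rule funpow_mult_Suc)
  then show ?case by (simp add: fd_spread Suc funpow_swap1)
qed simp

lemma lowdeg_spread: "lowdeg n f \<Longrightarrow> lowdeg (CARD('p) * n) (spread f)" for f :: "int \<Rightarrow> 'p::prime_card mod_ring"
  by (simp add: lowdeg_def fd_spread_pow) (simp add: spread_def)

lemma fd_pow_bin: "(fd ^^ j) (bin k) = (if j \<le> k then bin (k - j) else (\<lambda>l. 0))"
proof (induction j arbitrary: k)
  case (Suc j)
  note IH = Suc.IH
  have z: "(fd ^^ j) (\<lambda>l. 0 :: 'a) = (\<lambda>l. 0)" by (induction j) auto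
  have e: "(fd ^^ Suc j) (bin k :: int \<Rightarrow> 'a) = (fd ^^ j) (fd (bin k))" by (simp only: funpow_Suc_right comp_apply)
  show ?case
  proof (cases k)
    case 0
    show ?thesis unfolding e unfolding 0 fd_bin z by simp
  next
    case (Suc k')
    show ?thesis unfolding e unfolding Suc fd_bin IH by simp
  qed
qed simp

lemma bin_add_p: "bin k (l + int CARD('p)) = (bin k l + (if CARD('p) \<le> k then bin (k - CARD('p)) l else 0) :: 'p::prime_card mod_ring)"
  using fd_frobenius[of "bin k :: int \<Rightarrow> 'p mod_ring" l] by (auto simp: fd_pow_bin diff_eq_eq)

text \<open>One half of Lucas' congruence. Both sides have the same difference in z, since raising z
  by one shifts the argument by p and \<open>bin_add_p\<close> then lowers k by p; and they agree at
  0.\<close>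

lemma bin_p_mult:
  "(bin k (int CARD('p) * z) :: 'p::prime_card mod_ring) = (if CARD('p) dvd k then bin (k div CARD('p)) z else 0)"
proof (induction k arbitrary: z rule: less_induct)
  case (less k)
  let ?p = "CARD('p)"
  have p: "?p > 0" by simp
  define g where "g z = bin k (int ?p * z) - (if ?p dvd k then bin (k div ?p) z else 0 :: 'p mod_ring)" for z
  have "fd g z = 0" for z
  proof -
    have "bin k (int ?p * (z + 1)) - bin k (int ?p * z) = (if ?p \<le> k then bin (k - ?p) (int ?p * z) else 0 :: 'p mod_ring)"
      using bin_add_p[of k "int ?p * z", where 'p = 'p] by (simp add: algebra_simps)
    moreover have "(if ?p \<le> k then bin (k - ?p) (int ?p * z) else 0 :: 'p mod_ring) =
       (if ?p dvd k then bin (k div ?p) (z + 1) - bin (k div ?p) z else 0)"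
    proof (cases "?p \<le> k")
      case True
      then obtain j where k: "k = ?p + j" using le_Suc_ex by blast
      show ?thesis using less[of j z] True p by (auto simp: k bin_Suc_Suc)
    next
      case False
      then show ?thesis by (auto dest: dvd_imp_le)
    qed
    moreover have "fd g z = (bin k (int ?p * (z + 1)) - bin k (int ?p * z)) -
        (if ?p dvd k then bin (k div ?p) (z + 1) - bin (k div ?p) z else 0)"
      by (simp add: fd_def g_def)
    ultimately show ?thesis by simp
  qed
  then have "g z = g 0" by (rule fd_zero_const)
  also have "g 0 = 0" using p by (auto simp: g_def bin_at_0 elim!: dvdE)
  finally show ?case by (simp add: g_def)
qed

text \<open>The other half: for a lower index divisible by p the last digit of l does not matter.
  Again both sides have the same differences along each residue class.\<close>

lemma bin_mult_p:
  "(bin (CARD('p) * k) l :: 'p::prime_card mod_ring) = bin k (l div int CARD('p))"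
proof -
  let ?p = "CARD('p)"
  have p: "?p > 0" by simp
  have "(bin (?p * k) (int ?p * z + int r) :: 'p mod_ring) = bin k z" if r: "r < ?p" for z r
  proof (induction k arbitrary: z)
    case (Suc k)
    define g where "g z = bin (?p * Suc k) (int ?p * z + int r) - (bin (Suc k) z :: 'p mod_ring)" for z
    have "fd g z = 0" for z
    proof -
      have "fd g z = (bin (?p * Suc k) ((int ?p * z + int r) + int ?p) - bin (?p * Suc k) (int ?p * z + int r)) -
          (bin (Suc k) (z + 1) - bin (Suc k) z)"
        by (simp add: fd_def g_def algebra_simps)
      then show ?thesis unfolding bin_add_p bin_Suc_Suc using Suc[of z] by simp
    qed
    then have "g z = g 0" by (rule fd_zero_const)
    also have "g 0 = 0" using r by (simp add: g_def bin_of_nat binomial_eq_0 del: mult_Suc_right)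
       (simp add: binomial_eq_0)
    finally show ?case by (simp add: g_def)
  qed simp
  from this[of "nat (l mod int ?p)" "l div int ?p"] p show ?thesis
    by (simp add: nat_less_iff)
qed

text \<open>The value is the m-th base p digit of l, also for negative l because division rounds
  down.\<close>

lemma bin_prime_power: "(bin (CARD('p) ^ m) l :: 'p::prime_card mod_ring) = of_int (l div int CARD('p) ^ m)"
proof (induction m arbitrary: l)
  case 0 show ?case using bin_1[of l, where 'a = "'p mod_ring"] by simp
next
  case (Suc m)
  show ?case by (simp add: bin_mult_p Suc zdiv_zmult2_eq)
qed

text \<open>The indices are below p, so the sum is p-periodic in l by \<open>bin_add_p\<close>; for
  0 <= l < p it is the alternating row sum (1 - 1)^l. This explains the coefficients of
  \<open>Delta_T\<close>.\<close>

lemma alternating_bin: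
  "(\<Sum>i<CARD('p). (- 1) ^ i * bin i l) = (if int CARD('p) dvd l then 1 else 0 :: 'p::prime_card mod_ring)"
proof -
  let ?p = "CARD('p)"
  define s where "s l = (\<Sum>i<?p. (- 1) ^ i * (bin i l :: 'p mod_ring))" for l
  have p: "?p > 0" by simp
  have per: "s (int ?p * z + l) = s l" for z l
  proof -
    have "fd (\<lambda>z. s (int ?p * z + l)) z = 0" for z
    proof -
      have "s (int ?p * (z + 1) + l) = (\<Sum>i<?p. (- 1) ^ i * bin i ((int ?p * z + l) + int ?p))"
        unfolding s_def by (simp add: algebra_simps)
      also have "\<dots> = s (int ?p * z + l)" unfolding s_def bin_add_p by (intro sum.cong) auto
      finally show ?thesis by (simp add: fd_def)
    qed
    from fd_zero_const[OF this, of z] show ?thesis by simp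
  qed
  have "s (int r) = (if r = 0 then 1 else 0)" if "r < ?p" for r
  proof -
    have "s (int r) = (\<Sum>i\<le>r. (- 1) ^ i * of_nat (r choose i))"
      unfolding s_def bin_of_nat using that by (intro sum.mono_neutral_right) (auto simp: binomial_eq_0)
    then show ?thesis using choose_alternating_sum[of r, where 'a = "'p mod_ring"] by (cases r) auto
  qed
  moreover have nn: "0 \<le> l mod int ?p" "nat (l mod int ?p) < ?p" using p by (simp_all add: nat_less_iff)
  ultimately have "s (l mod int ?p) = (if nat (l mod int ?p) = 0 then 1 else 0)" by (metis int_nat_eq)
  then have "s (l mod int ?p) = (if l mod int ?p = 0 then 1 else 0)"
    using nn by (cases "l mod int ?p = 0") auto
  moreover have "s l = s (l mod int ?p)" using per[of "l div int ?p" "l mod int ?p"] by simp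
  ultimately show ?thesis by (simp add: s_def dvd_eq_mod_eq_0)
qed


section \<open>The order filtration\<close>

lemma symb_gF': "symb (gF r * x :: 'p::prime_card dst) a c l =
   (\<Sum>k\<le>r. if r \<le> c + k then bin k (2 * int (c + k - r) + int r - int (a + k) - l) *
      of_nat (c choose (c + k - r)) * symb x (a + k) (c + k - r) l else 0)"
  by (simp add: symb_gF bin_def cong: if_cong)

lemma symb_gH': "symb (gH r * x :: 'p::prime_card dst) a c l = bin r (l + 2 * int a - 2 * int c) * symb x a c l"
  by (simp add: symb_gH bin_def)

lemma symb_gF1: "symb (gF r :: 'p::prime_card dst) a c l = (if a = 0 \<and> c = r then 1 else 0)"
proof -
  have "symb (gF r * 1 :: 'p dst) a c l = (\<Sum>k\<le>r. if k = 0 then if a = 0 \<and> c = r then 1 else 0 else 0)"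
    unfolding symb_gF' by (intro sum.cong refl) (auto simp: symb_1 v0_def)
  then show ?thesis by (simp add: sum.delta)
qed

definition mon :: "nat \<Rightarrow> nat \<Rightarrow> nat \<Rightarrow> 'p::prime_card dst" where "mon a b c = gE a * gH b * gF c"

lemma symb_mon: "symb (mon a b c :: 'p::prime_card dst) a' c' l =
   (if a' = a \<and> c' = c then bin b (l - 2 * int c) else 0)"
  by (auto simp: mon_def mult.assoc symb_gE symb_gH' symb_gF1)

lemma symb_of_nat: "symb (of_nat n * x :: 'p::prime_card dst) a c l = of_nat n * symb x a c l"
  by (induction n) (simp_all add: symb_0 symb_add distrib_right)

lemma symb_of_int: "symb (of_int n * x :: 'p::prime_card dst) a c l = of_int n * symb x a c l"
  by (cases n rule: int_diff_cases) (simp add: symb_of_nat symb_diff left_diff_distrib)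

text \<open>Order strictly below n, so \<open>Dist_le n\<close> corresponds to
  \<open>dord (Suc n)\<close>. The subtraction is truncated: where a + c >= n the symbol has to
  vanish.\<close>

definition dord :: "nat \<Rightarrow> 'p::prime_card dst \<Rightarrow> bool" where
  "dord n x \<longleftrightarrow> (\<forall>a c. lowdeg (n - a - c) (symb x a c))"

lemma dord_mono: "dord n x \<Longrightarrow> n \<le> m \<Longrightarrow> dord m x"
  unfolding dord_def by (blast intro: lowdeg_mono diff_le_mono)

lemma dord_0: "dord n 0" by (simp add: dord_def lowdeg_def symb_0 fun_eq_iff) (metis lowdeg_def lowdeg_zero ext symb_0)

lemma dord_zero: "dord 0 x \<Longrightarrow> x = 0"
  using symb_inject[of x 0] by (simp add: dord_def lowdeg_0 fun_eq_iff symb_0)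

lemma dord_add: "dord n x \<Longrightarrow> dord n y \<Longrightarrow> dord n (x + y)"
  by (auto simp: dord_def symb_add[abs_def] intro: lowdeg_add)

lemma dord_uminus: "dord n x \<Longrightarrow> dord n (- x)"
  by (auto simp: dord_def symb_uminus[abs_def] intro: lowdeg_uminus)

lemma dord_sum: "(\<And>i. i \<in> A \<Longrightarrow> dord n (f i)) \<Longrightarrow> dord n (\<Sum>i\<in>A. f i)"
  by (induction A rule: infinite_finite_induct) (auto intro: dord_0 dord_add)

lemma dord_of_int: "dord n x \<Longrightarrow> dord n (of_int k * x)"
  by (auto simp: dord_def symb_of_int[abs_def] intro: lowdeg_cmult)

lemma dord_mon: "a + b + c < n \<Longrightarrow> dord n (mon a b c)"
  unfolding dord_def symb_mon[abs_def]
proof (intro allI)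
  fix a' c' assume n: "a + b + c < n"
  show "lowdeg (n - a' - c') (\<lambda>l. if a' = a \<and> c' = c then bin b (l - 2 * int c) else 0)"
  proof (cases "a' = a \<and> c' = c")
    case True
    then have "lowdeg (n - a' - c') (bin b)" using n by (intro lowdeg_mono[OF lowdeg_bin]) simp
    from lowdeg_shift[OF this, of "- (2 * int c)"] True show ?thesis by simp
  qed auto
qed

text \<open>Newton expansion in l - 2c, which is the weight of F^[c] 1_l and so the argument at
  which the H-part of a monomial is evaluated.\<close>

lemma symb_expand:
  fixes v :: "'p::prime_card mod_ring sym"
  assumes "\<And>a c. lowdeg (n - a - c) (v a c)"
  shows "\<exists>k. symb (\<Sum>a<n. \<Sum>c<n. \<Sum>b<n - a - c. of_int (k a b c) * mon a b c :: 'p dst) = v"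
proof -
  have "\<exists>k. \<forall>l. v a c l = (\<Sum>b<n - a - c. k b * bin b (l - 2 * int c))" for a c
    using newton_expand[OF lowdeg_shift[OF assms[of a c], of "2 * int c"]] by (auto intro: exI) (metis diff_add_cancel)
  then obtain k where k: "\<And>a c l. v a c l = (\<Sum>b<n - a - c. k a c b * bin b (l - 2 * int c))" by metis
  \<comment> \<open>The coefficients are lifted to integers, since scalars act on \<open>dst\<close>
    only through integers.\<close>
  let ?x = "\<Sum>a<n. \<Sum>c<n. \<Sum>b<n - a - c. of_int (to_int_mod_ring (k a c b)) * mon a b c :: 'p dst"
  have "symb ?x a c l = v a c l" for a c l
  proof -
    have "symb ?x a c l = (\<Sum>a'<n. \<Sum>c'<n. if c' = c then if a' = a then v a c l else 0 else 0)"
      unfolding symb_sum symb_of_int of_int_to_int_mod_ring symb_mon k[of a c l] by (intro sum.cong refl) auto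
    also have "\<dots> = (if a < n \<and> c < n then v a c l else 0)"
      by (cases "c < n") (simp_all add: sum.delta)
    also have "\<dots> = v a c l" using k[of a c l] by auto
    finally show ?thesis .
  qed
  then have "symb ?x = v" by (simp add: fun_eq_iff)
  then show ?thesis by (intro exI[of _ "\<lambda>a b c. to_int_mod_ring (k a c b)"])
qed

text \<open>Every symbol of finite order is the symbol of a distribution; this is how maps on
  distributions can be defined by prescribing symbols.\<close>

lemma symb_ex:
  fixes v :: "'p::prime_card mod_ring sym"
  shows "(\<And>a c. lowdeg (n - a - c) (v a c)) \<Longrightarrow> \<exists>x. symb x = v"
  using symb_expand[of n v] by blast

lemma dord_induct [consumes 1, case_names zero add mon]:
  assumes "dord n (x :: 'p::prime_card dst)" "P 0" "\<And>x y. dord n x \<Longrightarrow> dord n y \<Longrightarrow> P x \<Longrightarrow> P y \<Longrightarrow> P (x + y)"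
    and "\<And>a b c k. a + b + c < n \<Longrightarrow> P (of_int k * mon a b c)"
  shows "P x"
proof -
  obtain k where "symb (\<Sum>a<n. \<Sum>c<n. \<Sum>b<n - a - c. of_int (k a b c) * mon a b c) = symb x"
    using symb_expand[of n "symb x"] assms(1) by (auto simp: dord_def)
  then have x: "x = (\<Sum>a<n. \<Sum>c<n. \<Sum>b<n - a - c. of_int (k a b c) * mon a b c)"
    by (simp add: symb_inject)
  have sum: "dord n (sum f A) \<and> P (sum f A)" if "\<And>i. i \<in> A \<Longrightarrow> dord n (f i) \<and> P (f i)" for f and A :: "nat set"
    using that by (induction A rule: infinite_finite_induct) (auto intro: assms dord_0 dord_add)
  have "dord n x \<and> P x" unfolding x
    by (intro sum conjI assms(4) dord_of_int dord_mon) auto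
  then show ?thesis by simp
qed

lemma dord_gE_mult: "dord n x \<Longrightarrow> dord (n + r) (gE r * x)"
  unfolding dord_def
proof (intro allI)
  fix a c assume x: "\<forall>a c. lowdeg (n - a - c) (symb x a c)"
  show "lowdeg (n + r - a - c) (symb (gE r * x) a c)"
  proof (cases "r \<le> a")
    case True
    have "lowdeg (n - (a - r) - c) (symb x (a - r) c)" using x by blast
    then have "lowdeg (n + r - a - c) (symb x (a - r) c)" by (rule lowdeg_mono) (use True in auto)
    then show ?thesis using True by (simp add: symb_gE[abs_def] lowdeg_cmult)
  qed (simp add: symb_gE[abs_def])
qed

lemma dord_gH_mult: "dord n x \<Longrightarrow> dord (n + r) (gH r * x)"
  unfolding dord_def
proof (intro allI)
  fix a c assume x: "\<forall>a c. lowdeg (n - a - c) (symb x a c)"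
  have "lowdeg (Suc r) (\<lambda>l. bin r (l + (2 * int a - 2 * int c)) :: 'a mod_ring)"
    by (intro lowdeg_shift lowdeg_bin)
  then have "lowdeg (n - a - c + r) (\<lambda>l. symb x a c l * bin r (l + (2 * int a - 2 * int c)))"
    using x by (intro lowdeg_mult) auto
  then have *: "lowdeg (n - a - c + r) (symb (gH r * x) a c)"
    by (simp add: symb_gH'[abs_def] mult.commute algebra_simps)
  show "lowdeg (n + r - a - c) (symb (gH r * x) a c)"
  \<comment> \<open>If a + c > n the truncated bound in \<open>*\<close> is too weak, but then the
    symbol of x vanishes there.\<close>
  proof (cases "a + c \<le> n")
    case True then show ?thesis by (intro lowdeg_mono[OF *]) auto
  next
    case False
    then have "\<forall>l. symb x a c l = 0" using x[rule_format, of a c] by (simp add: lowdeg_0)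
    then show ?thesis by (simp add: symb_gH'[abs_def])
  qed
qed

text \<open>In the k-th term the symbol is read at (a + k, c + k - r), which lowers its degree bound
  by 2k - r relative to (a, c), while the binomial factor adds k. The balance is r - k, at most
  r.\<close>

lemma dord_gF_mult: "dord n x \<Longrightarrow> dord (n + r) (gF r * x)"
  unfolding dord_def
proof (intro allI)
  fix a c assume x: "\<forall>a c. lowdeg (n - a - c) (symb x a c)"
  have "lowdeg (n + r - a - c) (\<lambda>l. if r \<le> c + k then bin k (2 * int (c + k - r) + int r - int (a + k) - l) *
      of_nat (c choose (c + k - r)) * symb x (a + k) (c + k - r) l else 0)" if k: "k \<le> r" for k
  proof (cases "r \<le> c + k")
    case True
    let ?C = "c + k - r"
    show ?thesis
    proof (cases "a + k + ?C \<le> n")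
      case True': True
      have "lowdeg (Suc k) (\<lambda>l. bin k (2 * int ?C + int r - int (a + k) - l) :: 'a mod_ring)"
        by (intro lowdeg_reflect lowdeg_bin)
      then have "lowdeg (n - (a + k) - ?C + k) (\<lambda>l. (of_nat (c choose ?C) * symb x (a + k) ?C l) * bin k (2 * int ?C + int r - int (a + k) - l))"
        using x by (intro lowdeg_mult lowdeg_cmult) auto
      then have "lowdeg (n + r - a - c) (\<lambda>l. (of_nat (c choose ?C) * symb x (a + k) ?C l) * bin k (2 * int ?C + int r - int (a + k) - l))"
        by (rule lowdeg_mono) (use True True' k in auto)
      then show ?thesis using True by (simp add: mult_ac)
    next
      case False
      then have "\<forall>l. symb x (a + k) ?C l = 0" using x[rule_format, of "a + k" ?C] by (simp add: lowdeg_0)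
      then have "(\<lambda>l. if r \<le> c + k then bin k (2 * int (c + k - r) + int r - int (a + k) - l) *
          of_nat (c choose (c + k - r)) * symb x (a + k) (c + k - r) l else 0) = (\<lambda>l. 0)"
        by (simp add: fun_eq_iff)
      then show ?thesis by (simp only: lowdeg_zero)
    qed
  qed simp
  then show "lowdeg (n + r - a - c) (symb (gF r * x) a c)"
    unfolding symb_gF'[abs_def] by (intro lowdeg_sum) auto
qed

lemma dord_mon_mult: "dord n x \<Longrightarrow> dord (n + (a + b + c)) (mon a b c * x)"
proof -
  assume "dord n x"
  then have "dord (n + c + b + a) (gE a * (gH b * (gF c * x)))"
    by (intro dord_gE_mult dord_gH_mult dord_gF_mult)
  then show ?thesis by (simp add: mon_def mult.assoc add_ac)
qed

text \<open>The asymmetry comes from the strict convention of \<open>dord\<close>: order below i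
  times order at most j is order below i + j.\<close>

lemma dord_mult:
  assumes "dord i x" "dord (Suc j) y"
  shows "dord (i + j) (x * y)"
  using assms(1)
proof (induction x rule: dord_induct)
  case zero show ?case by (simp add: dord_0)
next
  case (add x y) then show ?case by (simp add: distrib_right dord_add)
next
  case (mon a b c k)
  have "dord (i + j) (mon a b c * y)"
    by (rule dord_mono[OF dord_mon_mult[OF assms(2)]]) (use mon in simp)
  then show ?case by (simp add: mult.assoc dord_of_int)
qed

lemma dord_mult':
  assumes "dord (Suc i) x" "dord j y"
  shows "dord (i + j) (x * y)"
proof (cases j)
  case 0 then show ?thesis using dord_zero[of y] assms(2) by (simp add: dord_0)
next
  case (Suc j') then show ?thesis using dord_mult[OF assms(1), of j' y] assms(2) by simp
qed

lemma dord_1: "dord (Suc 0) 1"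
  unfolding dord_def symb_1 v0_def
proof (intro allI)
  show "lowdeg (Suc 0 - a - c) (\<lambda>l. if a = 0 \<and> c = 0 then 1 else 0 :: 'a mod_ring)" for a c
    by (cases "a = 0 \<and> c = 0") (auto simp: lowdeg_Suc)
qed

lemma dord_gE: "dord (Suc r) (gE r)" using dord_gE_mult[OF dord_1, of r] by simp
lemma dord_gH: "dord (Suc r) (gH r)" using dord_gH_mult[OF dord_1, of r] by simp
lemma dord_gF: "dord (Suc r) (gF r)" using dord_gF_mult[OF dord_1, of r] by simp

lemma dord_ex: "\<exists>n. dord n (x :: 'p::prime_card dst)"
proof (induction x rule: dst_induct)
  case (add x y)
  then obtain n m where "dord n x" "dord m y" by blast
  then have "dord (max n m) (x + y)" by (intro dord_add) (auto elim: dord_mono)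
  then show ?case by blast
next
  case (mult x y)
  then obtain n m where "dord n x" "dord m y" by blast
  then have "dord (n + m) (x * y)" by (intro dord_mult) (auto elim: dord_mono)
  then show ?case by blast
qed (auto intro: dord_1 dord_gE dord_gF dord_uminus)

lemma gE_0 [simp]: "gE 0 = (1 :: 'p::prime_card dst)" and gH_0 [simp]: "gH 0 = (1 :: 'p dst)" and gF_0 [simp]: "gF 0 = (1 :: 'p dst)"
proof -
  have "symb (gE 0) = symb (1 :: 'p dst)" "symb (gH 0) = symb (1 :: 'p dst)" "symb (gF 0) = symb (1 :: 'p dst)"
    using symb_gE[of 0 "1 :: 'p dst"] symb_gH'[of 0 "1 :: 'p dst"]
    by (auto simp: fun_eq_iff symb_gF1 symb_1 v0_def)
  then show "gE 0 = (1 :: 'p dst)" "gH 0 = (1 :: 'p dst)" "gF 0 = (1 :: 'p dst)" by (simp_all add: symb_inject)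
qed

section \<open>Commutators lower the order\<close>

definition com :: "'a::ring \<Rightarrow> 'a \<Rightarrow> 'a" where "com x y = x * y - y * x"

lemma com_mult: "com (x * y) z = x * com y z + com x z * y" "com z (x * y) = x * com z y + com z x * y"
  by (simp_all add: com_def algebra_simps)

lemma com_add: "com (x + y) z = com x z + com y z" "com z (x + y) = com z x + com z y"
  by (simp_all add: com_def algebra_simps)

lemma com_of_int: "com (of_int k * x) y = of_int k * com x y" "com y (of_int k * x) = of_int k * com y x"
  for x :: "'a::ring_1"
proof -
  have "y * (of_int k * x) = of_int k * (y * x)" by (metis mult.assoc mult_of_int_commute)
  then show "com (of_int k * x) y = of_int k * com x y" "com y (of_int k * x) = of_int k * com y x"
    unfolding com_def by (simp_all add: right_diff_distrib mult.assoc)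
qed

lemma com_zero [simp]: "com 0 x = 0" "com x 0 = 0" by (simp_all add: com_def)

lemma com_swap: "com x y = - com y x" by (simp add: com_def)

lemma symb_HE: "symb (gH s * gE r :: 'p::prime_card dst) a c l = (if a = r \<and> c = 0 then bin s (l + 2 * int r) else 0)"
  using symb_gE[of r "1 :: 'p dst"] by (auto simp: symb_gH' symb_1 v0_def)

lemma symb_EH: "symb (gE r * gH s :: 'p::prime_card dst) a c l = (if a = r \<and> c = 0 then bin s l else 0)"
  using symb_gH'[of s "1 :: 'p dst"] by (auto simp: symb_gE symb_1 v0_def)

lemma symb_HF: "symb (gH s * gF r :: 'p::prime_card dst) a c l = (if a = 0 \<and> c = r then bin s (l - 2 * int r) else 0)"
  by (auto simp: symb_gH' symb_gF1)

lemma symb_FH: "symb (gF r * gH s :: 'p::prime_card dst) a c l = (if a = 0 \<and> c = r then bin s l else 0)"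
proof -
  have "symb (gF r * gH s :: 'p dst) a c l = (\<Sum>k\<le>r. if k = 0 then if a = 0 \<and> c = r then bin s l else 0 else 0)"
    unfolding symb_gF' using symb_gH'[of s "1 :: 'p dst"] by (intro sum.cong refl) (auto simp: symb_1 v0_def)
  then show ?thesis by (simp add: sum.delta)
qed

lemma symb_EF: "symb (gE r * gF s :: 'p::prime_card dst) a c l = (if a = r \<and> c = s then 1 else 0)"
  by (auto simp: symb_gE symb_gF1)

lemma symb_FE: "symb (gF s * gE r :: 'p::prime_card dst) a c l =
  (if a \<le> r \<and> c \<le> s \<and> r - a = s - c then bin (r - a) (int s - int r - l) else 0)"
proof -
  have "symb (gF s * gE r :: 'p dst) a c l = (\<Sum>k\<le>s. if k = r - a then
     if a \<le> r \<and> c \<le> s \<and> r - a = s - c then bin (r - a) (int s - int r - l) else 0 else 0)"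
    unfolding symb_gF' using symb_gE[of r "1 :: 'p dst"] by (intro sum.cong refl) (auto simp: symb_1 v0_def)
  then show ?thesis by (auto simp: sum.delta)
qed

lemma dord_com_HE: "dord (s + r) (com (gH s) (gE r) :: 'p::prime_card dst)"
  unfolding dord_def com_def symb_diff[abs_def] symb_HE symb_EH
proof (intro allI)
  fix a c
  have "lowdeg s (\<lambda>l. bin s (l + 2 * int r) - bin s l :: 'p mod_ring)"
    by (rule lowdeg_shift_diff[OF lowdeg_bin])
  then show "lowdeg (s + r - a - c) (\<lambda>l. (if a = r \<and> c = 0 then bin s (l + 2 * int r) else 0) - (if a = r \<and> c = 0 then bin s l else 0) :: 'p mod_ring)"
    by (cases "a = r \<and> c = 0") auto
qed

lemma dord_com_HF: "dord (s + r) (com (gH s) (gF r) :: 'p::prime_card dst)"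
  unfolding dord_def com_def symb_diff[abs_def] symb_HF symb_FH
proof (intro allI)
  fix a c
  have "lowdeg s (\<lambda>l. bin s (l + - (2 * int r)) - bin s l :: 'p mod_ring)"
    by (rule lowdeg_shift_diff[OF lowdeg_bin])
  then show "lowdeg (s + r - a - c) (\<lambda>l. (if a = 0 \<and> c = r then bin s (l - 2 * int r) else 0) - (if a = 0 \<and> c = r then bin s l else 0) :: 'p mod_ring)"
    by (cases "a = 0 \<and> c = r") auto
qed

text \<open>The term E^[r] F^[s] cancels. In the other terms of F^[s] E^[r] both exponents drop by
  some k > 0 while the degree in the weight rises by k only, a net loss of k.\<close>

lemma dord_com_FE: "dord (s + r) (com (gF s) (gE r) :: 'p::prime_card dst)"
  unfolding dord_def com_def symb_diff[abs_def] symb_FE symb_EF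
proof (intro allI)
  fix a c
  show "lowdeg (s + r - a - c) (\<lambda>l. (if a \<le> r \<and> c \<le> s \<and> r - a = s - c then bin (r - a) (int s - int r - l) else 0) - (if a = r \<and> c = s then 1 else 0) :: 'p mod_ring)"
  proof (cases "a < r \<and> c < s \<and> r - a = s - c")
    case True
    then have "lowdeg (s + r - a - c) (bin (r - a) :: int \<Rightarrow> 'p mod_ring)"
      by (intro lowdeg_mono[OF lowdeg_bin]) auto
    then show ?thesis using True by (auto intro: lowdeg_reflect)
  next
    case False
    then have e: "(a \<le> r \<and> c \<le> s \<and> r - a = s - c) = (a = r \<and> c = s)" by auto
    show ?thesis unfolding e by (cases "a = r \<and> c = s") auto
  qed
qed

lemma gF_gF: "gF r * gF s = (of_nat ((r + s) choose r) * gF (r + s) :: 'p::prime_card dst)"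
proof -
  have "symb (gF r * gF s) a c l = symb (of_nat ((r + s) choose r) * gF (r + s) :: 'p dst) a c l" for a c l
  proof -
    have "symb (gF r * gF s :: 'p dst) a c l = (\<Sum>k\<le>r. if k = 0 then if a = 0 \<and> c = r + s then of_nat ((r + s) choose s) else 0 else 0)"
      unfolding symb_gF' by (intro sum.cong refl) (auto simp: symb_gF1)
    then show ?thesis using binomial_symmetric[of r "r + s"] by (simp add: sum.delta symb_of_nat symb_gF1)
  qed
  then show ?thesis unfolding symb_inject[symmetric] by blast
qed

lemma gE_gE: "gE r * gE s = (of_nat ((r + s) choose r) * gE (r + s) :: 'p::prime_card dst)"
proof -
  have "symb (gE r * (gE s * 1)) a c l = symb (of_nat ((r + s) choose r) * (gE (r + s) * 1) :: 'p dst) a c l" for a c l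
    unfolding symb_of_nat symb_gE by (auto simp: symb_1 v0_def)
  then have "symb (gE r * (gE s * 1)) = symb (of_nat ((r + s) choose r) * (gE (r + s) * 1) :: 'p dst)" by blast
  then show ?thesis by (simp add: symb_inject)
qed

lemma com_FF: "com (gF r) (gF s) = (0 :: 'p::prime_card dst)"
  unfolding com_def gF_gF using binomial_symmetric[of r "r + s"] by (simp add: add.commute)

lemma com_EE: "com (gE r) (gE s) = (0 :: 'p::prime_card dst)"
  unfolding com_def gE_gE using binomial_symmetric[of r "r + s"] by (simp add: add.commute)

lemma com_HH: "com (gH r) (gH s) = (0 :: 'p::prime_card dst)"
proof -
  have "symb (gH r * (gH s * 1)) = symb (gH s * (gH r * 1) :: 'p dst)"
    unfolding fun_eq_iff symb_gH' by auto
  then show ?thesis by (simp add: symb_inject com_def)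
qed

lemma gH_gH: "dord (r + s) (gH r * gH s - of_nat ((r + s) choose r) * gH (r + s) :: 'p::prime_card dst)"
  unfolding dord_def
proof (intro allI)
  fix a c
  have "symb (gH r * (gH s * 1) - of_nat ((r + s) choose r) * (gH (r + s) * 1) :: 'p dst) a c =
     (\<lambda>l. if a = 0 \<and> c = 0 then bin r l * bin s l - of_nat ((r + s) choose r) * bin (r + s) l else 0)"
    unfolding fun_eq_iff symb_diff symb_of_nat symb_gH' by (auto simp: symb_1 v0_def)
  then show "lowdeg (r + s - a - c) (symb (gH r * gH s - of_nat ((r + s) choose r) * gH (r + s) :: 'p dst) a c)"
    using bin_mult[of r s, where 'a = "'p mod_ring"] by (cases "a = 0 \<and> c = 0") auto
qed

inductive gen_ord :: "nat \<Rightarrow> 'p::prime_card dst \<Rightarrow> bool" where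
  "gen_ord r (gE r)" | "gen_ord r (gH r)" | "gen_ord r (gF r)"

lemma dord_com_swap: "dord (r + s) (com x y) \<Longrightarrow> dord (s + r) (com y x)"
  using dord_uminus[of "r + s" "com x y"] com_swap[of y x] by (simp add: add.commute)

lemma gen_ord_com: "gen_ord r x \<Longrightarrow> gen_ord s y \<Longrightarrow> dord (r + s) (com x y)"
  by (auto elim!: gen_ord.cases simp: com_EE com_FF com_HH dord_0
      intro: dord_com_HE dord_com_HF dord_com_FE dord_com_swap[OF dord_com_HE] dord_com_swap[OF dord_com_HF]
        dord_com_swap[OF dord_com_FE])

lemma com_mult_ord:
  assumes "dord (Suc i) x" "dord (Suc j) y" "dord (i + s) (com x z)" "dord (j + s) (com y z)"
  shows "dord (i + j + s) (com (x * y) z)"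
  using dord_add[OF dord_mult'[OF assms(1,4)] dord_mono[OF dord_mult[OF assms(3,2)], of "i + (j + s)"]]
  by (simp add: com_mult add_ac)

lemma dord_com_gen: "dord (Suc i) x \<Longrightarrow> gen_ord s z \<Longrightarrow> dord (i + s) (com x z)"
proof (induction x rule: dord_induct)
  case (mon a b c k)
  have "dord (a + b + s) (com (gE a * gH b) z)"
    using mon by (intro com_mult_ord dord_gE dord_gH gen_ord_com gen_ord.intros)
  then have "dord (a + b + c + s) (com (mon a b c) z)"
    unfolding mon_def using mon dord_mult[OF dord_gE dord_gH, of a b]
    by (intro com_mult_ord dord_gF gen_ord_com gen_ord.intros) (auto intro: dord_gE dord_gH)
  then show ?case using mon by (auto simp: com_of_int intro!: dord_of_int elim: dord_mono)
qed (auto simp: dord_0 com_add dord_add)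

text \<open>The graded ring of the filtration is commutative. The commutator is a derivation in each
  argument, so the claim is carried from divided powers to monomials, first in one argument and then
  in the other.\<close>

lemma dord_com: "dord (Suc j) y \<Longrightarrow> dord (Suc i) x \<Longrightarrow> dord (i + j) (com x y)"
proof (induction y rule: dord_induct)
  case (mon a b c k)
  have sw: "dord n (com u v) \<Longrightarrow> dord n (com v u)" for n and u v :: "'a dst"
    using dord_uminus com_swap[of v u] by simp
  have "dord (a + b + i) (com (gE a * gH b) x)"
    using mon sw[OF dord_com_gen[OF mon(2)]] by (intro com_mult_ord dord_gE dord_gH) (auto intro: gen_ord.intros simp: add.commute)
  then have "dord (a + b + c + i) (com (mon a b c) x)"
    unfolding mon_def using mon dord_mult[OF dord_gE dord_gH, of a b] sw[OF dord_com_gen[OF mon(2)]]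
    by (intro com_mult_ord dord_gF) (auto intro: gen_ord.intros dord_gE dord_gH simp: add.commute)
  then have "dord (i + j) (com (mon a b c) x)" by (rule dord_mono) (use mon in simp)
  then have "dord (i + j) (com x (mon a b c))" by (rule sw)
  then show ?case by (simp add: com_of_int dord_of_int)
qed (auto simp: dord_0 com_add dord_add)


section \<open>The Frobenius morphism and its splitting on distributions\<close>

text \<open>An element with this symbol exists by \<open>symb_ex\<close>, because the restriction
  still has finite order, and it is unique by \<open>symb_inject\<close>; likewise for
  \<open>spl\<close>.\<close>

definition frob :: "'p::prime_card dst \<Rightarrow> 'p dst" where
  "frob x = (SOME y. symb y = (\<lambda>a c l. symb x (CARD('p) * a) (CARD('p) * c) (int CARD('p) * l)))"

definition spl :: "'p::prime_card dst \<Rightarrow> 'p dst" where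
  "spl x = (SOME y. symb y = (\<lambda>a c. if CARD('p) dvd a \<and> CARD('p) dvd c
      then spread (symb x (a div CARD('p)) (c div CARD('p))) else (\<lambda>l. 0)))"

lemma frob_lowdeg:
  fixes x :: "'p::prime_card dst"
  assumes "dord n x" "n \<le> CARD('p) * m"
  shows "lowdeg (m - a - c) (\<lambda>l. symb x (CARD('p) * a) (CARD('p) * c) (int CARD('p) * l))"
proof (rule lowdeg_scale)
  show "lowdeg (n - CARD('p) * a - CARD('p) * c) (symb x (CARD('p) * a) (CARD('p) * c))"
    using assms(1) by (auto simp: dord_def)
  show "n - CARD('p) * a - CARD('p) * c \<le> CARD('p) * (m - a - c)"
    unfolding diff_mult_distrib2 using assms(2) by (intro diff_le_mono)
qed

lemma symb_frob: "symb (frob x :: 'p::prime_card dst) a c l = symb x (CARD('p) * a) (CARD('p) * c) (int CARD('p) * l)"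
proof -
  obtain n where "dord n x" using dord_ex by blast
  then have "dord (CARD('p) * n) x" by (rule dord_mono) simp
  from symb_ex[OF frob_lowdeg[OF this order_refl]]
  have "\<exists>y. symb y = (\<lambda>a c l. symb x (CARD('p) * a) (CARD('p) * c) (int CARD('p) * l))" .
  from someI_ex[OF this] show ?thesis by (simp add: frob_def)
qed

lemma dord_frob: "dord n x \<Longrightarrow> n \<le> CARD('p) * m \<Longrightarrow> dord m (frob x :: 'p::prime_card dst)"
  using frob_lowdeg[of n x m] by (simp add: dord_def symb_frob[abs_def])

lemma spl_lowdeg:
  fixes x :: "'p::prime_card dst"
  assumes "dord n x"
  shows "lowdeg (CARD('p) * n - a - c) (if CARD('p) dvd a \<and> CARD('p) dvd c
      then spread (symb x (a div CARD('p)) (c div CARD('p))) else (\<lambda>l. 0))"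
proof (cases "CARD('p) dvd a \<and> CARD('p) dvd c")
  case True
  then obtain a' c' where a: "a = CARD('p) * a'" "c = CARD('p) * c'" by (auto elim!: dvdE)
  have "lowdeg (CARD('p) * (n - a' - c')) (spread (symb x a' c'))"
    using assms by (intro lowdeg_spread) (simp add: dord_def)
  moreover have "CARD('p) * n - a - c = CARD('p) * (n - a' - c')" by (simp only: a diff_mult_distrib2)
  ultimately show ?thesis using True by (simp add: a)
qed auto

lemma symb_spl: "symb (spl x :: 'p::prime_card dst) a c l =
   (if CARD('p) dvd a \<and> CARD('p) dvd c then spread (symb x (a div CARD('p)) (c div CARD('p))) l else 0)"
proof -
  obtain n where "dord n x" using dord_ex by blast
  from symb_ex[OF spl_lowdeg[OF this]]
  have "\<exists>y. symb y = (\<lambda>a c. if CARD('p) dvd a \<and> CARD('p) dvd c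
      then spread (symb x (a div CARD('p)) (c div CARD('p))) else (\<lambda>l. 0))" .
  from someI_ex[OF this] show ?thesis by (simp add: spl_def)
qed

lemma dord_spl: "dord n x \<Longrightarrow> dord (CARD('p) * n) (spl x :: 'p::prime_card dst)"
  unfolding dord_def[of "CARD('p) * n"] symb_spl[abs_def]
proof (intro allI)
  fix a c assume x: "dord n x"
  show "lowdeg (CARD('p) * n - a - c) (\<lambda>l. if CARD('p) dvd a \<and> CARD('p) dvd c
      then spread (symb x (a div CARD('p)) (c div CARD('p))) l else 0)"
    using spl_lowdeg[OF x, of a c] by (cases "CARD('p) dvd a \<and> CARD('p) dvd c") auto
qed

lemma symb_spl_mult: "symb (spl x :: 'p::prime_card dst) (CARD('p) * a) (CARD('p) * c) (int CARD('p) * l) = symb x a c l"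
  by (simp add: symb_spl spread_def)

section \<open>Multiplicativity of the Frobenius morphism\<close>

lemma frob_add: "frob (x + y) = frob x + (frob y :: 'p::prime_card dst)"
  unfolding symb_inject[symmetric] fun_eq_iff by (simp add: symb_frob symb_add)

lemma frob_uminus: "frob (- x) = - (frob x :: 'p::prime_card dst)"
  unfolding symb_inject[symmetric] fun_eq_iff by (simp add: symb_frob symb_uminus)

lemma frob_1: "frob 1 = (1 :: 'p::prime_card dst)"
  unfolding symb_inject[symmetric] fun_eq_iff by (auto simp: symb_frob symb_1 v0_def)

lemma choose_mod_p: "(of_nat (CARD('p) * a choose r) :: 'p::prime_card mod_ring) =
   (if CARD('p) dvd r then of_nat (a choose (r div CARD('p))) else 0)"
  unfolding bin_of_nat[symmetric] of_nat_mult bin_p_mult ..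

lemma frob_gE_mult: "frob (gE r * x) = (if CARD('p) dvd r then gE (r div CARD('p)) * frob x else 0 :: 'p::prime_card dst)"
proof -
  have p: "CARD('p) > 0" by simp
  have "symb (frob (gE r * x)) a c l = symb (if CARD('p) dvd r then gE (r div CARD('p)) * frob x else 0) a c l" for a c l
  proof (cases "CARD('p) dvd r")
    case True
    then obtain s where r: "r = CARD('p) * s" by (auto elim!: dvdE)
    show ?thesis using p by (auto simp: r symb_frob symb_gE choose_mod_p simp flip: diff_mult_distrib2)
  next
    case False
    then show ?thesis by (simp add: symb_frob symb_gE choose_mod_p symb_0)
  qed
  then show ?thesis unfolding symb_inject[symmetric] by blast
qed

lemma sum_multiples:
  fixes f :: "nat \<Rightarrow> 'a::comm_monoid_add"
  assumes "p > 0" "\<And>k. k \<le> p * s \<Longrightarrow> \<not> p dvd k \<Longrightarrow> f k = 0"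
  shows "(\<Sum>k\<le>p * s. f k) = (\<Sum>k\<le>s. f (p * k))"
proof -
  have "(\<Sum>k\<le>p * s. f k) = (\<Sum>k\<in>(\<lambda>k. p * k) ` {..s}. f k)"
  proof (intro sum.mono_neutral_right ballI)
    fix i assume i: "i \<in> {..p * s} - (\<lambda>k. p * k) ` {..s}"
    have "\<not> p dvd i" using i assms(1) by (auto elim!: dvdE)
    then show "f i = 0" using i assms(2) by simp
  qed auto
  also have "\<dots> = (\<Sum>k\<le>s. f (p * k))"
    using assms(1) by (subst sum.reindex) (auto simp: inj_on_def)
  finally show ?thesis .
qed

lemma bin_p_multI: "int CARD('p) dvd z \<Longrightarrow> \<not> CARD('p) dvd k \<Longrightarrow> (bin k z :: 'p::prime_card mod_ring) = 0"
  using bin_p_mult[of k, where 'p = 'p] by (auto elim!: dvdE)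

lemma frob_gF_mult: "frob (gF r * x) = (if CARD('p) dvd r then gF (r div CARD('p)) * frob x else 0 :: 'p::prime_card dst)"
proof -
  let ?p = "CARD('p)"
  have p: "?p > 0" by simp
  have "symb (frob (gF r * x)) a c l = symb (if ?p dvd r then gF (r div ?p) * frob x else 0) a c l" for a c l
  proof -
    let ?t = "\<lambda>k. if r \<le> ?p * c + k then bin k (2 * int (?p * c + k - r) + int r - int (?p * a + k) - int ?p * l) *
      of_nat (?p * c choose (?p * c + k - r)) * symb x (?p * a + k) (?p * c + k - r) (int ?p * l) else 0 :: 'p mod_ring"
    \<comment> \<open>If p divides the exponent of F read in this term but not k, the upper argument
      of the first binomial is a multiple of p and Lucas' congruence gives 0; if p does not divide
      that exponent, the second binomial is 0.\<close>
    have t0: "?t k = 0" if "\<not> (?p dvd k \<and> ?p dvd r)" for k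
    proof (cases "r \<le> ?p * c + k \<and> ?p dvd (?p * c + k - r)")
      case True
      then obtain C where C: "?p * c + k - r = ?p * C" by (auto elim!: dvdE)
      then have r: "r + ?p * C = ?p * c + k" using True by simp
      have nk: "\<not> ?p dvd k"
        using that r by (metis dvd_add_left_iff dvd_add_right_iff dvd_triv_left)
      have "2 * int (?p * C) + int r - int (?p * a + k) - int ?p * l = int ?p * (int C + int c - int a - l)"
        using arg_cong[OF r, of int] by (simp add: algebra_simps)
      then have "(bin k (2 * int (?p * C) + int r - int (?p * a + k) - int ?p * l) :: 'p mod_ring) = 0"
        using nk by (intro bin_p_multI) simp
      then show ?thesis by (simp only: C mult_zero_left if_cancel)
    next
      case False
      then show ?thesis by (auto simp: choose_mod_p)
    qed
    show ?thesis
    proof (cases "?p dvd r")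
      case True
      then obtain s where r: "r = ?p * s" by (auto elim!: dvdE)
      have "symb (frob (gF r * x)) a c l = (\<Sum>k\<le>r. ?t k)"
        unfolding symb_frob symb_gF' ..
      also have "\<dots> = (\<Sum>k\<le>s. ?t (?p * k))"
        unfolding r by (rule sum_multiples[OF p]) (use t0 r in blast)
      also have "\<dots> = (\<Sum>k\<le>s. if s \<le> c + k then bin k (2 * int (c + k - s) + int s - int (a + k) - l) *
         of_nat (c choose (c + k - s)) * symb x (?p * (a + k)) (?p * (c + k - s)) (int ?p * l) else 0)"
      proof (rule sum.cong[OF refl])
        fix k
        have 1: "r \<le> ?p * c + ?p * k \<longleftrightarrow> s \<le> c + k" using p by (simp add: r flip: distrib_left)
        have 2: "?p * c + ?p * k - r = ?p * (c + k - s)" by (simp only: r diff_mult_distrib2 distrib_left)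
        have 3: "2 * int (?p * C) + int r - int (?p * a + ?p * k) - int ?p * l =
           int ?p * (2 * int C + int s - int (a + k) - l)" for C by (simp add: r algebra_simps)
        show "?t (?p * k) = (if s \<le> c + k then bin k (2 * int (c + k - s) + int s - int (a + k) - l) *
         of_nat (c choose (c + k - s)) * symb x (?p * (a + k)) (?p * (c + k - s)) (int ?p * l) else 0)"
          unfolding 1 2 3 bin_p_mult choose_mod_p using p by (simp add: distrib_left)
      qed
      also have "\<dots> = symb (gF s * frob x) a c l" unfolding symb_gF' symb_frob ..
      finally show ?thesis using p by (simp add: r)
    next
      case False
      then have "(\<Sum>k\<le>r. ?t k) = 0" by (intro sum.neutral ballI t0) auto
      then show ?thesis using False unfolding symb_frob symb_gF' by (simp only: if_False symb_0)
    qed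
  qed
  then show ?thesis unfolding symb_inject[symmetric] by blast
qed

lemma frob_gE: "frob (gE r) = (if CARD('p) dvd r then gE (r div CARD('p)) else 0 :: 'p::prime_card dst)"
  using frob_gE_mult[of r "1 :: 'p dst"] by (simp add: frob_1 split: if_splits)

lemma frob_gF: "frob (gF r) = (if CARD('p) dvd r then gF (r div CARD('p)) else 0 :: 'p::prime_card dst)"
  using frob_gF_mult[of r "1 :: 'p dst"] by (simp add: frob_1 split: if_splits)

lemma frob_gH: "frob (gH r) = (if CARD('p) dvd r then gH (r div CARD('p)) else 0 :: 'p::prime_card dst)"
proof -
  have p: "CARD('p) > 0" by simp
  have "symb (frob (gH r)) a c l = symb (if CARD('p) dvd r then gH (r div CARD('p)) else 0 :: 'p dst) a c l" for a c l
    using symb_gH'[of r "1 :: 'p dst"] symb_gH'[of "r div CARD('p)" "1 :: 'p dst"] p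
    by (auto simp: symb_frob symb_1 v0_def symb_0 bin_p_mult)
  then show ?thesis unfolding symb_inject[symmetric] by blast
qed

lemma frob_mult: "frob (x * y) = frob x * (frob y :: 'p::prime_card dst)"
proof (induction x arbitrary: y rule: dst_induct)
  case (E n) show ?case unfolding frob_gE_mult frob_gE by simp
next
  case (F n) show ?case unfolding frob_gF_mult frob_gF by simp
next
  case (uminus x) then show ?case using frob_uminus[of "x * y"] by (simp add: frob_uminus)
next
  case (add x z) then show ?case by (simp add: distrib_right frob_add)
next
  case (mult x z) then show ?case by (simp add: mult.assoc)
qed (simp add: frob_1)

section \<open>Multiplicativity of the extension by zero\<close>

lemma symb_spl_gen: "symb (spl x :: 'p::prime_card dst) a c l =
   (if CARD('p) dvd a \<and> CARD('p) dvd c \<and> int CARD('p) dvd l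
    then symb x (a div CARD('p)) (c div CARD('p)) (l div int CARD('p)) else 0)"
  by (simp add: symb_spl spread_def)

lemma spl_add: "spl (x + y) = spl x + (spl y :: 'p::prime_card dst)"
  unfolding symb_inject[symmetric] fun_eq_iff by (simp add: symb_spl_gen symb_add)

lemma spl_uminus: "spl (- x) = - (spl x :: 'p::prime_card dst)"
  unfolding symb_inject[symmetric] fun_eq_iff by (simp add: symb_spl_gen symb_uminus)

lemma spl_0: "spl 0 = (0 :: 'p::prime_card dst)"
  unfolding symb_inject[symmetric] fun_eq_iff by (simp add: symb_spl symb_0 spread_def)

lemma frob_spl: "frob (spl x) = (x :: 'p::prime_card dst)"
  unfolding symb_inject[symmetric] fun_eq_iff by (simp add: symb_frob symb_spl_mult)

lemma spl_gE_mult: "spl (gE r * x) = (gE (CARD('p) * r) * spl x :: 'p::prime_card dst)"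
proof -
  let ?p = "CARD('p)"
  have p: "?p > 0" by simp
  have "symb (spl (gE r * x)) a c l = symb (gE (?p * r) * spl x) a c l" for a c l
  proof (cases "?p dvd a \<and> ?p dvd c \<and> int ?p dvd l")
    case True
    then obtain a' c' l' where "a = ?p * a'" "c = ?p * c'" "l = int ?p * l'" by (auto elim!: dvdE)
    then show ?thesis using p by (auto simp: symb_spl_mult symb_gE choose_mod_p simp flip: diff_mult_distrib2)
  next
    case False
    have "?p dvd a - ?p * r \<longleftrightarrow> ?p dvd a" if "?p * r \<le> a"
      using that by (metis dvd_diffD dvd_diff_nat dvd_triv_left)
    with False show ?thesis by (auto simp: symb_spl_gen symb_gE)
  qed
  then show ?thesis unfolding symb_inject[symmetric] by blast
qed

lemma spl_gH_mult: "spl (gH r * x) = (gH (CARD('p) * r) * spl x :: 'p::prime_card dst)"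
proof -
  let ?p = "CARD('p)"
  have p: "?p > 0" by simp
  have "symb (spl (gH r * x)) a c l = symb (gH (?p * r) * spl x) a c l" for a c l
  proof (cases "?p dvd a \<and> ?p dvd c \<and> int ?p dvd l")
    case True
    then obtain a' c' l' where a: "a = ?p * a'" "c = ?p * c'" "l = int ?p * l'" by (auto elim!: dvdE)
    have "int ?p * l' + 2 * int (?p * a') - 2 * int (?p * c') = int ?p * (l' + 2 * int a' - 2 * int c')"
      by (simp add: algebra_simps)
    then show ?thesis unfolding a symb_spl_mult symb_gH' using p by (simp add: bin_p_mult)
  next
    case False
    then show ?thesis by (auto simp: symb_spl_gen symb_gH')
  qed
  then show ?thesis unfolding symb_inject[symmetric] by blast
qed

text \<open>As in \<open>frob_gF_mult\<close> only the indices k divisible by p contribute; in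
  addition all terms vanish when (a, c, l) itself is not a triple of multiples of p.\<close>

lemma spl_gF_mult: "spl (gF r * x) = (gF (CARD('p) * r) * spl x :: 'p::prime_card dst)"
proof -
  let ?p = "CARD('p)"
  have p: "?p > 0" by simp
  have "symb (spl (gF r * x)) a c l = symb (gF (?p * r) * spl x) a c l" for a c l
  proof -
    let ?t = "\<lambda>k. if ?p * r \<le> c + k then bin k (2 * int (c + k - ?p * r) + int (?p * r) - int (a + k) - l) *
      of_nat (c choose (c + k - ?p * r)) * symb (spl x) (a + k) (c + k - ?p * r) l else 0 :: 'p mod_ring"
    have t0: "?t k = 0" if "\<not> (?p dvd a \<and> ?p dvd c \<and> int ?p dvd l \<and> ?p dvd k)" for k
    proof (cases "?p * r \<le> c + k \<and> ?p dvd (a + k) \<and> ?p dvd (c + k - ?p * r) \<and> int ?p dvd l")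
      case True
      then obtain A C l' where e: "a + k = ?p * A" "c + k - ?p * r = ?p * C" "l = int ?p * l'" by (auto elim!: dvdE)
      then have ck: "c + k = ?p * (r + C)" using True by (simp add: distrib_left)
      have nk: "\<not> ?p dvd k"
        using that True ck e(1) by (metis dvd_add_left_iff dvd_triv_left)
      have "2 * int (?p * C) + int (?p * r) - int (?p * A) - l = int ?p * (2 * int C + int r - int A - l')"
        by (simp add: algebra_simps e)
      then have "(bin k (2 * int (?p * C) + int (?p * r) - int (?p * A) - l) :: 'p mod_ring) = 0"
        using nk by (intro bin_p_multI) simp
      then show ?thesis by (simp only: e(1,2) mult_zero_left if_cancel)
    next
      case False
      then show ?thesis by (auto simp: symb_spl_gen)
    qed
    have s: "symb (gF (?p * r) * spl x) a c l = (\<Sum>k\<le>?p * r. ?t k)" unfolding symb_gF' ..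
    show ?thesis
    proof (cases "?p dvd a \<and> ?p dvd c \<and> int ?p dvd l")
      case True
      then obtain a' c' l' where a: "a = ?p * a'" "c = ?p * c'" "l = int ?p * l'" by (auto elim!: dvdE)
      have "(\<Sum>k\<le>?p * r. ?t k) = (\<Sum>k\<le>r. ?t (?p * k))"
        by (rule sum_multiples[OF p]) (use t0 in blast)
      also have "\<dots> = (\<Sum>k\<le>r. if r \<le> c' + k then bin k (2 * int (c' + k - r) + int r - int (a' + k) - l') *
         of_nat (c' choose (c' + k - r)) * symb x (a' + k) (c' + k - r) l' else 0)"
      proof (rule sum.cong[OF refl])
        fix k
        have 1: "?p * r \<le> c + ?p * k \<longleftrightarrow> r \<le> c' + k" using p by (simp add: a flip: distrib_left)
        have 2: "c + ?p * k - ?p * r = ?p * (c' + k - r)" by (simp only: a diff_mult_distrib2 distrib_left)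
        have 3: "2 * int (?p * C) + int (?p * r) - int (a + ?p * k) - l =
           int ?p * (2 * int C + int r - int (a' + k) - l')" for C by (simp add: a algebra_simps)
        have 4: "a + ?p * k = ?p * (a' + k)" by (simp add: a distrib_left)
        show "?t (?p * k) = (if r \<le> c' + k then bin k (2 * int (c' + k - r) + int r - int (a' + k) - l') *
         of_nat (c' choose (c' + k - r)) * symb x (a' + k) (c' + k - r) l' else 0)"
          unfolding 1 2 3 bin_p_mult unfolding 4 unfolding a symb_spl_mult choose_mod_p using p by simp
      qed
      also have "\<dots> = symb (spl (gF r * x)) a c l" unfolding a symb_spl_mult symb_gF' ..
      finally show ?thesis using s by simp
    next
      case False
      then have "(\<Sum>k\<le>?p * r. ?t k) = 0" by (intro sum.neutral ballI t0) auto
      then have "symb (gF (?p * r) * spl x) a c l = 0" using s by simp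
      then show ?thesis using False unfolding symb_spl_gen[of "gF r * x"] by auto
    qed
  qed
  then show ?thesis unfolding symb_inject[symmetric] by blast
qed

section \<open>The idempotent \<open>dT\<close> and its commutation with exponents divisible by
  p\<close>

definition dT :: "'p::prime_card dst" where "dT = spl 1"

lemma symb_dT: "symb (dT :: 'p::prime_card dst) a c l = (if a = 0 \<and> c = 0 \<and> int CARD('p) dvd l then 1 else 0)"
  by (auto simp: dT_def symb_spl_gen symb_1 v0_def elim!: dvdE)

lemma dT_eq: "dT = (\<Sum>i<CARD('p). of_int ((- 1) ^ i) * gH i :: 'p::prime_card dst)"
proof -
  have "symb (\<Sum>i<CARD('p). of_int ((- 1) ^ i) * gH i :: 'p dst) a c l = symb dT a c l" for a c l
  proof -
    have "symb (\<Sum>i<CARD('p). of_int ((- 1) ^ i) * gH i :: 'p dst) a c l =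
      (\<Sum>i<CARD('p). (- 1) ^ i * (bin i (l + 2 * int a - 2 * int c) * v0 a c l))"
      unfolding symb_sum symb_of_int using symb_gH'[of _ "1 :: 'p dst"] by (simp add: symb_1)
    also have "\<dots> = (if int CARD('p) dvd l + 2 * int a - 2 * int c then 1 else 0) * v0 a c l"
      unfolding mult.assoc[symmetric] sum_distrib_right[symmetric] alternating_bin ..
    finally show ?thesis by (auto simp: symb_dT v0_def)
  qed
  then have "symb dT = symb (\<Sum>i<CARD('p). of_int ((- 1) ^ i) * gH i :: 'p dst)" unfolding fun_eq_iff by metis
  then show ?thesis unfolding symb_inject .
qed

text \<open>Left multiplication by \<open>dT\<close> projects to the weights divisible by p, and
  E^[a] F^[c] 1_l has weight l + 2a - 2c.\<close>

lemma symb_dT_mult: "symb (dT * x :: 'p::prime_card dst) a c l =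
   (if int CARD('p) dvd l + 2 * int a - 2 * int c then symb x a c l else 0)"
proof -
  have "symb (dT * x :: 'p dst) a c l = (\<Sum>i<CARD('p). (- 1) ^ i * bin i (l + 2 * int a - 2 * int c)) * symb x a c l"
    unfolding dT_eq sum_distrib_right symb_sum mult.assoc symb_of_int symb_gH' by simp
  then show ?thesis by (simp add: alternating_bin)
qed

lemma dT_spl: "dT * spl x = (spl x :: 'p::prime_card dst)"
proof -
  have "symb (dT * spl x) a c l = symb (spl x) a c l" for a c l
    unfolding symb_dT_mult by (auto simp: symb_spl_gen elim!: dvdE simp flip: distrib_left right_diff_distrib mult.assoc)
  then show ?thesis unfolding symb_inject[symmetric] by blast
qed

text \<open>The image of a generator is E^[pn] \<open>dT\<close> or F^[pn] \<open>dT\<close>, and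
  this \<open>dT\<close> is absorbed by \<open>spl y\<close>, all of whose weights are divisible by
  p.\<close>

lemma spl_mult: "spl (x * y) = spl x * (spl y :: 'p::prime_card dst)"
proof (induction x arbitrary: y rule: dst_induct)
  case one show ?case using dT_spl[of y] by (simp add: dT_def)
next
  case (E n) show ?case using spl_gE_mult[of n y] spl_gE_mult[of n "1 :: 'p dst"] dT_spl[of y] by (simp add: mult.assoc dT_def)
next
  case (F n) show ?case using spl_gF_mult[of n y] spl_gF_mult[of n "1 :: 'p dst"] dT_spl[of y] by (simp add: mult.assoc dT_def)
next
  case (uminus x) then show ?case using spl_uminus[of "x * y"] by (simp add: spl_uminus)
next
  case (add x z) then show ?case by (simp add: distrib_right spl_add)
next
  case (mult x z) then show ?case by (simp add: mult.assoc)
qed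

lemma spl_dT: "spl x * dT = (spl x :: 'p::prime_card dst)"
  using spl_mult[of x 1] by (simp add: dT_def)

text \<open>E^[pr] and F^[pr] move weights by multiples of p and H preserves them, so the projection
  \<open>dT\<close> commutes with all three.\<close>

lemma dT_gE: "dT * gE (CARD('p) * r) = (gE (CARD('p) * r) * dT :: 'p::prime_card dst)"
  and dT_gF: "dT * gF (CARD('p) * r) = (gF (CARD('p) * r) * dT :: 'p dst)"
  and dT_gH: "dT * gH s = (gH s * dT :: 'p dst)"
proof -
  have "symb (dT * gE (CARD('p) * r)) a c l = symb (gE (CARD('p) * r) * dT :: 'p dst) a c l" for a c l
    using symb_gE[of "CARD('p) * r" "1 :: 'p dst"]
    by (auto simp: symb_dT_mult symb_gE symb_dT symb_1 v0_def dvd_add_left_iff)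
  then show "dT * gE (CARD('p) * r) = (gE (CARD('p) * r) * dT :: 'p dst)" unfolding symb_inject[symmetric] by blast
  have "symb (dT * gF (CARD('p) * r)) a c l = symb (gF (CARD('p) * r) * dT :: 'p dst) a c l" for a c l
  proof -
    have "symb (gF (CARD('p) * r) * dT :: 'p dst) a c l =
      (\<Sum>k\<le>CARD('p) * r. if k = 0 then if a = 0 \<and> c = CARD('p) * r \<and> int CARD('p) dvd l then 1 else 0 else 0)"
      unfolding symb_gF' by (intro sum.cong refl) (auto simp: symb_dT)
    then show ?thesis by (auto simp: sum.delta symb_dT_mult symb_gF1 dvd_diff_left_iff)
  qed
  then show "dT * gF (CARD('p) * r) = (gF (CARD('p) * r) * dT :: 'p dst)" unfolding symb_inject[symmetric] by blast
  have "symb (dT * gH s) a c l = symb (gH s * dT :: 'p dst) a c l" for a c l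
    using symb_gH'[of s "1 :: 'p dst"] by (auto simp: symb_dT_mult symb_gH' symb_dT symb_1 v0_def)
  then show "dT * gH s = (gH s * dT :: 'p dst)" unfolding symb_inject[symmetric] by blast
qed

lemma spl_gens: "spl (gE r) = (gE (CARD('p) * r) * dT :: 'p::prime_card dst)"
  "spl (gF r) = (gF (CARD('p) * r) * dT :: 'p dst)" "spl (gH r) = (gH (CARD('p) * r) * dT :: 'p dst)"
  using spl_gE_mult[of r "1 :: 'p dst"] spl_gF_mult[of r "1 :: 'p dst"] spl_gH_mult[of r "1 :: 'p dst"]
  by (simp_all add: dT_def)

lemma dT_idem: "dT * dT = (dT :: 'p::prime_card dst)"
  using dT_spl[of 1] by (simp add: dT_def)

lemma dord_dT: "dord CARD('p) (dT :: 'p::prime_card dst)"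
  using dord_spl[OF dord_1, where 'p = 'p] by (simp add: dT_def)

lemma spl_of_int: "spl (of_int k * x) = (of_int k * spl x :: 'p::prime_card dst)"
  unfolding symb_inject[symmetric] fun_eq_iff by (simp add: symb_spl_gen symb_of_int)

text \<open>Sharper than \<open>dord_spl\<close>, which allows order pn + p - 1: before the
  multiplication by \<open>dT\<close> the order is at most pn. For n = p^m this is the range of the
  commutator relations of level m + 1. On monomials y arises by multiplying the three exponents by
  p.\<close>

lemma spl_factor:
  fixes x :: "'p::prime_card dst"
  assumes "dord (Suc n) x"
  shows "\<exists>y. dord (Suc (CARD('p) * n)) y \<and> spl x = y * dT \<and> dT * y = y * dT"
  using assms
proof (induction x rule: dord_induct)
  case zero show ?case by (intro exI[of _ 0]) (simp add: dord_0 spl_0)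
next
  case (add x y)
  then obtain u v where "dord (Suc (CARD('p) * n)) u \<and> spl x = u * dT \<and> dT * u = u * dT"
    "dord (Suc (CARD('p) * n)) v \<and> spl y = v * dT \<and> dT * v = v * dT" by blast
  then show ?case by (intro exI[of _ "u + v"]) (simp add: dord_add spl_add algebra_simps)
next
  case (mon a b c k)
  let ?p = "CARD('p)"
  have "spl (mon a b c :: 'p dst) = mon (?p * a) (?p * b) (?p * c) * dT"
  proof -
    have "spl (mon a b c :: 'p dst) = spl (gE a * (gH b * (gF c * 1)))" by (simp add: mon_def mult.assoc)
    then show ?thesis unfolding spl_gE_mult spl_gH_mult spl_gF_mult by (simp add: mon_def mult.assoc dT_def)
  qed
  moreover have "dT * mon (?p * a) (?p * b) (?p * c) = (mon (?p * a) (?p * b) (?p * c) * dT :: 'p dst)"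
  proof -
    have "dT * mon (?p * a) (?p * b) (?p * c) = gE (?p * a) * (dT * gH (?p * b)) * (gF (?p * c) :: 'p dst)"
      unfolding mon_def by (simp only: dT_gE mult.assoc[symmetric])
    also have "\<dots> = gE (?p * a) * gH (?p * b) * (dT * gF (?p * c))" by (simp only: dT_gH mult.assoc)
    also have "\<dots> = mon (?p * a) (?p * b) (?p * c) * dT" by (simp only: dT_gF mult.assoc mon_def)
    finally show ?thesis .
  qed
  moreover have "?p * a + ?p * b + ?p * c < Suc (?p * n)"
    using mult_le_mono2[of "a + b + c" n ?p] mon by (simp add: distrib_left)
  moreover have "dT * (of_int k * z) = of_int k * (dT * z)" for z :: "'p dst"
    by (metis mult.assoc mult_of_int_commute)
  ultimately show ?case
    by (intro exI[of _ "of_int k * mon (?p * a) (?p * b) (?p * c)"] conjI)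
       (simp_all only: dord_of_int dord_mon spl_of_int mult.assoc)
qed

section \<open>Splitting off distributions of order \<open>p\<^sup>m\<close>\<close>

lemma choose_prime_power: "(of_nat (a choose CARD('p) ^ m) :: 'p::prime_card mod_ring) = of_nat (a div CARD('p) ^ m)"
  using bin_prime_power[of m "int a", where 'p = 'p] bin_of_nat[of "CARD('p) ^ m" a, where 'a = "'p mod_ring"]
  by (simp add: zdiv_int[symmetric]) (metis of_int_of_nat_eq of_nat_power zdiv_int)

text \<open>From (a choose i+j)(i+j choose i) = (a choose i)(a-i choose j).\<close>

lemma not_dvd_choose_add:
  assumes "\<not> p dvd (a choose i)" "\<not> p dvd (a - i choose j)" "i + j \<le> a" "prime (p :: nat)"
  shows "\<not> p dvd (a choose (i + j))"
proof
  assume "p dvd (a choose (i + j))"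
  then have "p dvd (a choose (i + j)) * ((i + j) choose i)" by simp
  also have "(a choose (i + j)) * ((i + j) choose i) = (a choose i) * (a - i choose j)"
    using choose_mult[of i "i + j" a] assms(3) by simp
  finally show False using assms by (simp add: prime_dvd_mult_iff)
qed

text \<open>Pieces of size p^m are taken one at a time from an exponent that is at least p^m: its
  m-th digit is then nonzero, so the binomial is a unit mod p. Once all exponents are below p^m, a
  piece of size p^m is collected as p pieces of size p^(m-1); for this the number t of pieces has to
  be arbitrary in the induction.\<close>

lemma greedy_split:
  assumes p: "prime p" and dig: "\<And>a m. (p dvd (a choose p ^ m)) \<longleftrightarrow> p dvd (a div p ^ m)"
  shows "a < p * p ^ m \<Longrightarrow> b < p * p ^ m \<Longrightarrow> c < p * p ^ m \<Longrightarrow> t * p ^ m \<le> a + b + c \<Longrightarrow>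
    \<exists>a1 b1 c1. a1 \<le> a \<and> b1 \<le> b \<and> c1 \<le> c \<and> a1 + b1 + c1 = t * p ^ m \<and>
      \<not> p dvd (a choose a1) \<and> \<not> p dvd (b choose b1) \<and> \<not> p dvd (c choose c1)"
proof (induction m arbitrary: a b c t)
  have p1: "p > 1" using p by (rule prime_gt_1_nat)
  have big: "\<exists>a1 b1 c1. a1 \<le> a \<and> b1 \<le> b \<and> c1 \<le> c \<and> a1 + b1 + c1 = p ^ m \<and>
      \<not> p dvd (a choose a1) \<and> \<not> p dvd (b choose b1) \<and> \<not> p dvd (c choose c1)"
    if "a < p * p ^ m" "b < p * p ^ m" "c < p * p ^ m" "p ^ m \<le> a \<or> p ^ m \<le> b \<or> p ^ m \<le> c" for a b c m
  proof -
    have *: "\<not> p dvd (x choose p ^ m)" if "p ^ m \<le> x" "x < p * p ^ m" for x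
    proof -
      have "x div p ^ m > 0" "x div p ^ m < p" using that p1 by (auto simp: div_greater_zero_iff less_mult_imp_div_less)
      then show ?thesis unfolding dig by (auto dest: dvd_imp_le)
    qed
    from that(4) show ?thesis
    proof (elim disjE)
      assume "p ^ m \<le> a" then show ?thesis using *[of a] that(1) p1
        by (intro exI[of _ "p ^ m"] exI[of _ 0]) auto
    next
      assume "p ^ m \<le> b" then show ?thesis using *[of b] that(2) p1
        by (intro exI[of _ 0] exI[of _ "p ^ m"]) auto
    next
      assume "p ^ m \<le> c" then show ?thesis using *[of c] that(3) p1
        by (intro exI[of _ 0] exI[of _ "p ^ m"]) auto
    qed
  qed
  have step: "\<exists>a1 b1 c1. a1 \<le> a \<and> b1 \<le> b \<and> c1 \<le> c \<and> a1 + b1 + c1 = t * p ^ m \<and>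
      \<not> p dvd (a choose a1) \<and> \<not> p dvd (b choose b1) \<and> \<not> p dvd (c choose c1)"
    if one: "\<And>a b c. a < p * p ^ m \<Longrightarrow> b < p * p ^ m \<Longrightarrow> c < p * p ^ m \<Longrightarrow> p ^ m \<le> a + b + c \<Longrightarrow>
      \<exists>a1 b1 c1. a1 \<le> a \<and> b1 \<le> b \<and> c1 \<le> c \<and> a1 + b1 + c1 = p ^ m \<and>
      \<not> p dvd (a choose a1) \<and> \<not> p dvd (b choose b1) \<and> \<not> p dvd (c choose c1)"
      and "a < p * p ^ m" "b < p * p ^ m" "c < p * p ^ m" "t * p ^ m \<le> a + b + c" for a b c t m
    using that(2-)
  proof (induction t)
    case 0 then show ?case using p1 by (intro exI[of _ 0]) auto
  next
    case (Suc t)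
    then obtain a1 b1 c1 where 1: "a1 \<le> a" "b1 \<le> b" "c1 \<le> c" "a1 + b1 + c1 = t * p ^ m"
      "\<not> p dvd (a choose a1)" "\<not> p dvd (b choose b1)" "\<not> p dvd (c choose c1)" by auto
    have "p ^ m \<le> (a - a1) + (b - b1) + (c - c1)" "a - a1 < p * p ^ m" "b - b1 < p * p ^ m" "c - c1 < p * p ^ m"
      using 1(1-4) Suc.prems by auto
    from one[OF this(2-4,1)] obtain a2 b2 c2 where
      2: "a2 \<le> a - a1" "b2 \<le> b - b1" "c2 \<le> c - c1" "a2 + b2 + c2 = p ^ m"
      "\<not> p dvd (a - a1 choose a2)" "\<not> p dvd (b - b1 choose b2)" "\<not> p dvd (c - c1 choose c2)" by blast
    show ?case
      by (intro exI[of _ "a1 + a2"] exI[of _ "b1 + b2"] exI[of _ "c1 + c2"])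
         (use 1 2 p in \<open>auto simp: not_dvd_choose_add\<close>)
  qed
  {
    case 0
    show ?case
    proof (rule step)
      fix a b c :: nat assume "a < p * p ^ 0" "b < p * p ^ 0" "c < p * p ^ 0" "p ^ 0 \<le> a + b + c"
      then show "\<exists>a1 b1 c1. a1 \<le> a \<and> b1 \<le> b \<and> c1 \<le> c \<and> a1 + b1 + c1 = p ^ 0 \<and>
          \<not> p dvd (a choose a1) \<and> \<not> p dvd (b choose b1) \<and> \<not> p dvd (c choose c1)"
        by (intro big) auto
    qed (use 0 in auto)
  next
    case (Suc m)
    show ?case
    proof (rule step)
      fix a b c :: nat assume *: "a < p * p ^ Suc m" "b < p * p ^ Suc m" "c < p * p ^ Suc m" "p ^ Suc m \<le> a + b + c"
      show "\<exists>a1 b1 c1. a1 \<le> a \<and> b1 \<le> b \<and> c1 \<le> c \<and> a1 + b1 + c1 = p ^ Suc m \<and>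
          \<not> p dvd (a choose a1) \<and> \<not> p dvd (b choose b1) \<and> \<not> p dvd (c choose c1)"
      proof (cases "p ^ Suc m \<le> a \<or> p ^ Suc m \<le> b \<or> p ^ Suc m \<le> c")
        case True then show ?thesis using * by (intro big)
      next
        case False
        then show ?thesis using Suc.IH[of a b c p] * by auto
      qed
    qed (use Suc.prems in auto)
  }
qed

lemma CARD_dvd_choose: "CARD('p::prime_card) dvd (a choose CARD('p) ^ m) \<longleftrightarrow> CARD('p) dvd (a div CARD('p) ^ m)"
  using choose_prime_power[of a m, where 'p = 'p] of_nat_mod_ring_0[where 'p = 'p] by metis

lemma dord_of_nat: "dord n x \<Longrightarrow> dord n (of_nat k * x)"
  using dord_of_int[of n x "int k"] by simp

text \<open>The graded ring is a divided power algebra in three commuting variables. The error has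
  three sources: moving F past the E and H of the second factor, moving H past its E, and the lower
  terms in the product of two binomials in H.\<close>

lemma mon_mult_leading:
  "dord (a + b + c + (a' + b' + c')) (mon a b c * mon a' b' c' -
     of_nat ((a + a' choose a) * (b + b' choose b) * (c + c' choose c)) * mon (a + a') (b + b') (c + c') :: 'p::prime_card dst)"
proof -
  let ?n = "a + b + c + (a' + b' + c')"
  let ?A = "of_nat (a + a' choose a) :: 'p dst" and ?B = "of_nat (b + b' choose b) :: 'p dst" and ?C = "of_nat (c + c' choose c) :: 'p dst"
  have 1: "dord ?n (gE a * gH b * com (gF c) (gE a' * gH b') * gF c' :: 'p dst)"
  proof -
    have "dord (c + (a' + b')) (com (gF c) (gE a' * gH b') :: 'p dst)"
      by (rule dord_com[OF _ dord_gF]) (use dord_mult[OF dord_gE dord_gH, of a' b'] in simp)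
    moreover have "dord (Suc (a + b)) (gE a * gH b :: 'p dst)" using dord_mult[OF dord_gE dord_gH, of a b] by simp
    ultimately have "dord (a + b + (c + (a' + b'))) (gE a * gH b * com (gF c) (gE a' * gH b') :: 'p dst)" by (intro dord_mult')
    from dord_mult[OF this dord_gF[of c']] show ?thesis by (simp add: add_ac)
  qed
  have 2: "dord ?n (gE a * com (gH b) (gE a') * (gH b' * (?C * gF (c + c'))))"
  proof -
    have "dord (a + (b + a')) (gE a * com (gH b) (gE a') :: 'p dst)"
      by (intro dord_mult' dord_gE dord_com dord_gH)
    moreover have "dord (Suc (b' + (c + c'))) (gH b' * (?C * gF (c + c')) :: 'p dst)"
      using dord_mult[OF dord_gH dord_of_nat[OF dord_gF], of b' "c + c'"] by simp
    ultimately show ?thesis using dord_mult[of "a + (b + a')" _ "b' + (c + c')"] by (simp add: add_ac)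
  qed
  have 3: "dord ?n (?A * gE (a + a') * (gH b * gH b' - ?B * gH (b + b')) * (?C * gF (c + c')))"
  proof -
    have "dord (a + a' + (b + b')) (?A * gE (a + a') * (gH b * gH b' - ?B * gH (b + b')))"
      by (intro dord_mult' dord_of_nat dord_gE gH_gH)
    then show ?thesis using dord_mult[OF _ dord_of_nat[OF dord_gF], of "a + a' + (b + b')" _ "c + c'"] by (simp add: add_ac)
  qed
  have comm: "of_nat n * z = z * of_nat n" for n and z :: "'p dst" by (rule mult_of_nat_commute)
  have "mon a b c * mon a' b' c' - of_nat ((a + a' choose a) * (b + b' choose b) * (c + c' choose c)) * mon (a + a') (b + b') (c + c') =
     gE a * gH b * com (gF c) (gE a' * gH b') * gF c' + gE a * com (gH b) (gE a') * (gH b' * (?C * gF (c + c'))) +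
     ?A * gE (a + a') * (gH b * gH b' - ?B * gH (b + b')) * (?C * gF (c + c'))"
  proof -
    have "mon a b c * mon a' b' c' = gE a * gH b * com (gF c) (gE a' * gH b') * gF c' + gE a * gH b * (gE a' * gH b') * (gF c * gF c')"
      by (simp add: mon_def com_def algebra_simps)
    also have "gE a * gH b * (gE a' * gH b') * (gF c * gF c') = gE a * com (gH b) (gE a') * (gH b' * (gF c * gF c')) +
        (gE a * gE a') * (gH b * gH b') * (gF c * gF c')"
      by (simp add: com_def algebra_simps)
    finally have e: "mon a b c * mon a' b' c' = gE a * gH b * com (gF c) (gE a' * gH b') * gF c' +
       (gE a * com (gH b) (gE a') * (gH b' * (?C * gF (c + c'))) + (?A * gE (a + a')) * (gH b * gH b') * (?C * gF (c + c')))"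
      unfolding gE_gE gF_gF .
    have "of_nat ((a + a' choose a) * (b + b' choose b) * (c + c' choose c)) * mon (a + a') (b + b') (c + c') =
       ?A * gE (a + a') * (?B * gH (b + b')) * (?C * gF (c + c'))"
      unfolding mon_def of_nat_mult by (metis (no_types, opaque_lifting) comm mult.assoc)
    then show ?thesis unfolding e by (simp add: right_diff_distrib left_diff_distrib)
  qed
  then show ?thesis using dord_add[OF dord_add[OF 1 2] 3] by simp
qed

text \<open>By the greedy choice a monomial of order i is, up to a scalar and lower order, the
  product of a monomial of order i - q and one of order q. So a property that respects sums, such
  products and lower order holds for all elements of order i.\<close>

lemma dord_split [consumes 3, case_names add prod lower]:
  fixes x :: "'p::prime_card dst" and m
  defines "q \<equiv> CARD('p) ^ m"
  assumes x: "dord (Suc i) x" and "q \<le> i" "i < 2 * q"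
    and add: "\<And>x y. P x \<Longrightarrow> P y \<Longrightarrow> P (x + y)"
    and prod: "\<And>s g. dord (Suc (i - q)) s \<Longrightarrow> dord (Suc q) g \<Longrightarrow> P (s * g)"
    and lower: "\<And>y. dord i y \<Longrightarrow> P y"
  shows "P x"
  using x
proof (induction x rule: dord_induct)
  case zero show ?case by (rule lower) (rule dord_0)
next
  case (add x y) then show ?case by (intro assms(5))
next
  case (mon a b c k)
  let ?p = "CARD('p)"
  have p: "prime ?p" by (rule CARD_prime)
  show ?case
  proof (cases "a + b + c < i")
    case True
    then show ?thesis by (intro lower dord_of_int dord_mon)
  next
    case False
    then have i: "a + b + c = i" using mon by simp
    \<comment> \<open>Since i < 2q, every exponent is below p^(m+1), the range of
      \<open>greedy_split\<close>.\<close>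
    have "2 * q \<le> ?p * q" using prime_ge_2_nat[OF p] by simp
    then have lt: "a < ?p * ?p ^ m" "b < ?p * ?p ^ m" "c < ?p * ?p ^ m" "1 * ?p ^ m \<le> a + b + c"
      using assms(3,4) i unfolding q_def by linarith+
    from greedy_split[OF p CARD_dvd_choose lt] obtain a1 b1 c1 where
      1: "a1 \<le> a" "b1 \<le> b" "c1 \<le> c" "a1 + b1 + c1 = q"
      "\<not> ?p dvd (a choose a1)" "\<not> ?p dvd (b choose b1)" "\<not> ?p dvd (c choose c1)"
      unfolding q_def by auto
    let ?u = "(a choose (a - a1)) * (b choose (b - b1)) * (c choose (c - c1))"
    have "\<not> ?p dvd ?u"
      using 1 p binomial_symmetric[OF 1(1)] binomial_symmetric[OF 1(2)] binomial_symmetric[OF 1(3)]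
      by (simp add: prime_dvd_mult_iff)
    then have u: "(of_nat ?u :: 'p mod_ring) \<noteq> 0" unfolding of_nat_mod_ring_0 .
    \<comment> \<open>The leading coefficient \<open>?u\<close> of the product is a unit mod p;
      \<open>w\<close> divides by it and restores the coefficient \<open>k\<close>.\<close>
    define w where "w = to_int_mod_ring (inverse (of_nat ?u :: 'p mod_ring) * of_int k)"
    have w: "(of_int w :: 'p mod_ring) * of_nat ?u = of_int k"
    proof -
      have "inverse x * y * x = y" if "x \<noteq> 0" for x y :: "'p mod_ring" using that by (simp add: field_simps)
      from this[OF u] show ?thesis unfolding w_def of_int_to_int_mod_ring .
    qed
    let ?s = "mon (a - a1) (b - b1) (c - c1) :: 'p dst" and ?g = "mon a1 b1 c1 :: 'p dst"
    have e: "of_int w * (of_nat ?u * mon a b c) = (of_int k * mon a b c :: 'p dst)"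
      unfolding symb_inject[symmetric] fun_eq_iff symb_of_int symb_of_nat by (simp only: mult.assoc[symmetric] w) simp
    have n: "a - a1 + (b - b1) + (c - c1) + (a1 + b1 + c1) = i" using 1 i by simp
    have "dord i (?s * ?g - of_nat ?u * mon a b c)"
      using mon_mult_leading[of "a - a1" "b - b1" "c - c1" a1 b1 c1, where 'p = 'p] 1 unfolding n by simp
    then have "dord i (- (of_int w * (?s * ?g - of_nat ?u * mon a b c)))"
      by (intro dord_uminus dord_of_int)
    then have l: "P (- (of_int w * (?s * ?g - of_nat ?u * mon a b c)))" by (rule lower)
    have e': "of_int k * mon a b c = (of_int w * ?s) * ?g + - (of_int w * (?s * ?g - of_nat ?u * mon a b c))"
      unfolding right_diff_distrib e by (simp add: mult.assoc)
    have "dord (Suc (i - q)) (of_int w * ?s)"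
      using 1 i by (intro dord_of_int dord_mon) linarith
    moreover have "dord (Suc q) ?g" using 1 by (intro dord_mon) simp
    ultimately have "P ((of_int w * ?s) * ?g)" by (rule prod)
    then show ?thesis unfolding e' using l by (rule assms(5))
  qed
qed


text \<open>The Newton expansion of g yields a combination of the elements H choose b that acts on
  each weight by the value of g there.\<close>

lemma weight_elt:
  fixes g :: "int \<Rightarrow> 'p::prime_card mod_ring"
  assumes "lowdeg n g"
  shows "\<exists>G :: 'p dst. dord n G \<and> (\<forall>x a c l. symb (G * x) a c l = g (l + 2 * int a - 2 * int c) * symb x a c l)"
proof -
  obtain k where k: "\<And>l. g l = (\<Sum>b<n. k b * bin b l)" using newton_expand[OF assms] by blast
  let ?G = "\<Sum>b<n. of_int (to_int_mod_ring (k b)) * gH b :: 'p dst"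
  have "dord n ?G" by (intro dord_sum dord_of_int) (auto intro: dord_mono[OF dord_gH])
  moreover have "symb (?G * x) a c l = g (l + 2 * int a - 2 * int c) * symb x a c l" for x a c l
    unfolding k sum_distrib_right symb_sum mult.assoc symb_of_int of_int_to_int_mod_ring symb_gH' ..
  ultimately show ?thesis by blast
qed

lemma symb_gF_dT: "symb (gF r * dT :: 'p::prime_card dst) a c l = (if a = 0 \<and> c = r \<and> int CARD('p) dvd l then 1 else 0)"
proof -
  have "symb (gF r * dT :: 'p dst) a c l =
    (\<Sum>k\<le>r. if k = 0 then if a = 0 \<and> c = r \<and> int CARD('p) dvd l then 1 else 0 else 0)"
    unfolding symb_gF' by (intro sum.cong refl) (auto simp: symb_dT)
  then show ?thesis by (simp add: sum.delta)
qed

text \<open>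
  \<open>W a * dT\<close> vanishes unless \<open>p\<close> divides \<open>a\<close>, because \<open>-l\<close> choose \<open>n - a\<close>
  is divisible by \<open>p\<close> for the weights \<open>l\<close> divisible by \<open>p\<close>.
\<close>

lemma com_FE_expand:
  assumes "CARD('p::prime_card) dvd n"
  shows "\<exists>W :: nat \<Rightarrow> 'p dst. com (gF n) (gE n) = (\<Sum>a<n. gE a * W a) \<and> (\<forall>a<n. dord (Suc n) (W a)) \<and>
    (\<forall>a<n. \<not> CARD('p) dvd a \<longrightarrow> W a * dT = 0)"
proof -
  \<comment> \<open>\<open>G a\<close> will be (-2a - H) choose (n - a); on F^[a] 1_l, of weight l -
    2a, it has the value (-l) choose (n - a).\<close>
  have "lowdeg (Suc (n - a)) (\<lambda>l. bin (n - a) (- (2 * int a) - l) :: 'p mod_ring)" for a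
    by (rule lowdeg_reflect[OF lowdeg_bin])
  from weight_elt[OF this] obtain G :: "nat \<Rightarrow> 'p dst" where
    G: "\<And>a. dord (Suc (n - a)) (G a)"
      "\<And>i x a c l. symb (G i * x) a c l = bin (n - i) (- (2 * int i) - (l + 2 * int a - 2 * int c)) * symb x a c l"
    by metis
  define W where "W a = G a * gF a" for a
  have sW: "symb (gE i * W i) a c l = (if a = i \<and> c = i then bin (n - i) (- l) else 0)" for i a c l
    by (auto simp: W_def symb_gE G symb_gF1)
  have "symb (gF n * gE n - gE n * gF n :: 'p dst) a c l = symb (\<Sum>a<n. gE a * W a) a c l" for a c l
  proof -
    have "symb (\<Sum>a<n. gE a * W a) a c l = (\<Sum>i<n. if i = a then if a = c then bin (n - a) (- l) else 0 else 0)"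
      unfolding symb_sum sW by (intro sum.cong refl) auto
    also have "\<dots> = (if a < n \<and> a = c then bin (n - a) (- l) else 0)" by (simp add: sum.delta)
    finally show ?thesis by (auto simp: symb_diff symb_FE symb_EF)
  qed
  then have "symb (gF n * gE n - gE n * gF n :: 'p dst) = symb (\<Sum>a<n. gE a * W a)" unfolding fun_eq_iff by blast
  then have "com (gF n) (gE n) = (\<Sum>a<n. gE a * W a)" unfolding com_def symb_inject .
  moreover have "dord (Suc n) (W a)" if "a < n" for a
    using dord_mult[OF G(1)[of a] dord_gF[of a]] that by (simp add: W_def)
  moreover have "W i * dT = 0" if "i < n" "\<not> CARD('p) dvd i" for i
  proof -
    have "symb (W i * dT) a c l = symb 0 a c l" for a c l
    proof -
      have nd: "\<not> CARD('p) dvd (n - i)"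
        using that assms by (metis dvd_diffD1 less_imp_le_nat)
      have "int CARD('p) dvd l \<Longrightarrow> (bin (n - i) (- l) :: 'p mod_ring) = 0" by (rule bin_p_multI[OF _ nd]) simp
      then show ?thesis by (auto simp: W_def mult.assoc G symb_gF_dT symb_0)
    qed
    then have "symb (W i * dT) = symb 0" unfolding fun_eq_iff by blast
    then show ?thesis unfolding symb_inject .
  qed
  ultimately show ?thesis by blast
qed

text \<open>By \<open>bin_prime_power\<close> the element H choose q acts by the weight divided by
  q, rounded down, and E^[q] and F^[q] change the weight by 2q in absolute value. So the relations
  of H with E and F in sl2 recur in order q.\<close>

lemma com_HE_power: "com (gH (CARD('p) ^ m)) (gE (CARD('p) ^ m)) = (of_int 2 * gE (CARD('p) ^ m) :: 'p::prime_card dst)"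
  and com_HF_power: "com (gH (CARD('p) ^ m)) (gF (CARD('p) ^ m)) = (of_int (- 2) * gF (CARD('p) ^ m) :: 'p dst)"
proof -
  let ?q = "CARD('p) ^ m"
  have q: "int ?q \<noteq> 0" by simp
  have 1: "(bin ?q (l + 2 * int ?q) :: 'p mod_ring) = bin ?q l + 2" for l
    using div_mult_self1[OF q, of l 2] by (simp add: bin_prime_power)
  have 2: "(bin ?q (l - 2 * int ?q) :: 'p mod_ring) = bin ?q l - 2" for l
    using div_mult_self1[OF q, of l "-2"] by (simp add: bin_prime_power)
  have "symb (com (gH ?q) (gE ?q)) a c l = symb (of_int 2 * gE ?q :: 'p dst) a c l" for a c l
    using symb_gE[of ?q "1 :: 'p dst"] unfolding com_def symb_diff symb_HE symb_EH symb_of_int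
    by (auto simp: 1 symb_1 v0_def simp del: of_nat_power)
  then show "com (gH ?q) (gE ?q) = (of_int 2 * gE ?q :: 'p dst)" unfolding symb_inject[symmetric] fun_eq_iff by blast
  have "symb (com (gH ?q) (gF ?q)) a c l = symb (of_int (- 2) * gF ?q :: 'p dst) a c l" for a c l
    unfolding com_def symb_diff symb_HF symb_FH symb_of_int
    by (auto simp: 2 symb_gF1 simp del: of_nat_power)
  then show "com (gH ?q) (gF ?q) = (of_int (- 2) * gF ?q :: 'p dst)" unfolding symb_inject[symmetric] fun_eq_iff by blast
qed

section \<open>Enveloping algebras of higher level\<close>

lemma (in ring) add_minus_cancel: "x \<in> carrier R \<Longrightarrow> y \<in> carrier R \<Longrightarrow> y \<oplus> (x \<ominus> y) = x"
  by (simp add: a_minus_def a_lcomm r_neg)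

lemma Dist_ring: "ring (Dist :: ('p::prime_card mod_ring, dist) module)"
proof -
  let ?D = "Dist :: ('p mod_ring, dist) module"
  have c: "carrier ?D = range (rep_d :: 'p dst \<Rightarrow> dist)"
    using type_definition.Rep_range[OF type_definition_dst] unfolding Dist_carrier_def by (rule sym)
  have ex: "\<exists>y. x + y = 0" for x :: "'p dst" by (rule exI[of _ "- x"]) simp
  show ?thesis
    by (intro ringI abelian_groupI monoidI)
       (auto simp: c ex rep_d_inject add_ac mult.assoc distrib_left distrib_right simp flip: rep_d_simps)
qed

lemma Dist_carrier: "carrier (Dist :: ('p::prime_card mod_ring, dist) module) = range (rep_d :: 'p dst \<Rightarrow> dist)"
  using type_definition.Rep_range[OF type_definition_dst] unfolding Dist_carrier_def by (rule sym)

lemma rep_d_minus: "rep_d x \<ominus>\<^bsub>(Dist :: ('p mod_ring, dist) module)\<^esub> rep_d y = rep_d (x - y :: 'p::prime_card dst)"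
proof -
  let ?D = "Dist :: ('p mod_ring, dist) module"
  interpret D: ring ?D by (rule Dist_ring)
  have "rep_d (- y) \<oplus>\<^bsub>?D\<^esub> rep_d y = \<zero>\<^bsub>?D\<^esub>" by (simp flip: rep_d_simps)
  then have "\<ominus>\<^bsub>?D\<^esub> rep_d y = rep_d (- y)" by (intro D.minus_equality) (auto simp: Dist_carrier)
  then show ?thesis by (simp add: a_minus_def flip: rep_d_simps)
qed

lemma of_int_dst_cong: "(of_int m :: 'p::prime_card mod_ring) = of_int n \<Longrightarrow> of_int m * x = (of_int n * x :: 'p dst)"
  unfolding symb_inject[symmetric] fun_eq_iff symb_of_int by simp

lemma rep_d_finsum: "finite A \<Longrightarrow> (\<Oplus>\<^bsub>(Dist :: ('p mod_ring, dist) module)\<^esub>i\<in>A. rep_d (f i)) = rep_d (\<Sum>i\<in>A. f i :: 'p::prime_card dst)"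
proof (induction A rule: finite_induct)
  case empty
  interpret D: ring "Dist :: ('p mod_ring, dist) module" by (rule Dist_ring)
  show ?case by (simp add: rep_d_simps)
next
  case (insert i A)
  interpret D: ring "Dist :: ('p mod_ring, dist) module" by (rule Dist_ring)
  show ?case using insert by (simp add: D.finsum_insert Dist_carrier rep_d_simps)
qed

text \<open>The filtration spanned by PBW monomials is the one given by degrees of symbols; the
  harder inclusion is the expansion behind \<open>dord_induct\<close>.\<close>

lemma Dist_le_carrier: "carrier (Dist_le n :: ('p::prime_card mod_ring, dist) module) = rep_d ` {x :: 'p dst. dord (Suc n) x}"
proof -
  let ?D = "Dist :: ('p mod_ring, dist) module"
  let ?S = "{(dist_E CARD('p) a \<otimes>\<^bsub>?D\<^esub> dist_H CARD('p) b) \<otimes>\<^bsub>?D\<^esub> dist_F CARD('p) c | a b c. a + b + c \<le> n}"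
  have S: "?S = rep_d ` {mon a b c :: 'p dst | a b c. a + b + c \<le> n}"
    by (auto simp: dist_gens[where 'p = 'p] mon_def simp flip: rep_d_simps)
  have "lin_span ?D ?S \<subseteq> rep_d ` {x :: 'p dst. dord (Suc n) x}"
  proof
    fix u assume "u \<in> lin_span ?D ?S"
    then show "u \<in> rep_d ` {x :: 'p dst. dord (Suc n) x}"
    proof induction
      case zero show ?case by (auto simp: dord_0 simp flip: rep_d_simps)
    next
      case (base x) then show ?case unfolding S by (auto intro!: imageI dord_mon)
    next
      case (add x y) then show ?case by (auto intro!: imageI dord_add simp flip: rep_d_simps)
    next
      case (smult x c) then show ?case by (auto intro!: imageI dord_of_int simp: rep_d_simps(5))
    qed
  qed
  moreover have "rep_d x \<in> lin_span ?D ?S" if "dord (Suc n) x" for x :: "'p dst"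
    using that
  proof (induction x rule: dord_induct)
    case zero show ?case unfolding rep_d_simps by (rule lin_span.zero)
  next
    case (add x y) then show ?case unfolding rep_d_simps by (intro lin_span.add)
  next
    case (mon a b c k)
    have "rep_d (of_int k * mon a b c :: 'p dst) = of_int k \<odot>\<^bsub>?D\<^esub> rep_d (mon a b c :: 'p dst)"
      unfolding rep_d_simps(5) by (intro arg_cong[of _ _ rep_d] of_int_dst_cong) (simp add: of_int_to_int_mod_ring)
    moreover have "rep_d (mon a b c :: 'p dst) \<in> lin_span ?D ?S"
      by (intro lin_span.base) (unfold S, use mon in \<open>fastforce\<close>)
    ultimately show ?case by (simp add: lin_span.smult)
  qed
  ultimately show ?thesis unfolding Dist_le_def Let_def by auto
qed

lemma Dist_le_sel: "monoid.mult (Dist_le n :: ('p::prime_card mod_ring, dist) module) = monoid.mult (dist_alg TYPE('p))"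
  "add (Dist_le n :: ('p mod_ring, dist) module) = add (dist_alg TYPE('p))" "module.smult (Dist_le n :: ('p mod_ring, dist) module) = module.smult Dist"
  by (simp_all add: Dist_le_def Let_def)

lemma q_pos: "CARD('p::prime_card) ^ m > 0" by simp

lemma level_space_carrier: "carrier (level_space m :: ('p::prime_card mod_ring, dist) module) = rep_d ` {x :: 'p dst. dord (2 * CARD('p) ^ m) x}"
proof -
  have "Suc (2 * CARD('p) ^ m - 1) = 2 * CARD('p) ^ m" using q_pos[of m, where 'p = 'p] by (simp add: Suc_diff_1)
  then show ?thesis unfolding level_space_def Dist_le_carrier by simp
qed

lemma level_space_sel: "add (level_space m :: ('p::prime_card mod_ring, dist) module) = add (dist_alg TYPE('p))"
  "module.smult (level_space m :: ('p mod_ring, dist) module) = module.smult Dist"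
  by (simp_all add: level_space_def Dist_le_sel)

interpretation level: tensor_space "level_space m :: ('p::prime_card mod_ring, dist) module" for m
proof unfold_locales
  fix v w and c :: "'p mod_ring"
  assume "v \<in> carrier (level_space m :: ('p mod_ring, dist) module)"
  then obtain x :: "'p dst" where x: "v = rep_d x" "dord (2 * CARD('p) ^ m) x" by (auto simp: level_space_carrier)
  show "c \<odot>\<^bsub>level_space m\<^esub> v \<in> carrier (level_space m :: ('p mod_ring, dist) module)"
    using x by (auto simp: level_space_carrier level_space_sel rep_d_simps(5) intro!: imageI dord_of_int)
  assume "w \<in> carrier (level_space m :: ('p mod_ring, dist) module)"
  then obtain y :: "'p dst" where y: "w = rep_d y" "dord (2 * CARD('p) ^ m) y" by (auto simp: level_space_carrier)
  show "v \<oplus>\<^bsub>level_space m :: ('p mod_ring, dist) module\<^esub> w \<in> carrier (level_space m :: ('p mod_ring, dist) module)"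
    using x y by (auto simp: level_space_carrier level_space_sel intro!: imageI dord_add simp flip: rep_d_simps)
qed

definition level_rels :: "nat \<Rightarrow> ('p::prime_card mod_ring, dist) tensor set" where
  "level_rels m =
    (let T = tensor_algebra (level_space m); \<iota> = (\<lambda>x :: 'p dst. tensor_incl (level_space m) (rep_d x))
     in {c \<odot>\<^bsub>T\<^esub> \<one>\<^bsub>T\<^esub> \<ominus>\<^bsub>T\<^esub> \<iota> (of_int (to_int_mod_ring c)) | c. True} \<union>
        {(\<iota> x \<otimes>\<^bsub>T\<^esub> \<iota> y \<ominus>\<^bsub>T\<^esub> \<iota> y \<otimes>\<^bsub>T\<^esub> \<iota> x) \<ominus>\<^bsub>T\<^esub> \<iota> (com x y) | x y.
            dord (Suc (CARD('p) ^ m)) x \<and> dord (Suc (CARD('p) ^ m)) y} \<union>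
        {\<iota> z \<otimes>\<^bsub>T\<^esub> \<iota> x \<ominus>\<^bsub>T\<^esub> \<iota> (z * x) | z x. dord (CARD('p) ^ m) z \<and> dord (Suc (CARD('p) ^ m)) x})"

lemma level_ideal_eq: "(level_ideal m :: 'p::prime_card ulevel) = Idl\<^bsub>tensor_algebra (level_space m)\<^esub> (level_rels m)"
proof -
  let ?D = "Dist :: ('p mod_ring, dist) module"
  have one: "c \<odot>\<^bsub>?D\<^esub> \<one>\<^bsub>?D\<^esub> = rep_d (of_int (to_int_mod_ring c) :: 'p dst)" for c
    unfolding rep_d_simps(4)[symmetric, where 'p = 'p] rep_d_simps(5) by simp
  have c: "rep_d (x * y) \<ominus>\<^bsub>?D\<^esub> rep_d (y * x) = rep_d (com x y)" for x y :: "'p dst"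
    by (simp add: com_def rep_d_minus)
  have q: "Suc (CARD('p) ^ m - 1) = CARD('p) ^ m" by simp
  have m: "rep_d x \<otimes>\<^bsub>?D\<^esub> rep_d y = rep_d (x * y)" for x y :: "'p dst" by (simp add: rep_d_simps)
  have *: "{f u v | u v. u \<in> rep_d ` {x. P x} \<and> v \<in> rep_d ` {x. Q x}} = {f (rep_d x) (rep_d y) | x y. P x \<and> Q y}"
    for f :: "dist \<Rightarrow> dist \<Rightarrow> 'z" and P Q :: "'p dst \<Rightarrow> bool" by blast
  show ?thesis
    unfolding level_ideal_def level_rels_def Let_def Dist_le_carrier one * m c q ..
qed

lemma com_level: "dord (Suc (CARD('p) ^ m)) x \<Longrightarrow> dord (Suc (CARD('p) ^ m)) y \<Longrightarrow> dord (2 * CARD('p) ^ m) (com x y :: 'p::prime_card dst)"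
  using dord_com[of "CARD('p) ^ m" y "CARD('p) ^ m" x] by (simp add: mult_2)

lemma small_mult_level: "dord (CARD('p) ^ m) x \<Longrightarrow> dord (Suc (CARD('p) ^ m)) y \<Longrightarrow> dord (2 * CARD('p) ^ m) (x * y :: 'p::prime_card dst)"
  using dord_mult[of "CARD('p) ^ m" x "CARD('p) ^ m" y] by (simp add: mult_2)

lemma gens_level: "dord (Suc (CARD('p) ^ m)) x \<Longrightarrow> dord (2 * CARD('p) ^ m) (x :: 'p::prime_card dst)"
  using q_pos[of m, where 'p = 'p] by (elim dord_mono) linarith

lemma level_incl_closed: "dord (2 * CARD('p) ^ m) x \<Longrightarrow>
    tensor_incl (level_space m) (rep_d (x :: 'p::prime_card dst)) \<in> carrier (tensor_algebra (level_space m :: ('p mod_ring, dist) module))"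
  by (intro level.tensor_incl_closed) (auto simp: level_space_carrier)

lemma dord_of_int1: "dord (2 * CARD('p) ^ m) (of_int k :: 'p::prime_card dst)"
  using dord_of_int[OF dord_1, of k] q_pos[of m, where 'p = 'p] by (auto elim!: dord_mono)

interpretation level: presented "level_space m :: ('p::prime_card mod_ring, dist) module" "level_rels m" for m
proof unfold_locales
  let ?V = "level_space m :: ('p mod_ring, dist) module"
  interpret T: kalg "tensor_algebra ?V" by (rule level.tensor_kalg)
  have small: "dord (CARD('p) ^ m) x \<Longrightarrow> dord (2 * CARD('p) ^ m) x" for x :: "'p dst" by (elim dord_mono) simp
  show "level_rels m \<subseteq> carrier (tensor_algebra ?V)"
    unfolding level_rels_def Let_def
    by (auto intro!: T.minus_closed T.m_closed T.smult_closed level_incl_closed dord_of_int1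
        intro: small com_level small_mult_level gens_level)
qed

lemma level_ideal_pres: "(level_ideal m :: 'p::prime_card ulevel) = level.pres_ideal m"
  unfolding level.pres_ideal_def level_ideal_eq ..

lemma U_level_eq: "(U_level m :: ('p::prime_card mod_ring, 'p ulevel) module) = level.pres_algebra m"
  unfolding U_level_def level.pres_algebra_def level_ideal_pres ..

section \<open>Classes of distributions and the universal property of the algebra of level m\<close>

definition lc :: "nat \<Rightarrow> 'p::prime_card dst \<Rightarrow> 'p ulevel" where "lc m x = level_class m (rep_d x)"

lemma lc_eq: "lc m (x :: 'p::prime_card dst) = level.pres_incl m (rep_d x)"
  unfolding lc_def level_class_def level.pres_incl_def level_ideal_pres ..

lemma U_level_kalg: "kalg (U_level m :: ('p::prime_card mod_ring, 'p ulevel) module)"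
  unfolding U_level_eq by (rule level.pres_kalg)

context
  fixes m :: nat and U :: "('p::prime_card mod_ring, 'p ulevel) module" and q :: nat
  defines "U \<equiv> U_level m" and "q \<equiv> CARD('p) ^ m"
begin

lemma lc_closed: "dord (2 * q) x \<Longrightarrow> lc m x \<in> carrier U"
  unfolding U_def U_level_eq lc_eq q_def by (intro level.pres_incl_closed) (auto simp: level_space_carrier)

lemma lc_add: "dord (2 * q) x \<Longrightarrow> dord (2 * q) y \<Longrightarrow> lc m (x + y) = lc m x \<oplus>\<^bsub>U\<^esub> lc m y"
  using level.pres_incl_add[of "rep_d x" m "rep_d y", where 'p = 'p]
  by (simp add: U_def U_level_eq lc_eq q_def level_space_carrier level_space_sel rep_d_simps)

lemma lc_smult: "dord (2 * q) x \<Longrightarrow> c \<odot>\<^bsub>U\<^esub> lc m x = lc m (of_int (to_int_mod_ring c) * x)"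
  using level.pres_incl_smult[of "rep_d x" m c]
  by (simp add: U_def U_level_eq lc_eq q_def level_space_carrier level_space_sel rep_d_simps(5))

lemmas proj_minus = alg_hom_minus[OF level.tensor_kalg level.pres_kalg level.pres_proj_nonunital]

lemma lc_one: "lc m 1 = \<one>\<^bsub>U\<^esub>"
proof -
  interpret U: kalg U unfolding U_def by (rule U_level_kalg)
  let ?T = "tensor_algebra (level_space m :: ('p mod_ring, dist) module)"
  interpret T: kalg ?T by (rule level.tensor_kalg)
  let ?s = "1 \<odot>\<^bsub>?T\<^esub> \<one>\<^bsub>?T\<^esub> \<ominus>\<^bsub>?T\<^esub> tensor_incl (level_space m) (rep_d (of_int (to_int_mod_ring (1 :: 'p mod_ring)) :: 'p dst))"
  have "?s \<in> level_rels m" unfolding level_rels_def Let_def by blast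
  note z = level.pres_rel[OF this]
  have i1: "of_int (to_int_mod_ring (1 :: 'p mod_ring)) = (1 :: 'p dst)"
    using of_int_dst_cong[of "to_int_mod_ring (1 :: 'p mod_ring)" 1 "1 :: 'p dst"] by (simp add: of_int_to_int_mod_ring)
  have o: "level.pres_ideal m +>\<^bsub>?T\<^esub> \<one>\<^bsub>?T\<^esub> = \<one>\<^bsub>level.pres_algebra m\<^esub>" by (rule alg_hom_one[OF level.pres_proj])
  have "\<one>\<^bsub>U\<^esub> \<ominus>\<^bsub>U\<^esub> lc m 1 = \<zero>\<^bsub>U\<^esub>"
    using z dord_of_int1[of m 1, where 'p = 'p] level_incl_closed[of m "1 :: 'p dst"] o
    by (simp add: proj_minus T.smult_one i1 U_def U_level_eq lc_eq level.pres_incl_def)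
  then show ?thesis using lc_closed[of 1] dord_of_int1[of m 1, where 'p = 'p] by (simp add: q_def)
qed

lemma lc_small_mult:
  assumes "dord q z" "dord (Suc q) x"
  shows "lc m z \<otimes>\<^bsub>U\<^esub> lc m x = lc m (z * x)"
proof -
  interpret U: kalg U unfolding U_def by (rule U_level_kalg)
  let ?T = "tensor_algebra (level_space m :: ('p mod_ring, dist) module)"
  interpret T: kalg ?T by (rule level.tensor_kalg)
  let ?i = "\<lambda>x :: 'p dst. tensor_incl (level_space m) (rep_d x)"
  have d: "dord (2 * q) z" "dord (2 * q) x" "dord (2 * q) (z * x)"
    using assms small_mult_level gens_level by (auto simp: q_def elim: dord_mono)
  have c: "?i z \<in> carrier ?T" "?i x \<in> carrier ?T" "?i (z * x) \<in> carrier ?T"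
    using d level_incl_closed unfolding q_def by blast+
  have "?i z \<otimes>\<^bsub>?T\<^esub> ?i x \<ominus>\<^bsub>?T\<^esub> ?i (z * x) \<in> level_rels m"
    unfolding level_rels_def Let_def using assms q_def by blast
  from level.pres_rel[OF this] have "lc m z \<otimes>\<^bsub>U\<^esub> lc m x \<ominus>\<^bsub>U\<^esub> lc m (z * x) = \<zero>\<^bsub>U\<^esub>"
    using c by (simp add: proj_minus level.pres_projD U_def U_level_eq lc_eq level.pres_incl_def)
  then show ?thesis using d by (simp add: lc_closed)
qed

lemma lc_com:
  assumes "dord (Suc q) x" "dord (Suc q) y"
  shows "lc m x \<otimes>\<^bsub>U\<^esub> lc m y = lc m y \<otimes>\<^bsub>U\<^esub> lc m x \<oplus>\<^bsub>U\<^esub> lc m (com x y)"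
proof -
  interpret U: kalg U unfolding U_def by (rule U_level_kalg)
  let ?T = "tensor_algebra (level_space m :: ('p mod_ring, dist) module)"
  interpret T: kalg ?T by (rule level.tensor_kalg)
  let ?i = "\<lambda>x :: 'p dst. tensor_incl (level_space m) (rep_d x)"
  have d: "dord (2 * q) x" "dord (2 * q) y" "dord (2 * q) (com x y)"
    using assms com_level gens_level by (auto simp: q_def)
  have c: "?i x \<in> carrier ?T" "?i y \<in> carrier ?T" "?i (com x y) \<in> carrier ?T"
    using d level_incl_closed unfolding q_def by blast+
  have "(?i x \<otimes>\<^bsub>?T\<^esub> ?i y \<ominus>\<^bsub>?T\<^esub> ?i y \<otimes>\<^bsub>?T\<^esub> ?i x) \<ominus>\<^bsub>?T\<^esub> ?i (com x y) \<in> level_rels m"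
    unfolding level_rels_def Let_def using assms q_def by blast
  from level.pres_rel[OF this] have
    "(lc m x \<otimes>\<^bsub>U\<^esub> lc m y \<ominus>\<^bsub>U\<^esub> lc m y \<otimes>\<^bsub>U\<^esub> lc m x) \<ominus>\<^bsub>U\<^esub> lc m (com x y) = \<zero>\<^bsub>U\<^esub>"
    using c by (simp add: proj_minus level.pres_projD U_def U_level_eq lc_eq level.pres_incl_def)
  then have e: "lc m x \<otimes>\<^bsub>U\<^esub> lc m y \<ominus>\<^bsub>U\<^esub> lc m y \<otimes>\<^bsub>U\<^esub> lc m x = lc m (com x y)" using d by (simp add: lc_closed)
  show ?thesis unfolding e[symmetric]
    using d by (simp add: lc_closed U.add_minus_cancel)
qed

text \<open>The relators become equations between values of f; those for the scalars follow from
  \<open>smult\<close> and \<open>one\<close>.\<close>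

lemma lc_lift:
  fixes B :: "('p mod_ring, 'b) module"
  assumes B: "kalg B"
    and cl: "\<And>x. dord (2 * q) x \<Longrightarrow> f x \<in> carrier B"
    and add: "\<And>x y. dord (2 * q) x \<Longrightarrow> dord (2 * q) y \<Longrightarrow> f (x + y) = f x \<oplus>\<^bsub>B\<^esub> f y"
    and smult: "\<And>x c. dord (2 * q) x \<Longrightarrow> f (of_int (to_int_mod_ring c) * x) = c \<odot>\<^bsub>B\<^esub> f x"
    and one: "f 1 = \<one>\<^bsub>B\<^esub>"
    and mult: "\<And>z x. dord q z \<Longrightarrow> dord (Suc q) x \<Longrightarrow> f z \<otimes>\<^bsub>B\<^esub> f x = f (z * x)"
    and com: "\<And>x y. dord (Suc q) x \<Longrightarrow> dord (Suc q) y \<Longrightarrow> f x \<otimes>\<^bsub>B\<^esub> f y = f y \<otimes>\<^bsub>B\<^esub> f x \<oplus>\<^bsub>B\<^esub> f (com x y)"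
  shows "\<exists>g \<in> alg_hom U B. \<forall>x. dord (2 * q) x \<longrightarrow> g (lc m x) = f x"
proof -
  let ?V = "level_space m :: ('p mod_ring, dist) module" and ?T = "tensor_algebra (level_space m :: ('p mod_ring, dist) module)"
  interpret B: kalg B by fact
  interpret T: kalg ?T by (rule level.tensor_kalg)
  let ?f = "\<lambda>v. f (abs_d v :: 'p dst)"
  have car: "\<exists>x :: 'p dst. v = rep_d x \<and> dord (2 * q) x" if "v \<in> carrier ?V" for v
    using that by (auto simp: level_space_carrier q_def)
  have "\<exists>g \<in> alg_hom (level.pres_algebra m) B. \<forall>v\<in>carrier ?V. g (level.pres_incl m v) = ?f v"
  proof (rule level.pres_lift[OF B])
    fix v w and c :: "'p mod_ring" assume v: "v \<in> carrier ?V"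
    then obtain x :: "'p dst" where x: "v = rep_d x" "dord (2 * q) x" using car by blast
    show "?f v \<in> carrier B" using x cl by (simp add: rep_d_inverse)
    show "?f (c \<odot>\<^bsub>?V\<^esub> v) = c \<odot>\<^bsub>B\<^esub> ?f v" using x smult by (simp add: level_space_sel rep_d_simps(5) rep_d_inverse)
    assume "w \<in> carrier ?V"
    then obtain y :: "'p dst" where y: "w = rep_d y" "dord (2 * q) y" using car by blast
    show "?f (v \<oplus>\<^bsub>?V\<^esub> w) = ?f v \<oplus>\<^bsub>B\<^esub> ?f w"
      using x y add by (simp add: level_space_sel rep_d_inverse flip: rep_d_simps(1))
  next
    fix g s assume g: "g \<in> alg_hom ?T B" and gf: "\<And>v. v \<in> carrier ?V \<Longrightarrow> g (tensor_incl ?V v) = ?f v" and s: "s \<in> (level_rels m :: ('p mod_ring, dist) tensor set)"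
    let ?i = "\<lambda>x :: 'p dst. tensor_incl ?V (rep_d x)"
    have gi: "g (?i x) = f x" if "dord (2 * q) x" for x
      using gf[of "rep_d x"] that by (simp add: level_space_carrier q_def rep_d_inverse)
    have ic: "?i x \<in> carrier ?T" if "dord (2 * q) x" for x using that level_incl_closed unfolding q_def by blast
    note g' = alg_hom_nonunital[OF g]
    note gm = alg_hom_minus[OF level.tensor_kalg B g'] alg_homD[OF g']
    have lv: "dord (2 * q) x" if "dord (Suc q) x" for x :: "'p dst" using that gens_level by (simp add: q_def)
    have sm: "dord (Suc q) x" if "dord q x" for x :: "'p dst" using that by (elim dord_mono) simp
    from s consider c where "s = c \<odot>\<^bsub>?T\<^esub> \<one>\<^bsub>?T\<^esub> \<ominus>\<^bsub>?T\<^esub> ?i (of_int (to_int_mod_ring c))"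
      | x y where "dord (Suc q) x" "dord (Suc q) y" "s = (?i x \<otimes>\<^bsub>?T\<^esub> ?i y \<ominus>\<^bsub>?T\<^esub> ?i y \<otimes>\<^bsub>?T\<^esub> ?i x) \<ominus>\<^bsub>?T\<^esub> ?i (com x y)"
      | z x where "dord q z" "dord (Suc q) x" "s = ?i z \<otimes>\<^bsub>?T\<^esub> ?i x \<ominus>\<^bsub>?T\<^esub> ?i (z * x)"
      unfolding level_rels_def Let_def q_def by blast
    then show "g s = \<zero>\<^bsub>B\<^esub>"
    proof cases
      case 1
      have d: "dord (2 * q) (of_int k :: 'p dst)" for k using dord_of_int1 by (simp add: q_def)
      have "f (of_int (to_int_mod_ring c)) = c \<odot>\<^bsub>B\<^esub> \<one>\<^bsub>B\<^esub>" using smult[of 1 c] d[of 1] one by simp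
      then show ?thesis using 1 d by (simp add: gm ic gi alg_hom_one[OF g])
    next
      case 2
      have "dord (2 * q) (com x y)" using 2 com_level by (simp add: q_def)
      then show ?thesis using 2 cl[OF lv[OF 2(1)]] cl[OF lv[OF 2(2)]] cl[of "com x y"]
        by (simp add: gm ic gi lv) (simp add: com[OF 2(1,2)] a_minus_def B.a_ac B.r_neg B.r_neg1 B.r_neg2)
    next
      case 3
      have "dord (2 * q) (z * x)" using 3 small_mult_level by (simp add: q_def)
      then show ?thesis using 3 cl[of "z * x"]
        by (simp add: gm ic gi lv sm mult)
    qed
  qed
  then obtain g where g: "g \<in> alg_hom (level.pres_algebra m) B" "\<forall>v\<in>carrier ?V. g (level.pres_incl m v) = ?f v" by blast
  then have "g (lc m x) = f x" if "dord (2 * q) x" for x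
    using that by (auto simp: lc_eq level_space_carrier q_def rep_d_inverse)
  then show ?thesis using g(1) by (auto simp: U_def U_level_eq)
qed

lemma lc_induct [consumes 1, case_names one lc add smult mult]:
  assumes "u \<in> carrier U" "P \<one>\<^bsub>U\<^esub>" "\<And>x. dord (2 * q) x \<Longrightarrow> P (lc m x)"
    and "\<And>x y. x \<in> carrier U \<Longrightarrow> y \<in> carrier U \<Longrightarrow> P x \<Longrightarrow> P y \<Longrightarrow> P (x \<oplus>\<^bsub>U\<^esub> y)"
    and "\<And>x c. x \<in> carrier U \<Longrightarrow> P x \<Longrightarrow> P (c \<odot>\<^bsub>U\<^esub> x)"
    and "\<And>x y. x \<in> carrier U \<Longrightarrow> y \<in> carrier U \<Longrightarrow> P x \<Longrightarrow> P y \<Longrightarrow> P (x \<otimes>\<^bsub>U\<^esub> y)"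
  shows "P u"
  using assms(1) unfolding U_def U_level_eq
proof (induction u rule: level.pres_induct)
  case (gen v)
  then obtain x :: "'p dst" where "v = rep_d x" "dord (2 * q) x" by (auto simp: level_space_carrier q_def)
  then show ?case using assms(3) by (simp add: lc_eq)
qed (use assms(2,4-) in \<open>auto simp: U_def U_level_eq\<close>)

end


text \<open>
  The relations of the enveloping algebra of level \<open>m\<close> for the commutators follow from those for
  the products with distributions of order less than \<open>p\<^sup>m\<close>, which determine all products of total
  order less than \<open>2p\<^sup>m\<close>, and from the commutators of the three elements of order \<open>p\<^sup>m\<close>.
\<close>

locale level_map = ring R for R :: "('b, 'z) ring_scheme" (structure) +
  fixes m :: nat and q :: nat and f :: "'p::prime_card dst \<Rightarrow> 'b"
  defines "q \<equiv> CARD('p) ^ m"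
  assumes f_closed: "dord (2 * q) x \<Longrightarrow> f x \<in> carrier R"
    and f_add: "dord (2 * q) x \<Longrightarrow> dord (2 * q) y \<Longrightarrow> f (x + y) = f x \<oplus> f y"
    and f_left: "dord q s \<Longrightarrow> dord (Suc q) g \<Longrightarrow> f s \<otimes> f g = f (s * g)"
    and f_right: "dord q s \<Longrightarrow> dord (Suc q) g \<Longrightarrow> f g \<otimes> f s = f (g * s)"
begin

lemma q_gt_0: "q > 0" by (simp add: q_def)

lemma f_closed': "dord n x \<Longrightarrow> n \<le> 2 * q \<Longrightarrow> f x \<in> carrier R"
  by (rule f_closed) (rule dord_mono)

lemma f_0: "f 0 = \<zero>"
  using f_add[OF dord_0 dord_0] f_closed[OF dord_0] by (metis add.r_cancel_one' add_0)

lemma f_minus: "dord (2 * q) x \<Longrightarrow> f (- x) = \<ominus> f x"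
  using f_add[OF dord_uminus, of x x] f_closed[of x] f_closed[OF dord_uminus, of x]
  by (simp add: f_0 minus_equality)

text \<open>Induction on the total order. A factor of order above q is cut by
  \<open>dord_split\<close> into s g with g of order at most q, and s is absorbed by the small
  factor through \<open>f_left\<close>. When the large factor is on the left, g stands between s and
  y and is first commuted past y.\<close>

lemma f_mult:
  assumes "dord (Suc i) x" "dord (Suc j) y" "i + j < 2 * q"
  shows "f x \<otimes> f y = f (x * y)"
  using assms
proof (induction "i + j" arbitrary: i j x y rule: less_induct)
  case less
  note x = less.prems(1) and y = less.prems(2) and ij = less.prems(3)
  have xy: "dord (Suc i + j) (x * y)" using x y by (rule dord_mult)
  show ?case
  proof (cases "i < q")
    case i: True
    then have xs: "dord q x" using x by (elim dord_mono) simp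
    show ?thesis
    proof (cases "j \<le> q")
      case True
      then show ?thesis using y by (intro f_left[OF xs]) (auto elim: dord_mono)
    next
      case False
      have "dord (Suc j) y \<and> f x \<otimes> f y = f (x * y)"
        using y
      proof (rule dord_split[where m = m and 'p = 'p])
        show "CARD('p) ^ m \<le> j" "j < 2 * CARD('p) ^ m" using False ij by (auto simp: q_def)
      next
        fix y z assume *: "dord (Suc j) y \<and> f x \<otimes> f y = f (x * y)" "dord (Suc j) z \<and> f x \<otimes> f z = f (x * z)"
        have c: "f x \<in> carrier R" "f y \<in> carrier R" "f z \<in> carrier R"
          using f_closed'[OF x] f_closed'[of "Suc j" y] f_closed'[of "Suc j" z] * ij by auto
        have "dord (2 * q) y" "dord (2 * q) z" using * ij by (auto elim!: dord_mono)
        moreover have "dord (2 * q) (x * y)" "dord (2 * q) (x * z)"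
          using dord_mult[OF x, of j y] dord_mult[OF x, of j z] * ij by (auto elim!: dord_mono)
        ultimately show "dord (Suc j) (y + z) \<and> f x \<otimes> f (y + z) = f (x * (y + z))"
          using * c by (simp add: dord_add distrib_left f_add r_distr)
      next
        fix s g :: "'p dst" assume s: "dord (Suc (j - CARD('p) ^ m)) s" and "dord (Suc (CARD('p) ^ m)) g"
        then have s: "dord (Suc (j - q)) s" and g: "dord (Suc q) g" by (simp_all add: q_def)
        have sq: "dord q s" using s by (rule dord_mono) (use ij False in simp)
        have xsq: "dord q (x * s)" using dord_mult[OF x s] by (rule dord_mono) (use ij False in simp)
        have c: "f x \<in> carrier R" "f s \<in> carrier R" "f g \<in> carrier R"
          using xs sq g q_gt_0 by (auto intro: f_closed'[of q] f_closed'[of "Suc q"])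
        have "f x \<otimes> f (s * g) = f x \<otimes> (f s \<otimes> f g)" by (simp add: f_left[OF sq g])
        also have "\<dots> = f (x * s) \<otimes> f g"
          using c f_left[OF xs dord_mono[OF sq, of "Suc q"]] by (simp flip: m_assoc)
        also have "\<dots> = f (x * (s * g))" using f_left[OF xsq g] by (simp add: mult.assoc)
        finally have "f x \<otimes> f (s * g) = f (x * (s * g))" .
        moreover have "dord (Suc j) (s * g)" using dord_mult[OF s g] False by (auto elim!: dord_mono)
        ultimately show "dord (Suc j) (s * g) \<and> f x \<otimes> f (s * g) = f (x * (s * g))" by blast
      next
        fix z :: "'p dst" assume z: "dord j z"
        then have "dord (Suc (j - 1)) z" using False by (cases j) auto
        then have "f x \<otimes> f z = f (x * z)" using False ij x by (intro less.hyps[of i "j - 1"]) auto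
        then show "dord (Suc j) z \<and> f x \<otimes> f z = f (x * z)" using z by (auto elim: dord_mono)
      qed
      then show ?thesis by blast
    qed
  next
    case i: False
    then have j: "j < q" using ij by simp
    then have ys: "dord q y" using y by (elim dord_mono) simp
    show ?thesis
    proof (cases "i \<le> q")
      case True
      then show ?thesis using x by (intro f_right[OF ys]) (auto elim: dord_mono)
    next
      case False
      have "dord (Suc i) x \<and> f x \<otimes> f y = f (x * y)"
        using x
      proof (rule dord_split[where m = m and 'p = 'p])
        show "CARD('p) ^ m \<le> i" "i < 2 * CARD('p) ^ m" using False ij by (auto simp: q_def)
      next
        fix x z assume *: "dord (Suc i) x \<and> f x \<otimes> f y = f (x * y)" "dord (Suc i) z \<and> f z \<otimes> f y = f (z * y)"
        have c: "f x \<in> carrier R" "f y \<in> carrier R" "f z \<in> carrier R"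
          using f_closed'[OF y] f_closed'[of "Suc i" x] f_closed'[of "Suc i" z] * ij by auto
        have "dord (2 * q) x" "dord (2 * q) z" using * ij by (auto elim!: dord_mono)
        moreover have "dord (2 * q) (x * y)" "dord (2 * q) (z * y)"
          using dord_mult[OF _ y, of "Suc i" x] dord_mult[OF _ y, of "Suc i" z] * ij by (auto elim!: dord_mono)
        ultimately show "dord (Suc i) (x + z) \<and> f (x + z) \<otimes> f y = f ((x + z) * y)"
          using * c by (simp add: dord_add distrib_right f_add l_distr)
      next
        fix s g :: "'p dst" assume s: "dord (Suc (i - CARD('p) ^ m)) s" and "dord (Suc (CARD('p) ^ m)) g"
        then have s: "dord (Suc (i - q)) s" and g: "dord (Suc q) g" by (simp_all add: q_def)
        have sq: "dord q s" using s by (rule dord_mono) (use ij False in simp)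
        have syq: "dord q (s * y)" using dord_mult[OF s y] by (rule dord_mono) (use ij False in simp)
        have cgy: "dord (q + j) (com g y)" by (rule dord_com[OF y g])
        have cgy': "dord (Suc (q + j - 1)) (com g y)" using cgy q_gt_0 by simp
        have gy: "dord (2 * q) (g * y)" "dord (2 * q) (y * g)" "dord (2 * q) (com g y)"
          using dord_mult[OF g y] dord_mult[OF y g] cgy j by (auto elim!: dord_mono)
        have c: "f y \<in> carrier R" "f s \<in> carrier R" "f g \<in> carrier R" "f (com g y) \<in> carrier R" "f (y * g) \<in> carrier R"
          using ys sq g gy q_gt_0 by (auto intro: f_closed'[of q] f_closed'[of "Suc q"] f_closed)
        have d: "dord (2 * q) (s * y * g)" using dord_mult[OF syq g] by (rule dord_mono) simp
        have d': "dord (2 * q) (s * com g y)" using dord_mult'[OF s cgy] by (rule dord_mono) (use ij False in simp)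
        have "f (s * g) \<otimes> f y = f s \<otimes> (f g \<otimes> f y)" using c by (simp add: m_assoc flip: f_left[OF sq g])
        also have "f g \<otimes> f y = f (y * g + com g y)" by (simp add: f_right[OF ys g] com_def)
        also have "\<dots> = f y \<otimes> f g \<oplus> f (com g y)" using gy by (simp add: f_add f_left[OF ys g])
        also have "f s \<otimes> \<dots> = f s \<otimes> f y \<otimes> f g \<oplus> f s \<otimes> f (com g y)" using c by (simp add: r_distr m_assoc)
        also have "f s \<otimes> f y = f (s * y)" by (intro f_left[OF sq] dord_mono[OF ys]) simp
        also have "f (s * y) \<otimes> f g = f (s * y * g)" by (rule f_left[OF syq g])
        \<comment> \<open>A commutator loses one order, so the total order is now i + j - 1 and the
          induction hypothesis applies.\<close>
        also have "f s \<otimes> f (com g y) = f (s * com g y)"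
          using s cgy' ij False q_gt_0 by (intro less.hyps[of "i - q" "q + j - 1"]) auto
        also have "f (s * y * g) \<oplus> f (s * com g y) = f (s * y * g + s * com g y)" using d d' by (simp add: f_add)
        also have "s * y * g + s * com g y = s * g * y" by (simp add: com_def algebra_simps)
        finally have "f (s * g) \<otimes> f y = f (s * g * y)" .
        moreover have "dord (Suc i) (s * g)" using dord_mult[OF s g] False by (auto elim!: dord_mono)
        ultimately show "dord (Suc i) (s * g) \<and> f (s * g) \<otimes> f y = f (s * g * y)" by blast
      next
        fix z :: "'p dst" assume z: "dord i z"
        then have "dord (Suc (i - 1)) z" using False by (cases i) auto
        then have "f z \<otimes> f y = f (z * y)" using False ij y by (intro less.hyps[of "i - 1" j]) auto
        then show "dord (Suc i) z \<and> f z \<otimes> f y = f (z * y)" using z by (auto elim: dord_mono)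
      qed
      then show ?thesis by blast
    qed
  qed
qed

definition crel :: "'p dst \<Rightarrow> 'p dst \<Rightarrow> bool" where
  "crel x y \<longleftrightarrow> f x \<otimes> f y = f y \<otimes> f x \<oplus> f (com x y)"

lemma d_gens: "dord (Suc q) x \<Longrightarrow> dord (2 * q) x" using q_gt_0 by (elim dord_mono) simp

lemma d_com: "dord (Suc q) x \<Longrightarrow> dord (Suc q) y \<Longrightarrow> dord (2 * q) (com x y)"
  using dord_com[of q y q x] by (simp add: mult_2)

lemma crel_sym: "dord (Suc q) x \<Longrightarrow> dord (Suc q) y \<Longrightarrow> crel x y \<Longrightarrow> crel y x"
proof -
  assume d: "dord (Suc q) x" "dord (Suc q) y" and "crel x y"
  have c: "f x \<in> carrier R" "f y \<in> carrier R" "f (com x y) \<in> carrier R" using d d_gens d_com f_closed by auto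
  have "f (com y x) = \<ominus> f (com x y)" using f_minus[OF d_com[OF d]] com_swap[of y x] by simp
  then show ?thesis using \<open>crel x y\<close> c unfolding crel_def by (simp add: a_assoc r_neg)
qed

lemma crel_small: "dord q x \<Longrightarrow> dord (Suc q) y \<Longrightarrow> crel x y"
proof -
  assume d: "dord q x" "dord (Suc q) y"
  have d': "dord (Suc q) x" using d(1) by (rule dord_mono) simp
  have "dord (2 * q) (y * x)" using dord_mult'[OF d(2,1)] by (simp add: mult_2)
  moreover have "x * y = y * x + com x y" by (simp add: com_def)
  ultimately show ?thesis unfolding crel_def f_left[OF d] f_right[OF d] using d_com[OF d' d(2)] by (simp add: f_add)
qed

text \<open>Leibniz rule. A commutator loses one order, so its product with the remaining factor has
  order at most 2q - 1 and is evaluated by \<open>f_mult\<close>.\<close>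

lemma crel_mult:
  assumes x1: "dord (Suc i) x1" "i < q" and x2: "dord (Suc j) x2" "j < q" and ij: "i + j = q" and y: "dord (Suc q) y"
    and c1: "crel x1 y" and c2: "crel x2 y"
  shows "crel (x1 * x2) y"
proof -
  have d1: "dord q x1" "dord (Suc q) x1" and d2: "dord q x2" "dord (Suc q) x2"
    using x1 x2 by (auto elim: dord_mono)
  have k1: "dord (i + q) (com x1 y)" and k2: "dord (j + q) (com x2 y)"
    using dord_com[OF y x1(1)] dord_com[OF y x2(1)] by simp_all
  have k1': "dord (Suc (i + q - 1)) (com x1 y)" and k2': "dord (Suc (j + q - 1)) (com x2 y)" using k1 k2 q_gt_0 by simp_all
  have c: "f x1 \<in> carrier R" "f x2 \<in> carrier R" "f y \<in> carrier R" "f (com x1 y) \<in> carrier R" "f (com x2 y) \<in> carrier R"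
    using d1 d2 y d_gens f_closed d_com by auto
  have p: "dord (2 * q) (com x1 y * x2)" "dord (2 * q) (x1 * com x2 y)"
    using dord_mult[OF k1 x2(1)] dord_mult'[OF x1(1) k2] ij by (auto elim!: dord_mono)
  have x: "f (x1 * x2) = f x1 \<otimes> f x2" using f_left[OF d1(1) d2(2)] by simp
  have m1: "f (com x1 y) \<otimes> f x2 = f (com x1 y * x2)" using ij q_gt_0 x2 by (intro f_mult[OF k1' x2(1)]) simp
  have m2: "f x1 \<otimes> f (com x2 y) = f (x1 * com x2 y)" using ij q_gt_0 x1 by (intro f_mult[OF x1(1) k2']) simp
  have "f (x1 * x2) \<otimes> f y = f x1 \<otimes> (f x2 \<otimes> f y)" using c by (simp add: x m_assoc)
  also have "\<dots> = f x1 \<otimes> f y \<otimes> f x2 \<oplus> f (x1 * com x2 y)"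
    using c c2 unfolding crel_def by (simp add: r_distr m_assoc flip: m2)
  also have "f x1 \<otimes> f y \<otimes> f x2 = f y \<otimes> f (x1 * x2) \<oplus> f (com x1 y * x2)"
    using c c1 unfolding crel_def by (simp add: l_distr m_assoc x flip: m1)
  also have "\<dots> \<oplus> f (x1 * com x2 y) = f y \<otimes> f (x1 * x2) \<oplus> f (com x1 y * x2 + x1 * com x2 y)"
    using c p f_closed by (simp add: f_add x a_assoc)
  also have "com x1 y * x2 + x1 * com x2 y = com (x1 * x2) y" by (simp add: com_mult add.commute)
  finally show ?thesis unfolding crel_def .
qed

text \<open>The locale assumes only a ring, so scalars enter as images of integers, which are
  distributions of order 0.\<close>

lemma f_int:
  assumes "dord (2 * q) x"
  shows "f (of_int k * x) = f (of_int k) \<otimes> f x \<and> f (of_int k * x) = f x \<otimes> f (of_int k)"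
proof -
  have x: "dord (Suc (2 * q - 1)) x" using assms q_gt_0 by simp
  have k: "dord (Suc 0) (of_int k :: 'p dst)" using dord_of_int[OF dord_1, of k] by simp
  have "f (of_int k) \<otimes> f x = f (of_int k * x)" "f x \<otimes> f (of_int k) = f (x * of_int k)"
    using q_gt_0 by (intro f_mult[OF k x] f_mult[OF x k]; simp)+
  then show ?thesis using mult_of_int_commute[of k x] by simp
qed

lemma f_unit: "dord (2 * q) x \<Longrightarrow> f 1 \<otimes> f x = f x \<and> f x \<otimes> f 1 = f x"
  using f_int[of x 1] by simp

lemma crel_linear:
  assumes y: "dord (Suc q) y" and x: "dord (Suc q) x"
    and mon: "\<And>a b c. a + b + c \<le> q \<Longrightarrow> crel (mon a b c) y"
  shows "crel x y"
  using x
proof (induction x rule: dord_induct)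
  case zero
  show ?case using f_closed[OF d_gens[OF y]] unfolding crel_def by (simp add: f_0)
next
  case (add x z)
  note d = add.hyps
  have "f x \<in> carrier R" "f z \<in> carrier R" "f y \<in> carrier R" "f (com x y) \<in> carrier R" "f (com z y) \<in> carrier R"
    using d y d_gens f_closed d_com by auto
  then show ?case using add.IH d_gens[OF d(1)] d_gens[OF d(2)] d_com[OF d(1) y] d_com[OF d(2) y] unfolding crel_def
    by (simp add: com_add f_add l_distr r_distr a_ac)
next
  case (mon a b c k)
  let ?x = "mon a b c :: 'p dst"
  have d: "dord (Suc q) ?x" using mon by (rule dord_mon)
  have di: "dord (2 * q) (of_int k)" using dord_of_int[OF dord_1, of k] q_gt_0 by (auto elim: dord_mono)
  have c: "f ?x \<in> carrier R" "f y \<in> carrier R" "f (of_int k) \<in> carrier R" "f (com ?x y) \<in> carrier R"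
    using d y d_gens f_closed d_com di by auto
  have yk: "f (of_int k) \<otimes> f y = f y \<otimes> f (of_int k)" using f_int[OF d_gens[OF y]] by metis
  have "f (of_int k * ?x) \<otimes> f y = f (of_int k) \<otimes> (f ?x \<otimes> f y)"
    using f_int[OF d_gens[OF d], of k] c by (simp add: m_assoc)
  also have "f ?x \<otimes> f y = f y \<otimes> f ?x \<oplus> f (com ?x y)" using assms(3)[of a b c] mon unfolding crel_def by simp
  also have "f (of_int k) \<otimes> \<dots> = f y \<otimes> (f (of_int k) \<otimes> f ?x) \<oplus> f (of_int k) \<otimes> f (com ?x y)"
    using c yk by (simp add: r_distr flip: m_assoc)
  finally show ?case unfolding crel_def com_of_int using f_int[OF d_gens[OF d], of k] f_int[OF d_com[OF d y], of k] by simp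
qed

text \<open>A monomial of order q with at least two nontrivial factors is a product of two elements
  of order below q, which satisfy the relation by \<open>crel_small\<close>; this leaves the three
  pure monomials. Linearity is used in one argument against a pure element and then, after
  \<open>crel_sym\<close>, in the other.\<close>

lemma crel_all:
  assumes HE: "crel (gH q) (gE q)" and HF: "crel (gH q) (gF q)" and FE: "crel (gF q) (gE q)"
    and x: "dord (Suc q) x" and y: "dord (Suc q) y"
  shows "crel x y"
proof -
  let ?pure = "{gE q, gH q, gF q} :: 'p dst set"
  have dp: "dord (Suc q) x" if "x \<in> ?pure" for x using that dord_gE dord_gH dord_gF by auto
  have refl: "crel x x" if "dord (Suc q) x" for x
    using f_closed[OF d_gens[OF that]] unfolding crel_def com_def by (simp add: f_0)
  have pp: "crel x y" if "x \<in> ?pure" "y \<in> ?pure" for x y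
    using that HE HF FE crel_sym[OF dp dp HE] crel_sym[OF dp dp HF] crel_sym[OF dp dp FE] refl[OF dp] by auto
  have step: "crel (mon a b c) y" if y: "dord (Suc q) y" and py: "\<And>x. x \<in> ?pure \<Longrightarrow> crel x y" and abc: "a + b + c \<le> q" for a b c y
  proof (cases "a + b + c < q")
    case True
    then show ?thesis using y by (intro crel_small dord_mon)
  next
    case False
    then have q: "a + b + c = q" using abc by simp
    consider "a = q" "b = 0" "c = 0" | "a = 0" "b = q" "c = 0" | "a = 0" "b = 0" "c = q"
      | "a > 0" "a < q" | "a = 0" "b > 0" "b < q" using q by linarith
    then show ?thesis
    proof cases
      case 4
      have d: "dord (Suc (b + c)) (gH b * gF c :: 'p dst)" using dord_mult[OF dord_gH dord_gF, of b c] by simp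
      have "crel (gE a * (gH b * gF c)) y"
      proof (rule crel_mult[OF dord_gE _ d _ _ y])
        show "crel (gE a) y" by (rule crel_small[OF dord_mono[OF dord_gE] y]) (use 4 q in simp)
        show "crel (gH b * gF c) y" by (rule crel_small[OF dord_mono[OF d] y]) (use 4 q in simp)
      qed (use 4 q in auto)
      then show ?thesis by (simp add: mon_def mult.assoc)
    next
      case 5
      have "crel (gH b * gF c) y"
      proof (rule crel_mult[OF dord_gH _ dord_gF _ _ y])
        show "crel (gH b) y" by (rule crel_small[OF dord_mono[OF dord_gH] y]) (use 5 q in simp)
        show "crel (gF c) y" by (rule crel_small[OF dord_mono[OF dord_gF] y]) (use 5 q in simp)
      qed (use 5 q in auto)
      then show ?thesis using 5 by (simp add: mon_def)
    qed (use py in \<open>auto simp: mon_def\<close>)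
  qed
  have px: "crel x y" if x: "x \<in> ?pure" and y: "dord (Suc q) y" for x y
  proof (rule crel_sym[OF y dp[OF x]])
    show "crel y x"
    proof (rule crel_linear[OF dp[OF x] y])
      show "crel (mon a b c) x" if "a + b + c \<le> q" for a b c
        using step[OF dp[OF x] pp[OF _ x] that] by blast
    qed
  qed
  show ?thesis
  proof (rule crel_linear[OF y x])
    show "crel (mon a b c) y" if "a + b + c \<le> q" for a b c
      using step[OF y px[OF _ y] that] by blast
  qed
qed

end


section \<open>Products of classes and uniqueness of morphisms\<close>

context
  fixes m :: nat and U :: "('p::prime_card mod_ring, 'p ulevel) module" and q :: nat
  defines "U \<equiv> U_level m" and "q \<equiv> CARD('p) ^ m"
begin

text \<open>The defining relations have the small factor on the left only; the other order follows
  by adding the commutator.\<close>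

lemma lc_gen_small:
  assumes "dord q s" "dord (Suc q) g"
  shows "lc m g \<otimes>\<^bsub>U\<^esub> lc m s = lc m (g * s)"
proof -
  have s: "dord (Suc q) s" using assms(1) by (rule dord_mono) simp
  have d: "dord (2 * q) (s * g)" "dord (2 * q) (com g s)"
    using small_mult_level[of m s g] com_level[of m g s] assms s unfolding q_def by auto
  have "lc m g \<otimes>\<^bsub>U\<^esub> lc m s = lc m (s * g) \<oplus>\<^bsub>U\<^esub> lc m (com g s)"
    using lc_com[of m g s] lc_small_mult[of m s g] assms s by (simp add: U_def q_def)
  also have "\<dots> = lc m (s * g + com g s)" using lc_add[of m "s * g" "com g s"] d by (simp add: U_def q_def)
  also have "s * g + com g s = g * s" by (simp add: com_def)
  finally show ?thesis .
qed

lemma lc_level_map: "level_map U m (lc m :: 'p dst \<Rightarrow> 'p ulevel)"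
proof -
  interpret U: kalg U unfolding U_def by (rule U_level_kalg)
  show ?thesis
  proof unfold_locales
    fix x y :: "'p dst"
    assume x: "dord (2 * CARD('p) ^ m) x"
    then show "lc m x \<in> carrier U" unfolding U_def by (rule lc_closed)
    assume "dord (2 * CARD('p) ^ m) y"
    with x show "lc m (x + y) = lc m x \<oplus>\<^bsub>U\<^esub> lc m y" unfolding U_def by (rule lc_add)
  next
    fix s g :: "'p dst"
    assume *: "dord (CARD('p) ^ m) s" "dord (Suc (CARD('p) ^ m)) g"
    show "lc m s \<otimes>\<^bsub>U\<^esub> lc m g = lc m (s * g)" unfolding U_def by (rule lc_small_mult[OF *])
    show "lc m g \<otimes>\<^bsub>U\<^esub> lc m s = lc m (g * s)" by (rule lc_gen_small[unfolded q_def, OF *])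
  qed
qed

lemmas lc_mult = level_map.f_mult[OF lc_level_map, folded q_def]
lemmas lc_0 = level_map.f_0[OF lc_level_map]

lemma lc_of_int: "dord (2 * q) x \<Longrightarrow> lc m (of_int k * x) = of_int k \<odot>\<^bsub>U\<^esub> lc m x"
  using lc_smult[of m x "of_int k"] of_int_dst_cong[of "to_int_mod_ring (of_int k :: 'p mod_ring)" k x]
  by (simp add: of_int_to_int_mod_ring U_def q_def)

lemma level_gens: "level_E m n = lc m (gE n :: 'p dst)" "level_F m n = lc m (gF n :: 'p dst)" "level_H m n = lc m (gH n :: 'p dst)"
  by (simp_all add: level_E_def level_F_def level_H_def lc_def dist_gens[where 'p = 'p])

text \<open>Up to order p^m distributions are combinations of products of generators. Beyond that
  \<open>dord_split\<close> takes off factors of order p^m, and induction on the order reaches all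
  of \<open>level_space m\<close>.\<close>

lemma level_hom_eq:
  fixes B :: "('p mod_ring, 'b) module"
  assumes B: "kalg B" and f: "f \<in> nonunital_alg_hom U B" and g: "g \<in> nonunital_alg_hom U B"
    and eq: "\<And>n. n \<le> q \<Longrightarrow> f (lc m (gE n)) = g (lc m (gE n)) \<and> f (lc m (gF n)) = g (lc m (gF n)) \<and> f (lc m (gH n)) = g (lc m (gH n))"
    and u: "u \<in> carrier U"
  shows "f u = g u"
proof -
  interpret U: kalg U unfolding U_def by (rule U_level_kalg)
  note fh = alg_homD[OF f] and gh = alg_homD[OF g]
  have q0: "q > 0" by (simp add: q_def)
  have cl: "lc m x \<in> carrier U" if "dord n x" "n \<le> 2 * q" for n x
    using lc_closed[of m x] dord_mono[OF that] by (simp add: U_def q_def)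
  have mon: "f (lc m (mon a b c)) = g (lc m (mon a b c))" if abc: "a + b + c \<le> q" for a b c
  proof -
    have d: "dord (Suc (a + b)) (gE a * gH b :: 'p dst)" using dord_mult[OF dord_gE dord_gH, of a b] by simp
    have 1: "lc m (mon a b c) = lc m (gE a) \<otimes>\<^bsub>U\<^esub> lc m (gH b) \<otimes>\<^bsub>U\<^esub> lc m (gF c)"
      using lc_mult[OF dord_gE dord_gH, of a b] lc_mult[OF d dord_gF, of c] abc q0 by (simp add: mon_def)
    have "lc m (gE a) \<in> carrier U" "lc m (gH b) \<in> carrier U" "lc m (gF c) \<in> carrier U"
      using abc q0 by (auto intro!: cl[OF dord_gE] cl[OF dord_gH] cl[OF dord_gF])
    then show ?thesis unfolding 1 using eq[of a] eq[of b] eq[of c] abc by (simp add: fh gh)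
  qed
  have addc: "f (lc m (x + y)) = g (lc m (x + y))"
    if "dord (2 * q) x" "dord (2 * q) y" "f (lc m x) = g (lc m x)" "f (lc m y) = g (lc m y)" for x y
    using that cl[OF that(1)] cl[OF that(2)] by (simp add: fh gh lc_add[where 'p = 'p and m = m, folded U_def q_def])
  have main: "dord (Suc i) x \<Longrightarrow> i < 2 * q \<Longrightarrow> f (lc m x) = g (lc m x)" for i x
  proof (induction i arbitrary: x rule: less_induct)
    case (less i)
    have up: "dord (Suc i) y \<Longrightarrow> dord (2 * q) y" for y :: "'p dst" using less.prems(2) by (elim dord_mono) simp
    show ?case
    proof (cases "i \<le> q")
      case True
      show ?thesis using less.prems(1)
      proof (induction x rule: dord_induct)
        case zero show ?case using eq[of 0] U.zero_closed lc_0 fh(4)[of "\<zero>\<^bsub>U\<^esub>" 0] gh(4)[of "\<zero>\<^bsub>U\<^esub>" 0]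
            fh(1)[of "\<zero>\<^bsub>U\<^esub>"] gh(1)[of "\<zero>\<^bsub>U\<^esub>"] alg_hom_zero[OF U.kalg_axioms B f] alg_hom_zero[OF U.kalg_axioms B g] by simp
      next
        case (add x y) then show ?case using up by (intro addc) auto
      next
        case (mon a b c k)
        have d: "dord (2 * q) (mon a b c :: 'p dst)" using mon by (intro up dord_mon)
        show ?case using cl[OF d] \<open>a + b + c < Suc i\<close> True d
          by (simp add: lc_of_int fh gh \<open>\<And>c b a. a + b + c \<le> q \<Longrightarrow> f (lc m (Submission.mon a b c)) = g (lc m (Submission.mon a b c))\<close>)
      qed
    next
      case False
      have "dord (Suc i) x \<and> f (lc m x) = g (lc m x)"
        using less.prems(1)
      proof (rule dord_split[where m = m and 'p = 'p])
        show "CARD('p) ^ m \<le> i" "i < 2 * CARD('p) ^ m" using False less.prems by (auto simp: q_def)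
      next
        fix x y :: "'p dst" assume "dord (Suc i) x \<and> f (lc m x) = g (lc m x)" "dord (Suc i) y \<and> f (lc m y) = g (lc m y)"
        then show "dord (Suc i) (x + y) \<and> f (lc m (x + y)) = g (lc m (x + y))" using up by (auto intro: addc dord_add)
      next
        fix s h :: "'p dst" assume "dord (Suc (i - CARD('p) ^ m)) s" "dord (Suc (CARD('p) ^ m)) h"
        then have s: "dord (Suc (i - q)) s" and h: "dord (Suc q) h" by (simp_all add: q_def)
        have "lc m (s * h) = lc m s \<otimes>\<^bsub>U\<^esub> lc m h" using less.prems(2) False by (intro lc_mult[OF s h, symmetric]) simp
        moreover have "f (lc m s) = g (lc m s)" using s less.prems False q0 by (intro less.IH[of "i - q"]) auto
        moreover have "f (lc m h) = g (lc m h)" using h False less.prems q0 by (intro less.IH[of q]) auto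
        moreover have "lc m s \<in> carrier U" "lc m h \<in> carrier U"
          using less.prems False q0 by (auto intro: cl[OF s] cl[OF h])
        moreover have "dord (Suc i) (s * h)" using dord_mult[OF s h] False by (auto elim!: dord_mono)
        ultimately show "dord (Suc i) (s * h) \<and> f (lc m (s * h)) = g (lc m (s * h))" by (simp add: fh gh)
      next
        fix y :: "'p dst" assume y: "dord i y"
        then have "dord (Suc (i - 1)) y" using False by (cases i) auto
        then have "f (lc m y) = g (lc m y)" using False less.prems by (intro less.IH[of "i - 1"]) auto
        then show "dord (Suc i) y \<and> f (lc m y) = g (lc m y)" using y by (auto elim: dord_mono)
      qed
      then show ?thesis by blast
    qed
  qed
  have lv: "f (lc m x) = g (lc m x)" if "dord (2 * q) x" for x
    using main[of "2 * q - 1" x] that q0 by simp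
  have one: "f \<one>\<^bsub>U\<^esub> = g \<one>\<^bsub>U\<^esub>" using eq[of 0] lc_one[of m, where 'p = 'p] by (simp add: U_def)
  show ?thesis using u[unfolded U_def]
  proof (induction u rule: lc_induct)
    case one then show ?case using \<open>f \<one>\<^bsub>U\<^esub> = g \<one>\<^bsub>U\<^esub>\<close> by (simp add: U_def)
  next
    case (lc x) then show ?case using lv by (simp add: q_def)
  qed (simp_all add: fh gh flip: U_def)
qed

end

lemma frob_of_int: "frob (of_int k * x) = (of_int k * frob x :: 'p::prime_card dst)"
  unfolding symb_inject[symmetric] fun_eq_iff by (simp add: symb_frob symb_of_int)

lemma frob_com: "frob (com x y) = com (frob x) (frob y :: 'p::prime_card dst)"
  using frob_add[of "x * y" "- (y * x)"] by (simp add: com_def frob_mult frob_uminus)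

lemma spl_com: "spl (com x y) = com (spl x) (spl y :: 'p::prime_card dst)"
  using spl_add[of "x * y" "- (y * x)"] by (simp add: com_def spl_mult spl_uminus)

section \<open>The Frobenius morphism between the levels\<close>

lemma frob_lift:
  "\<exists>g \<in> alg_hom (U_level (Suc m)) (U_level m :: ('p::prime_card mod_ring, 'p ulevel) module).
     \<forall>x :: 'p dst. dord (2 * CARD('p) ^ Suc m) x \<longrightarrow> g (lc (Suc m) x) = lc m (frob x)"
proof -
  interpret U: kalg "U_level m :: ('p mod_ring, 'p ulevel) module" by (rule U_level_kalg)
  let ?p = "CARD('p)"
  have p: "?p > 0" by simp
  have d: "dord (2 * ?p ^ m) (frob x)" if "dord (2 * ?p ^ Suc m) x" for x :: "'p dst"
    using that by (rule dord_frob) simp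
  have ds: "dord (?p ^ m) (frob x)" if "dord (?p ^ Suc m) x" for x :: "'p dst"
    using that by (rule dord_frob) simp
  have dg: "dord (Suc (?p ^ m)) (frob x)" if "dord (Suc (?p ^ Suc m)) x" for x :: "'p dst"
    using that by (rule dord_frob) (use p in simp)
  show ?thesis
  proof (rule lc_lift[OF U_level_kalg])
    fix x y z :: "'p dst" and c :: "'p mod_ring"
    show "lc m (frob (1 :: 'p dst)) = \<one>\<^bsub>U_level m\<^esub>" by (simp add: frob_1 lc_one)
    assume x: "dord (2 * ?p ^ Suc m) x"
    show "lc m (frob x) \<in> carrier (U_level m)" by (rule lc_closed[OF d[OF x]])
    show "lc m (frob (of_int (to_int_mod_ring c) * x)) = c \<odot>\<^bsub>U_level m\<^esub> lc m (frob x)"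
      by (simp add: frob_of_int lc_smult[OF d[OF x]])
    assume y: "dord (2 * ?p ^ Suc m) y"
    show "lc m (frob (x + y)) = lc m (frob x) \<oplus>\<^bsub>U_level m\<^esub> lc m (frob y)"
      by (simp add: frob_add lc_add[OF d[OF x] d[OF y]])
  next
    fix x y :: "'p dst"
    assume y: "dord (Suc (?p ^ Suc m)) y"
    show "lc m (frob x) \<otimes>\<^bsub>U_level m\<^esub> lc m (frob y) = lc m (frob (x * y))" if "dord (?p ^ Suc m) x"
      using lc_small_mult[OF ds[OF that] dg[OF y]] by (simp add: frob_mult)
    assume x: "dord (Suc (?p ^ Suc m)) x"
    show "lc m (frob x) \<otimes>\<^bsub>U_level m\<^esub> lc m (frob y) =
        lc m (frob y) \<otimes>\<^bsub>U_level m\<^esub> lc m (frob x) \<oplus>\<^bsub>U_level m\<^esub> lc m (frob (com x y))"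
      unfolding frob_com by (rule lc_com[OF dg[OF x] dg[OF y]])
  qed
qed

text \<open>This discharges the definite description: existence by restricting the morphism of
  \<open>frob_lift\<close> to the carrier, uniqueness by \<open>level_hom_eq\<close> on the carrier
  and extensionality outside it.\<close>

lemma Frobenius_lc:
  "(Frobenius m :: 'p::prime_card ulevel \<Rightarrow> 'p ulevel) \<in> alg_hom (U_level (Suc m)) (U_level m)"
  "dord (2 * CARD('p) ^ Suc m) x \<Longrightarrow> Frobenius m (lc (Suc m) x) = lc m (frob x :: 'p dst)"
proof -
  let ?A = "U_level (Suc m) :: ('p mod_ring, 'p ulevel) module" and ?B = "U_level m :: ('p mod_ring, 'p ulevel) module"
  let ?p = "CARD('p)"
  let ?P = "\<lambda>f. f \<in> alg_hom ?A ?B \<and> f \<in> extensional (carrier ?A) \<and>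
       (\<forall>n\<le>?p ^ Suc m.
          f (level_E (Suc m) n) = (if ?p dvd n then level_E m (n div ?p) else \<zero>\<^bsub>?B\<^esub>) \<and>
          f (level_F (Suc m) n) = (if ?p dvd n then level_F m (n div ?p) else \<zero>\<^bsub>?B\<^esub>) \<and>
          f (level_H (Suc m) n) = (if ?p dvd n then level_H m (n div ?p) else \<zero>\<^bsub>?B\<^esub>))"
  interpret A: kalg ?A by (rule U_level_kalg)
  obtain g where g: "g \<in> alg_hom ?A ?B" "\<And>x :: 'p dst. dord (2 * ?p ^ Suc m) x \<Longrightarrow> g (lc (Suc m) x) = lc m (frob x)"
    using frob_lift[of m, where 'p = 'p] by blast
  define G where "G = restrict g (carrier ?A)"
  have Gh: "G \<in> alg_hom ?A ?B"
    using g(1) unfolding G_def alg_hom_def nonunital_alg_hom_def by auto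
  have Gl: "G (lc (Suc m) x) = lc m (frob x)" if "dord (2 * ?p ^ Suc m) x" for x :: "'p dst"
    using g(2)[OF that] lc_closed[OF that] by (simp add: G_def)
  have q: "Suc n \<le> 2 * ?p ^ Suc m" if "n \<le> ?p ^ Suc m" for n
    using that q_pos[of "Suc m", where 'p = 'p] by linarith
  have PG: "?P G"
    using Gh Gl[OF dord_mono[OF dord_gE q]] Gl[OF dord_mono[OF dord_gF q]] Gl[OF dord_mono[OF dord_gH q]]
    by (auto simp: level_gens frob_gE frob_gF frob_gH lc_0 G_def[THEN arg_cong, of "\<lambda>f. f \<in> extensional (carrier ?A)"])
  have "f = G" if f: "?P f" for f
  proof (rule extensionalityI[of _ "carrier ?A"])
    show "f \<in> extensional (carrier ?A)" "G \<in> extensional (carrier ?A)" using f by (auto simp: G_def)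
    fix u assume u: "u \<in> carrier ?A"
    show "f u = G u"
      by (rule level_hom_eq[OF U_level_kalg alg_hom_nonunital alg_hom_nonunital[OF Gh] _ u])
         (use f PG in \<open>auto simp flip: level_gens\<close>)
  qed
  with PG have "(THE f. ?P f) = G" by (intro the_equality)
  then have "Frobenius m = G" unfolding Frobenius_def Let_def .
  then show "(Frobenius m :: 'p ulevel \<Rightarrow> 'p ulevel) \<in> alg_hom ?A ?B"
    "dord (2 * ?p ^ Suc m) x \<Longrightarrow> Frobenius m (lc (Suc m) x) = lc m (frob x :: 'p dst)"
    using Gh Gl by simp_all
qed

section \<open>The splitting between the levels\<close>

text \<open>The corner e B e, with unit e. The universal property yields unital morphisms, so a
  morphism that sends 1 to an idempotent e is obtained as a unital morphism into this
  corner.\<close>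

definition corner :: "('k, 'b) module \<Rightarrow> 'b \<Rightarrow> ('k, 'b) module" where
  "corner B e = B\<lparr>carrier := {x \<in> carrier B. e \<otimes>\<^bsub>B\<^esub> x = x \<and> x \<otimes>\<^bsub>B\<^esub> e = x}, one := e\<rparr>"

lemma corner_kalg:
  assumes "kalg B" "e \<in> carrier B" "e \<otimes>\<^bsub>B\<^esub> e = e"
  shows "kalg (corner B e)"
proof -
  interpret B: kalg B by fact
  have r: "ring (corner B e)"
  proof (intro ringI abelian_groupI monoidI)
    show "\<exists>y\<in>carrier (corner B e). y \<oplus>\<^bsub>corner B e\<^esub> x = \<zero>\<^bsub>corner B e\<^esub>" if "x \<in> carrier (corner B e)" for x
      using that assms by (intro bexI[of _ "\<ominus>\<^bsub>B\<^esub> x"]) (auto simp: corner_def B.l_neg B.r_minus B.l_minus)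
    show "x \<otimes>\<^bsub>corner B e\<^esub> y \<in> carrier (corner B e)" if "x \<in> carrier (corner B e)" "y \<in> carrier (corner B e)" for x y
      using that assms by (auto simp: corner_def B.m_assoc) (simp flip: B.m_assoc)
  qed (use assms in \<open>auto simp: corner_def B.a_ac B.m_assoc B.l_distr B.r_distr\<close>)
  show ?thesis
    by (intro kalg.intro[OF r] kalg_axioms.intro)
       (use assms in \<open>auto simp: corner_def B.smult_l_distr B.smult_r_distr B.smult_assoc1 B.smult_one B.smult_mult1 B.smult_mult2\<close>)
qed

lemma Delta_T_eq: "Delta_T m = lc m (dT :: 'p::prime_card dst)"
proof -
  let ?D = "Dist :: ('p mod_ring, dist) module"
  have "(- 1) ^ i \<odot>\<^bsub>?D\<^esub> rep_d (gH i :: 'p dst) = rep_d (of_int ((- 1) ^ i) * gH i :: 'p dst)" for i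
    unfolding rep_d_simps(5)
    using of_int_dst_cong[of "to_int_mod_ring ((- 1) ^ i :: 'p mod_ring)" "(- 1) ^ i" "gH i :: 'p dst"]
    by (simp add: of_int_to_int_mod_ring)
  then have "(\<Oplus>\<^bsub>?D\<^esub>i\<in>{0..CARD('p) - 1}. ((- 1) ^ i :: 'p mod_ring) \<odot>\<^bsub>?D\<^esub> dist_H CARD('p) i) =
      rep_d (\<Sum>i\<in>{0..CARD('p) - 1}. of_int ((- 1) ^ i) * gH i :: 'p dst)"
    by (simp add: dist_gens[where 'p = 'p] rep_d_finsum)
  moreover have "{0..CARD('p) - 1} = {..<CARD('p)}"
  proof -
    have "{0..n - 1} = {..<n}" if "n > 0" for n :: nat using that by auto
    then show ?thesis by simp
  qed
  ultimately show ?thesis unfolding Delta_T_def Let_def lc_def dT_eq by simp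
qed

context
  fixes m :: nat and B :: "('p::prime_card mod_ring, 'p ulevel) module" and Q :: nat and \<Delta> :: "'p ulevel"
  defines "B \<equiv> U_level (Suc m)" and "Q \<equiv> CARD('p) ^ Suc m" and "\<Delta> \<equiv> lc (Suc m) (dT :: 'p dst)"
begin

lemma dT_small: "dord Q (dT :: 'p dst)"
  by (rule dord_mono[OF dord_dT]) (simp add: Q_def)

lemma dT_gens: "dord (Suc Q) (dT :: 'p dst)"
  by (rule dord_mono[OF dT_small]) simp

lemmas lcQ = lc_closed[where 'p = 'p and m = "Suc m", folded Q_def B_def]
  lc_add[where 'p = 'p and m = "Suc m", folded Q_def B_def]
  lc_small_mult[where 'p = 'p and m = "Suc m", folded Q_def B_def]
  lc_gen_small[where 'p = 'p and m = "Suc m", folded Q_def B_def]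
  lc_com[where 'p = 'p and m = "Suc m", folded Q_def B_def]
  lc_mult[where 'p = 'p and m = "Suc m", folded Q_def B_def]
  lc_smult[where 'p = 'p and m = "Suc m", folded Q_def B_def]
  lc_0[where 'p = 'p and m = "Suc m", folded B_def]

lemma small_gens: "dord Q x \<Longrightarrow> dord (Suc Q) x" by (elim dord_mono) simp

lemma gens_Q: "dord (Suc Q) x \<Longrightarrow> dord (2 * Q) x"
  using q_pos[of "Suc m", where 'p = 'p] unfolding Q_def by (elim dord_mono) linarith

lemma small_Q: "dord Q x \<Longrightarrow> dord (2 * Q) x" by (elim dord_mono) simp

lemma Delta_closed: "\<Delta> \<in> carrier B" unfolding \<Delta>_def by (intro lcQ(1) small_Q dT_small)

lemma Delta_idem: "\<Delta> \<otimes>\<^bsub>B\<^esub> \<Delta> = \<Delta>"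
  unfolding \<Delta>_def by (subst lcQ(3)[OF dT_small dT_gens]) (simp add: dT_idem)

lemma spl_orders: "dord (2 * CARD('p) ^ m) x \<Longrightarrow> dord (2 * Q) (spl x :: 'p dst)"
  "dord (CARD('p) ^ m) x \<Longrightarrow> dord Q (spl x :: 'p dst)"
  using dord_spl[of "2 * CARD('p) ^ m" x] dord_spl[of "CARD('p) ^ m" x] by (simp_all add: Q_def mult.left_commute)

lemma spl_gen:
  assumes "dord (Suc (CARD('p) ^ m)) (x :: 'p dst)"
  obtains y where "dord (Suc Q) y" "spl x = y * dT" "dT * y = y * dT"
  using spl_factor[OF assms] that by (auto simp: Q_def)

lemma spl_level_map: "level_map B m (\<lambda>x :: 'p dst. lc (Suc m) (spl x))"
proof -
  interpret B: kalg B unfolding B_def by (rule U_level_kalg)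
  show ?thesis
  proof unfold_locales
    fix x y :: "'p dst"
    assume x: "dord (2 * CARD('p) ^ m) x"
    then show "lc (Suc m) (spl x) \<in> carrier B" by (intro lcQ(1) spl_orders)
    assume "dord (2 * CARD('p) ^ m) y"
    with x show "lc (Suc m) (spl (x + y)) = lc (Suc m) (spl x) \<oplus>\<^bsub>B\<^esub> lc (Suc m) (spl y)"
      unfolding spl_add by (intro lcQ(2) spl_orders)
  next
    fix s g :: "'p dst"
    assume "dord (CARD('p) ^ m) s"
    then have s: "dord Q (spl s)" by (rule spl_orders)
    assume "dord (Suc (CARD('p) ^ m)) g"
    then obtain y where y: "dord (Suc Q) y" "spl g = y * dT" "dT * y = y * dT" by (rule spl_gen)
    have c: "lc (Suc m) (spl s) \<in> carrier B" "lc (Suc m) y \<in> carrier B" "\<Delta> \<in> carrier B"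
      using lcQ(1) small_Q[OF s] gens_Q[OF y(1)] Delta_closed by auto
    have D: "lc (Suc m) (spl s) \<otimes>\<^bsub>B\<^esub> \<Delta> = lc (Suc m) (spl s)" "\<Delta> \<otimes>\<^bsub>B\<^esub> lc (Suc m) (spl s) = lc (Suc m) (spl s)"
      unfolding \<Delta>_def using lcQ(3)[OF s dT_gens] lcQ(3)[OF dT_small small_gens[OF s]] by (simp_all add: spl_dT dT_spl)
    have g1: "lc (Suc m) (spl g) = \<Delta> \<otimes>\<^bsub>B\<^esub> lc (Suc m) y"
      unfolding \<Delta>_def lcQ(3)[OF dT_small y(1)] y by simp
    have g2: "lc (Suc m) (spl g) = lc (Suc m) y \<otimes>\<^bsub>B\<^esub> \<Delta>"
      unfolding \<Delta>_def lcQ(4)[OF dT_small y(1)] y by simp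
    have "lc (Suc m) (spl s) \<otimes>\<^bsub>B\<^esub> lc (Suc m) (spl g) = lc (Suc m) (spl s) \<otimes>\<^bsub>B\<^esub> lc (Suc m) y"
      unfolding g1 using c D by (simp flip: B.m_assoc)
    also have "\<dots> = lc (Suc m) (spl s * y)" by (rule lcQ(3)[OF s y(1)])
    also have "spl s * y = spl s * dT * y" by (simp add: spl_dT)
    also have "\<dots> = spl (s * g)" by (simp add: spl_mult y mult.assoc)
    finally show "lc (Suc m) (spl s) \<otimes>\<^bsub>B\<^esub> lc (Suc m) (spl g) = lc (Suc m) (spl (s * g))" .
    have "lc (Suc m) (spl g) \<otimes>\<^bsub>B\<^esub> lc (Suc m) (spl s) = lc (Suc m) y \<otimes>\<^bsub>B\<^esub> lc (Suc m) (spl s)"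
      unfolding g2 using c D by (simp add: B.m_assoc)
    also have "\<dots> = lc (Suc m) (y * spl s)" by (rule lcQ(4)[OF s y(1)])
    also have "y * spl s = y * (dT * spl s)" by (simp add: dT_spl)
    also have "\<dots> = spl (g * s)" by (simp add: spl_mult y mult.assoc)
    finally show "lc (Suc m) (spl g) \<otimes>\<^bsub>B\<^esub> lc (Suc m) (spl s) = lc (Suc m) (spl (g * s))" .
  qed
qed

text \<open>For t whose order plus that of \<open>dT\<close> is less than 2Q this follows from
  \<open>lc_mult\<close>, but a commutator can itself have order 2Q - 1.\<close>

definition central_mult :: "'p dst \<Rightarrow> bool" where
  "central_mult t \<longleftrightarrow> dord (2 * Q) t \<and> dord (2 * Q) (t * dT) \<and> lc (Suc m) t \<otimes>\<^bsub>B\<^esub> \<Delta> = lc (Suc m) (t * dT)"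

text \<open>\<open>\<Delta>\<close> is idempotent and commutes with the classes of X and Y, so each
  product of images is the product of the two classes times one \<open>\<Delta>\<close>. The
  relation between X and Y then reduces the claim to the commutator times
  \<open>\<Delta>\<close>.\<close>

lemma pure_crel:
  assumes X: "dord (Suc Q) X" "dT * X = X * dT" and Y: "dord (Suc Q) Y" "dT * Y = Y * dT"
    and c: "central_mult (com X Y)"
  shows "lc (Suc m) (X * dT) \<otimes>\<^bsub>B\<^esub> lc (Suc m) (Y * dT) =
    lc (Suc m) (Y * dT) \<otimes>\<^bsub>B\<^esub> lc (Suc m) (X * dT) \<oplus>\<^bsub>B\<^esub> lc (Suc m) (com (X * dT) (Y * dT))"
proof -
  interpret B: kalg B unfolding B_def by (rule U_level_kalg)
  let ?x = "lc (Suc m) X" and ?y = "lc (Suc m) Y" and ?c = "lc (Suc m) (com X Y)"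
  have cl: "?x \<in> carrier B" "?y \<in> carrier B" "\<Delta> \<in> carrier B" "?c \<in> carrier B"
    using lcQ(1) gens_Q X Y Delta_closed c by (auto simp: central_mult_def)
  have x: "lc (Suc m) (X * dT) = ?x \<otimes>\<^bsub>B\<^esub> \<Delta>" "\<Delta> \<otimes>\<^bsub>B\<^esub> ?x = ?x \<otimes>\<^bsub>B\<^esub> \<Delta>"
    unfolding \<Delta>_def using lcQ(3)[OF dT_small X(1)] lcQ(4)[OF dT_small X(1)] X(2) by simp_all
  have y: "lc (Suc m) (Y * dT) = ?y \<otimes>\<^bsub>B\<^esub> \<Delta>" "\<Delta> \<otimes>\<^bsub>B\<^esub> ?y = ?y \<otimes>\<^bsub>B\<^esub> \<Delta>"
    unfolding \<Delta>_def using lcQ(3)[OF dT_small Y(1)] lcQ(4)[OF dT_small Y(1)] Y(2) by simp_all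
  have com: "com (X * dT) (Y * dT) = com X Y * dT"
  proof -
    have "X * dT * (Y * dT) = X * (dT * Y) * dT" "Y * dT * (X * dT) = Y * (dT * X) * dT" by (simp_all add: mult.assoc)
    then show ?thesis unfolding com_def X(2) Y(2) by (simp add: mult.assoc dT_idem left_diff_distrib)
  qed
  have prod: "a \<otimes>\<^bsub>B\<^esub> \<Delta> \<otimes>\<^bsub>B\<^esub> (b \<otimes>\<^bsub>B\<^esub> \<Delta>) = a \<otimes>\<^bsub>B\<^esub> b \<otimes>\<^bsub>B\<^esub> \<Delta>"
    if "a \<in> carrier B" "b \<in> carrier B" "\<Delta> \<otimes>\<^bsub>B\<^esub> b = b \<otimes>\<^bsub>B\<^esub> \<Delta>" for a b
  proof -
    have "a \<otimes>\<^bsub>B\<^esub> \<Delta> \<otimes>\<^bsub>B\<^esub> (b \<otimes>\<^bsub>B\<^esub> \<Delta>) = a \<otimes>\<^bsub>B\<^esub> (\<Delta> \<otimes>\<^bsub>B\<^esub> b) \<otimes>\<^bsub>B\<^esub> \<Delta>" using that(1,2) cl by (simp add: B.m_assoc)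
    also have "\<dots> = a \<otimes>\<^bsub>B\<^esub> b \<otimes>\<^bsub>B\<^esub> (\<Delta> \<otimes>\<^bsub>B\<^esub> \<Delta>)" unfolding that(3) using that(1,2) cl by (simp add: B.m_assoc)
    finally show ?thesis by (simp add: Delta_idem)
  qed
  have "lc (Suc m) (X * dT) \<otimes>\<^bsub>B\<^esub> lc (Suc m) (Y * dT) = (?y \<otimes>\<^bsub>B\<^esub> ?x \<oplus>\<^bsub>B\<^esub> ?c) \<otimes>\<^bsub>B\<^esub> \<Delta>"
    unfolding x(1) y(1) prod[OF cl(1,2) y(2)] lcQ(5)[OF X(1) Y(1)] ..
  also have "\<dots> = lc (Suc m) (Y * dT) \<otimes>\<^bsub>B\<^esub> lc (Suc m) (X * dT) \<oplus>\<^bsub>B\<^esub> lc (Suc m) (com X Y * dT)"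
    using cl c unfolding x(1) y(1) prod[OF cl(2,1) x(2)] central_mult_def by (simp add: B.l_distr)
  finally show ?thesis unfolding com .
qed

lemma central_mult_gens: "dord (Suc Q) x \<Longrightarrow> dord (2 * Q) (x * dT) \<Longrightarrow> central_mult x"
  unfolding central_mult_def \<Delta>_def by (simp add: gens_Q lcQ(4)[OF dT_small])

lemma central_mult_0: "central_mult 0"
proof -
  interpret B: kalg B unfolding B_def by (rule U_level_kalg)
  show ?thesis unfolding central_mult_def using Delta_closed by (simp add: dord_0 lcQ(8))
qed

lemma central_mult_add: "central_mult x \<Longrightarrow> central_mult y \<Longrightarrow> central_mult (x + y)"
proof -
  interpret B: kalg B unfolding B_def by (rule U_level_kalg)
  assume "central_mult x" "central_mult y"
  then show ?thesis unfolding central_mult_def using Delta_closed lcQ(1)[of x] lcQ(1)[of y]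
    by (simp add: dord_add lcQ(2) distrib_right B.l_distr)
qed

lemma central_mult_sum: "(\<And>i. i \<in> A \<Longrightarrow> central_mult (f i)) \<Longrightarrow> central_mult (\<Sum>i\<in>A. f i)"
  by (induction A rule: infinite_finite_induct) (auto intro: central_mult_0 central_mult_add)

text \<open>In each term E^[a] has order below \<open>Q\<close>, so its class splits off and
  \<open>dT\<close> multiplies \<open>W a\<close> alone; this product is 0 unless p divides
  a.\<close>

lemma central_mult_FE: "central_mult (com (gF Q) (gE Q))"
proof -
  interpret B: kalg B unfolding B_def by (rule U_level_kalg)
  have "CARD('p) dvd Q" by (simp add: Q_def)
  from com_FE_expand[OF this] obtain W :: "nat \<Rightarrow> 'p dst" where
    W: "com (gF Q) (gE Q) = (\<Sum>a<Q. gE a * W a)" "\<And>a. a < Q \<Longrightarrow> dord (Suc Q) (W a)"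
      "\<And>a. a < Q \<Longrightarrow> \<not> CARD('p) dvd a \<Longrightarrow> W a * dT = 0" by blast
  have "central_mult (gE a * W a)" if a: "a < Q" for a
  proof -
    note Wa = W(2)[OF a]
    have E: "dord Q (gE a :: 'p dst)" using a by (intro dord_mono[OF dord_gE]) simp
    have 1: "dord (2 * Q) (gE a * W a)" using dord_mult[OF E Wa] by (simp add: mult_2)
    have c: "lc (Suc m) (gE a) \<in> carrier B" "lc (Suc m) (W a) \<in> carrier B"
      using lcQ(1) small_Q[OF E] gens_Q[OF Wa] by auto
    have 2: "lc (Suc m) (gE a * W a) \<otimes>\<^bsub>B\<^esub> \<Delta> = lc (Suc m) (gE a) \<otimes>\<^bsub>B\<^esub> lc (Suc m) (W a * dT)"
      using c Delta_closed lcQ(4)[OF dT_small Wa]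
      by (simp add: \<Delta>_def[symmetric] B.m_assoc flip: lcQ(3)[OF E Wa])
    show ?thesis
    proof (cases "CARD('p) dvd a")
      case False
      then show ?thesis using 1 2 c W(3)[OF a False] unfolding central_mult_def mult.assoc
        by (simp add: dord_0 lcQ(8))
    next
      case True
      then obtain k where k: "a = CARD('p) * k" by (auto elim: dvdE)
      \<comment> \<open>Both are multiples of p, so a < Q leaves a gap of at least p, room for the
        order p - 1 of \<open>dT\<close>.\<close>
      have "a + CARD('p) \<le> Q"
      proof -
        have "k < CARD('p) ^ m" using a by (simp add: k Q_def)
        then have "CARD('p) * Suc k \<le> CARD('p) * CARD('p) ^ m" by (intro mult_le_mono2) simp
        then show ?thesis by (simp add: k Q_def)
      qed
      moreover have "CARD('p) > 0" by simp
      ultimately have le: "a + (Q + CARD('p) - 1) < 2 * Q" by linarith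
      have "dord (Q + CARD('p)) (W a * dT)" using dord_mult'[OF Wa dord_dT] .
      then have WD: "dord (Suc (Q + CARD('p) - 1)) (W a * dT)" by simp
      have "lc (Suc m) (gE a) \<otimes>\<^bsub>B\<^esub> lc (Suc m) (W a * dT) = lc (Suc m) (gE a * (W a * dT))"
        by (rule lcQ(6)[OF dord_gE WD le])
      moreover have "dord (2 * Q) (gE a * (W a * dT))"
        by (rule dord_mono[OF dord_mult[OF dord_gE WD]]) (use le in simp)
      ultimately show ?thesis using 1 2 unfolding central_mult_def by (simp add: mult.assoc)
    qed
  qed
  then show ?thesis unfolding W(1) by (intro central_mult_sum) auto
qed

lemma gens_dT: "dord (2 * Q) (gE Q * dT :: 'p dst)" "dord (2 * Q) (gF Q * dT :: 'p dst)"
  using dord_mult'[OF dord_gE dT_small, of Q] dord_mult'[OF dord_gF dT_small, of Q] by (simp_all add: mult_2)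

lemma spl_crel:
  assumes "dord (Suc (CARD('p) ^ m)) x" "dord (Suc (CARD('p) ^ m)) (y :: 'p dst)"
  shows "lc (Suc m) (spl x) \<otimes>\<^bsub>B\<^esub> lc (Suc m) (spl y) =
    lc (Suc m) (spl y) \<otimes>\<^bsub>B\<^esub> lc (Suc m) (spl x) \<oplus>\<^bsub>B\<^esub> lc (Suc m) (spl (com x y))"
proof -
  interpret S: level_map B m "CARD('p) ^ m" "\<lambda>x :: 'p dst. lc (Suc m) (spl x)" by (rule spl_level_map)
  let ?q = "CARD('p) ^ m"
  have Q: "CARD('p) * ?q = Q" by (simp add: Q_def)
  have dT: "dT * gE Q = (gE Q * dT :: 'p dst)" "dT * gF Q = (gF Q * dT :: 'p dst)"
    unfolding Q[symmetric] by (rule dT_gE dT_gF)+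
  \<comment> \<open>The commutators of H with E and F are scalar multiples of elements of order
    \<open>Q\<close>, so their products with \<open>\<Delta>\<close> stay in range.\<close>
  have HE: "central_mult (of_int k * gE Q)" "central_mult (of_int k * gF Q)" for k
    using gens_dT by (auto intro!: central_mult_gens dord_of_int dord_gE dord_gF simp: mult.assoc)
  have HE: "central_mult (com (gH Q) (gE Q))" "central_mult (com (gH Q) (gF Q))"
    unfolding com_HE_power[of "Suc m", where 'p = 'p, folded Q_def] com_HF_power[of "Suc m", where 'p = 'p, folded Q_def]
    by (rule HE)+
  have "S.crel (gH ?q) (gE ?q)"
    unfolding S.crel_def spl_com spl_gens Q by (rule pure_crel[OF dord_gH dT_gH dord_gE dT(1) HE(1)])
  moreover have "S.crel (gH ?q) (gF ?q)"
    unfolding S.crel_def spl_com spl_gens Q by (rule pure_crel[OF dord_gH dT_gH dord_gF dT(2) HE(2)])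
  moreover have "S.crel (gF ?q) (gE ?q)"
    unfolding S.crel_def spl_com spl_gens Q by (rule pure_crel[OF dord_gF dT(2) dord_gE dT(1) central_mult_FE])
  ultimately have "S.crel x y" by (rule S.crel_all[OF _ _ _ assms])
  then show ?thesis unfolding S.crel_def .
qed

lemma spl_lift:
  "\<exists>\<phi> \<in> nonunital_alg_hom (U_level m) B. \<phi> \<one>\<^bsub>(U_level m :: ('p mod_ring, 'p ulevel) module)\<^esub> = \<Delta> \<and>
     (\<forall>x :: 'p dst. dord (2 * CARD('p) ^ m) x \<longrightarrow> \<phi> (lc m x) = lc (Suc m) (spl x))"
proof -
  interpret B: kalg B unfolding B_def by (rule U_level_kalg)
  interpret S: level_map B m "CARD('p) ^ m" "\<lambda>x :: 'p dst. lc (Suc m) (spl x)" by (rule spl_level_map)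
  let ?U = "U_level m :: ('p mod_ring, 'p ulevel) module" and ?C = "corner B \<Delta>"
  have D: "\<Delta> = lc (Suc m) (spl 1 :: 'p dst)" by (simp add: \<Delta>_def dT_def)
  have "\<exists>g \<in> alg_hom ?U ?C. \<forall>x :: 'p dst. dord (2 * CARD('p) ^ m) x \<longrightarrow> g (lc m x) = lc (Suc m) (spl x)"
  proof (rule lc_lift[OF corner_kalg[OF B.kalg_axioms Delta_closed Delta_idem]])
    fix x y :: "'p dst" and c :: "'p mod_ring"
    show "lc (Suc m) (spl (1 :: 'p dst)) = \<one>\<^bsub>?C\<^esub>" by (simp add: corner_def D)
    assume x: "dord (2 * CARD('p) ^ m) x"
    \<comment> \<open>\<open>f_unit\<close> says that the image of 1, which is
      \<open>\<Delta>\<close>, acts as a unit on all images; that is membership in the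
      corner.\<close>
    show "lc (Suc m) (spl x) \<in> carrier ?C" using S.f_closed[OF x] S.f_unit[OF x] by (simp add: corner_def D)
    show "lc (Suc m) (spl (of_int (to_int_mod_ring c) * x)) = c \<odot>\<^bsub>?C\<^esub> lc (Suc m) (spl x)"
      by (simp add: corner_def spl_of_int lcQ(7)[OF spl_orders(1)[OF x]])
    assume "dord (2 * CARD('p) ^ m) y"
    with x show "lc (Suc m) (spl (x + y)) = lc (Suc m) (spl x) \<oplus>\<^bsub>?C\<^esub> lc (Suc m) (spl y)"
      using S.f_add by (simp add: corner_def)
  next
    fix x y :: "'p dst"
    assume y: "dord (Suc (CARD('p) ^ m)) y"
    show "lc (Suc m) (spl x) \<otimes>\<^bsub>?C\<^esub> lc (Suc m) (spl y) = lc (Suc m) (spl (x * y))" if "dord (CARD('p) ^ m) x"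
      using S.f_left[OF that y] by (simp add: corner_def)
    assume x: "dord (Suc (CARD('p) ^ m)) x"
    show "lc (Suc m) (spl x) \<otimes>\<^bsub>?C\<^esub> lc (Suc m) (spl y) =
        lc (Suc m) (spl y) \<otimes>\<^bsub>?C\<^esub> lc (Suc m) (spl x) \<oplus>\<^bsub>?C\<^esub> lc (Suc m) (spl (com x y))"
      using spl_crel[OF x y] by (simp add: corner_def)
  qed
  then obtain g where g: "g \<in> alg_hom ?U ?C" "\<And>x :: 'p dst. dord (2 * CARD('p) ^ m) x \<Longrightarrow> g (lc m x) = lc (Suc m) (spl x)" by blast
  then have "g \<in> nonunital_alg_hom ?U B" "g \<one>\<^bsub>?U\<^esub> = \<Delta>"
    by (auto simp: alg_hom_def nonunital_alg_hom_def corner_def)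
  with g show ?thesis by blast
qed

end

theorem proposition2p2p1:
  fixes m :: nat
  assumes "CARD('p::prime_card) > 2"
  shows "let A = (U_level m :: ('p mod_ring, 'p ulevel) module);
             B = (U_level (Suc m) :: ('p mod_ring, 'p ulevel) module)
         in \<exists>\<phi> \<in> nonunital_alg_hom A B.
              splits_on_generators m \<phi> \<and>
              (\<forall>\<psi> \<in> nonunital_alg_hom A B.
                 splits_on_generators m \<psi> \<longrightarrow> (\<forall>u\<in>carrier A. \<psi> u = \<phi> u)) \<and>
              \<phi> \<one>\<^bsub>A\<^esub> = Delta_T (Suc m) \<and>
              (\<forall>u\<in>carrier A. Frobenius m (\<phi> u) = u)"
proof -
  let ?A = "U_level m :: ('p mod_ring, 'p ulevel) module" and ?B = "U_level (Suc m) :: ('p mod_ring, 'p ulevel) module"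
  let ?p = "CARD('p)"
  interpret A: kalg ?A by (rule U_level_kalg)
  obtain \<phi> where \<phi>: "\<phi> \<in> nonunital_alg_hom ?A ?B" "\<phi> \<one>\<^bsub>?A\<^esub> = Delta_T (Suc m)"
    "\<And>x :: 'p dst. dord (2 * ?p ^ m) x \<Longrightarrow> \<phi> (lc m x) = lc (Suc m) (spl x)"
    using spl_lift[of m, where 'p = 'p] unfolding Delta_T_eq[of "Suc m", where 'p = 'p] by blast
  have q: "Suc n \<le> 2 * ?p ^ m" if "n \<le> ?p ^ m" for n
    using that q_pos[of m, where 'p = 'p] by linarith
  have gens: "dord (2 * ?p ^ m) (gE n :: 'p dst)" "dord (2 * ?p ^ m) (gF n :: 'p dst)" "dord (2 * ?p ^ m) (gH n :: 'p dst)"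
    if "n \<le> ?p ^ m" for n
    using dord_mono[OF dord_gE q[OF that]] dord_mono[OF dord_gF q[OF that]] dord_mono[OF dord_gH q[OF that]] by blast+
  have up: "Suc (?p * n) \<le> Suc (?p ^ Suc m)" if "n \<le> ?p ^ m" for n using that by simp
  have spl_gen: "\<phi> (lc m (gE n)) = lc (Suc m) (gE (n * ?p)) \<otimes>\<^bsub>?B\<^esub> Delta_T (Suc m) \<and>
      \<phi> (lc m (gF n)) = lc (Suc m) (gF (n * ?p)) \<otimes>\<^bsub>?B\<^esub> Delta_T (Suc m) \<and>
      \<phi> (lc m (gH n)) = lc (Suc m) (gH (n * ?p)) \<otimes>\<^bsub>?B\<^esub> Delta_T (Suc m)" if n: "n \<le> ?p ^ m" for n
    using gens[OF n] lc_gen_small[OF dT_small dord_mono[OF dord_gE up[OF n]]] lc_gen_small[OF dT_small dord_mono[OF dord_gF up[OF n]]]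
      lc_gen_small[OF dT_small dord_mono[OF dord_gH up[OF n]]]
    by (simp add: \<phi>(3) spl_gens Delta_T_eq mult.commute)
  have split: "splits_on_generators m \<phi>"
    unfolding splits_on_generators_def Let_def level_gens using spl_gen by blast
  have "\<psi> u = \<phi> u" if \<psi>: "\<psi> \<in> nonunital_alg_hom ?A ?B" "splits_on_generators m \<psi>" and u: "u \<in> carrier ?A" for \<psi> u
  proof (rule level_hom_eq[OF U_level_kalg \<psi>(1) \<phi>(1) _ u])
    fix n assume "n \<le> ?p ^ m"
    then show "\<psi> (lc m (gE n)) = \<phi> (lc m (gE n)) \<and> \<psi> (lc m (gF n)) = \<phi> (lc m (gF n)) \<and> \<psi> (lc m (gH n)) = \<phi> (lc m (gH n))"
      using \<psi>(2) split unfolding splits_on_generators_def Let_def level_gens by simp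
  qed
  moreover have "Frobenius m (\<phi> u) = u" if u: "u \<in> carrier ?A" for u
  proof -
    \<comment> \<open>The composite is compared with the identity on generators only, where
      \<open>frob_spl\<close> applies; \<open>level_hom_eq\<close> accepts nonunital
      morphisms.\<close>
    have F: "(\<lambda>u. Frobenius m (\<phi> u)) \<in> nonunital_alg_hom ?A ?A"
      by (rule nonunital_alg_hom_comp[OF \<phi>(1) alg_hom_nonunital[OF Frobenius_lc(1)]])
    have I: "(\<lambda>u. u) \<in> nonunital_alg_hom ?A ?A" by (simp add: nonunital_alg_hom_def)
    show ?thesis
    proof (rule level_hom_eq[OF U_level_kalg F I _ u])
      have "Frobenius m (\<phi> (lc m x)) = lc m x" if "dord (2 * ?p ^ m) x" for x :: "'p dst"
        using that Frobenius_lc(2)[OF spl_orders(1)[OF that]] by (simp add: \<phi>(3) frob_spl)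
      then show "Frobenius m (\<phi> (lc m (gE n))) = lc m (gE n) \<and> Frobenius m (\<phi> (lc m (gF n))) = lc m (gF n) \<and>
          Frobenius m (\<phi> (lc m (gH n))) = lc m (gH n)" if "n \<le> ?p ^ m" for n
        using gens[OF that] by blast
    qed
  qed
  ultimately show ?thesis unfolding Let_def using \<phi>(1,2) split by blast
qed

end
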